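(* For every $n\geqslant 0$ the simplicial complex $\mathcal{C}^n$ is weakly Cohen–Macaulay of dimension $n$: it is $(n-1)$-connected, and for every $p$-simplex $C$ of $\mathcal{C}^n$ the link $\mathrm{lk}_{\mathcal{C}^n}(C)$ is $(n-p-2)$-connected.
   Context: Standing setup: $\Gamma_1$ is an arbitrary finite Coxeter diagram with a preferred vertex $s_1$ (edge $\{s,t\}$ iff $m_{st}\geqslant3$; unlabelled edge means $m_{st}=3$, no edge means $m_{st}=2$). For $n\geqslant 2$, $\Gamma_n$ is obtained from $\Gamma_{n-1}$ by adding one new vertex $s_n$ joined by an unlabelled edge to $s_{n-1}$ and to no other vertex. $\Gamma_0$ is $\Gamma_1$ with $s_1$ deleted; $\Gamma_{-1}$ is $\Gamma_1$ with $s_1$ and all its neighbours deleted. For $n\geqslant -1$, $S_n$ is the vertex set of $\Gamma_n$ and $W_n$ the Coxeter group; $W_m$ ($m\leqslant n$) is the standard parabolic subgroup of $W_n$ generated by $S_m$. Definition of $\mathcal{C}^n$ ($n\geqslant 0$): the abstract simplicial complex with vertex set $W_n/W_{n-1}$ whose $k$-simplices ($0\leqslant k\leqslant n$) are the sets $\{c(s_{n-k+1}\cdots s_n)W_{n-1},\ \ldots,\ cs_nW_{n-1},\ cW_{n-1}\}$ for $c\in W_n$ (these have $k+1$ distinct elements); such $c$ is called a lift of the simplex. The link $\mathrm{lk}(C)$ consists of simplices $D$ with $D\cap C=\emptyset$ and $D\cup C$ a simplex. A space is $(-1)$-connected if nonempty, and $k$-connected for $k\leqslant -2$ vacuously. 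*)

theory Defs
  imports "HOL-Analysis.Analysis" "HOL-Library.Extended_Nat"
begin

text \<open>Gamma_1 is given by a finite vertex set V, a preferred vertex s1 and a Coxeter
 matrix m (values in enat; infinity allowed).  Vertices of Gamma_n live in type 'g + nat:
 the old vertices are Inl a, and the new vertex s_k (k >= 2) is Inr k; s_1 = Inl s1.\<close>

definition sv :: "'g \<Rightarrow> nat \<Rightarrow> 'g + nat" where
  "sv s1 k = (if k = 1 then Inl s1 else Inr k)"

definition Sset :: "'g set \<Rightarrow> 'g \<Rightarrow> nat \<Rightarrow> ('g + nat) set" where
  "Sset V s1 n = Inl ` (V - {s1}) \<union> sv s1 ` {1..n}"

text \<open>S_{-1}: delete s1 and its neighbours (those a with m s1 a >= 3).\<close>
definition Sm1 :: "'g set \<Rightarrow> 'g \<Rightarrow> ('g \<Rightarrow> 'g \<Rightarrow> enat) \<Rightarrow> ('g + nat) set" where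
  "Sm1 V s1 m = Inl ` {a \<in> V - {s1}. m s1 a = 2}"

definition Sprev :: "'g set \<Rightarrow> 'g \<Rightarrow> ('g \<Rightarrow> 'g \<Rightarrow> enat) \<Rightarrow> nat \<Rightarrow> ('g + nat) set" where
  "Sprev V s1 m n = (if n = 0 then Sm1 V s1 m else Sset V s1 (n - 1))"

definition chain_adj :: "'g \<Rightarrow> 'g + nat \<Rightarrow> 'g + nat \<Rightarrow> bool" where
  "chain_adj s1 x y = (\<exists>k\<ge>1. (x = sv s1 k \<and> y = sv s1 (Suc k)) \<or> (y = sv s1 k \<and> x = sv s1 (Suc k)))"

definition Mext :: "'g \<Rightarrow> ('g \<Rightarrow> 'g \<Rightarrow> enat) \<Rightarrow> 'g + nat \<Rightarrow> 'g + nat \<Rightarrow> enat" where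
  "Mext s1 m x y =
     (if x = y then 1
      else (case (x, y) of
              (Inl a, Inl b) \<Rightarrow> m a b
            | _ \<Rightarrow> (if chain_adj s1 x y then 3 else 2)))"

text \<open>The Coxeter group with generating set S and Coxeter matrix M is the set of words
 over S modulo the congruence generated by the relators s s and (s t)^(M s t)
 (M s t finite).  Since every generator is an involution, this monoid quotient is the group
 with the Coxeter presentation.\<close>

inductive cox_eq :: "('v \<Rightarrow> 'v \<Rightarrow> enat) \<Rightarrow> 'v set \<Rightarrow> 'v list \<Rightarrow> 'v list \<Rightarrow> bool"
  for M :: "'v \<Rightarrow> 'v \<Rightarrow> enat" and S :: "'v set" where
  cox_refl: "w \<in> lists S \<Longrightarrow> cox_eq M S w w"
| cox_sym: "cox_eq M S u w \<Longrightarrow> cox_eq M S w u"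
| cox_trans: "cox_eq M S u v \<Longrightarrow> cox_eq M S v w \<Longrightarrow> cox_eq M S u w"
| cox_sq: "xs \<in> lists S \<Longrightarrow> ys \<in> lists S \<Longrightarrow> s \<in> S \<Longrightarrow>
             cox_eq M S (xs @ [s, s] @ ys) (xs @ ys)"
| cox_rel: "xs \<in> lists S \<Longrightarrow> ys \<in> lists S \<Longrightarrow> s \<in> S \<Longrightarrow> t \<in> S \<Longrightarrow> M s t = enat k \<Longrightarrow>
             cox_eq M S (xs @ concat (replicate k [s, t]) @ ys) (xs @ ys)"

text \<open>The coset c W_T in the Coxeter group on S (as the set of all words representing its
 elements); W_T is the standard parabolic subgroup generated by T.\<close>
definition coset :: "('v \<Rightarrow> 'v \<Rightarrow> enat) \<Rightarrow> 'v set \<Rightarrow> 'v set \<Rightarrow> 'v list \<Rightarrow> 'v list set" where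
  "coset M S T c = {w. \<exists>u \<in> lists T. cox_eq M S (c @ u) w}"

definition vtx :: "'g set \<Rightarrow> 'g \<Rightarrow> ('g \<Rightarrow> 'g \<Rightarrow> enat) \<Rightarrow> nat \<Rightarrow> ('g + nat) list
                    \<Rightarrow> ('g + nat) list set" where
  "vtx V s1 m n c = coset (Mext s1 m) (Sset V s1 n) (Sprev V s1 m n) c"

text \<open>The k-simplex with lift c:
 {c s_{n-k+1}...s_n W_{n-1}, ..., c s_n W_{n-1}, c W_{n-1}}.\<close>
definition simplex_of :: "'g set \<Rightarrow> 'g \<Rightarrow> ('g \<Rightarrow> 'g \<Rightarrow> enat) \<Rightarrow> nat \<Rightarrow> ('g + nat) list \<Rightarrow> nat
                          \<Rightarrow> ('g + nat) list set set" where
  "simplex_of V s1 m n c k =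
     {vtx V s1 m n (c @ map (sv s1) [j..<Suc n]) | j. Suc n - k \<le> j \<and> j \<le> Suc n}"

definition Cn :: "'g set \<Rightarrow> 'g \<Rightarrow> ('g \<Rightarrow> 'g \<Rightarrow> enat) \<Rightarrow> nat \<Rightarrow> ('g + nat) list set set set" where
  "Cn V s1 m n = {simplex_of V s1 m n c k | c k. c \<in> lists (Sset V s1 n) \<and> k \<le> n}"

definition link :: "'a set set \<Rightarrow> 'a set \<Rightarrow> 'a set set" where
  "link K C = {D \<in> K. D \<inter> C = {} \<and> D \<union> C \<in> K}"

definition closed_simplex :: "'a set \<Rightarrow> ('a \<Rightarrow> real) set" where
  "closed_simplex s = {f. (\<forall>v. 0 \<le> f v) \<and> (\<forall>v. v \<notin> s \<longrightarrow> f v = 0) \<and> sum f s = 1}"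

definition realization :: "'a set set \<Rightarrow> ('a \<Rightarrow> real) set" where
  "realization K = (\<Union>s\<in>K. closed_simplex s)"

text \<open>The (weak / coherent) topology: U is open iff its trace on every closed simplex is open
 in the Euclidean topology of that simplex (product topology on 'a => real).\<close>
definition geom_top :: "'a set set \<Rightarrow> ('a \<Rightarrow> real) topology" where
  "geom_top K = topology (\<lambda>U. U \<subseteq> realization K \<and>
      (\<forall>s\<in>K. openin (subtopology euclidean (closed_simplex s)) (U \<inter> closed_simplex s)))"

text \<open>Unit sphere S^{d-1} and unit disk D^d in R^d, embedded in nat => real.\<close>
definition sphere_d :: "nat \<Rightarrow> (nat \<Rightarrow> real) set" where
  "sphere_d d = {x. (\<forall>j\<ge>d. x j = 0) \<and> (\<Sum>j<d. (x j)\<^sup>2) = 1}"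

definition disk_d :: "nat \<Rightarrow> (nat \<Rightarrow> real) set" where
  "disk_d d = {x. (\<forall>j\<ge>d. x j = 0) \<and> (\<Sum>j<d. (x j)\<^sup>2) \<le> 1}"

text \<open>k-connected: every map S^i -> X with -1 <= i <= k extends over D^{i+1}
 (i = -1 means X nonempty; vacuous for k <= -2).\<close>
definition k_connected :: "'b topology \<Rightarrow> int \<Rightarrow> bool" where
  "k_connected X k = (\<forall>d::nat. int d \<le> k + 1 \<longrightarrow>
     (\<forall>g. continuous_map (subtopology euclidean (sphere_d d)) X g \<longrightarrow>
        (\<exists>h. continuous_map (subtopology euclidean (disk_d d)) X h \<and>
             (\<forall>x\<in>sphere_d d. h x = g x))))"

end

theory Submission
  imports Defs
begin

text \<open>The complex is shellable. Right multiplication by \<open>s_i\<close> permutes the vertices of the \<open>n\<close>-simplex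
  with lift \<open>c\<close>, multiplication by \<open>S_{-1}\<close> fixes them, and multiplication by any other generator moves
  only one. Order the \<open>n\<close>-simplices \<open>A\<close> by the least length \<open>l(A)\<close> of a lift. By the exchange condition,
  lengthening a lift by one generator fixes the simplex or increases \<open>l\<close>. If \<open>A \<noteq> B\<close> and
  \<open>l(B) \<le> l(A)\<close>, suitable lifts lie in one coset \<open>e W_R\<close>, where \<open>W_R\<close> is the pointwise stabiliser of
  \<open>A \<inter> B\<close>; descending from \<open>A\<close> to the shortest element of this coset must leave \<open>A\<close>, at first into a
  simplex with smaller \<open>l\<close> that shares with \<open>A\<close> a facet containing \<open>A \<inter> B\<close>. Links inherit the
  shelling.

  In a shelled complex a map from a sphere of dimension less than \<open>n\<close> has image in finitely many
  simplices, and can be pushed off the last of them: if the last simplex is attached along its whole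
  boundary, first perturb the map to miss an interior point.\<close>

section \<open>The exchange condition\<close>

text \<open>The algebraic obstacle is that pointwise stabilisers must be standard parabolic. This
  comes down to the identity that W_{j-1} and s_j W_{j-1} s_j intersect in W_{j-2}, and it needs a
  presentation that does not collapse: distinct generators stay distinct and commute only if m_{st}
  = 2. The geometric representation supplies this.

  The descent is best read upwards: along a shortest word from the shortest element of e W_R to a
  lift of A or B, every letter increases the length, so every step keeps the simplex or raises l.
  Hence the simplex at the bottom is B or has l below l(B), and in both cases it is not A. The
  letter that enters A changes the simplex, so it is none of s_1, ..., s_n and can move the first
  vertex only.

  W_n may be infinite, but finitely many generators leave only finitely many simplices with l below
  a given bound.

  The topological obstacle is that a continuous map of a low-dimensional sphere may still fill an
  n-simplex. A Lipschitz approximation cannot, by comparing the number of small cells covering the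
  sphere with the number of points of a fine grid.\<close>

lemma rev_in_lists_iff [simp]: "rev w \<in> lists A \<longleftrightarrow> w \<in> lists A"
  by (simp add: in_lists_conv_set)

section \<open>Words modulo the Coxeter relations, with reversal as inversion\<close>

context
  fixes M :: "'v \<Rightarrow> 'v \<Rightarrow> enat" and S :: "'v set"
begin

abbreviation ceq (infix "\<doteq>" 50) where "u \<doteq> w \<equiv> cox_eq M S u w"

lemma cox_eq_lists:
  assumes "u \<doteq> w"
  shows "u \<in> lists S" "w \<in> lists S"
proof -
  have "set (concat (replicate k [s, t])) \<subseteq> {s, t}" for k and s t :: 'v
    by (induction k) auto
  with assms have "u \<in> lists S \<and> w \<in> lists S"
    by (induction) (force simp: in_lists_conv_set)+
  thus "u \<in> lists S" "w \<in> lists S" by auto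
qed

lemma cox_eq_context:
  assumes "u \<doteq> w" "a \<in> lists S" "b \<in> lists S"
  shows "a @ u @ b \<doteq> a @ w @ b"
  using assms
proof (induction)
  case (cox_refl w)
  then show ?case by (intro cox_eq.cox_refl) auto
next
  case (cox_sq xs ys s)
  then show ?case using cox_eq.cox_sq[of "a @ xs" S "ys @ b" s M] by simp
next
  case (cox_rel xs ys s t k)
  then show ?case using cox_eq.cox_rel[of "a @ xs" S "ys @ b" s t M k] by simp
qed (blast intro: cox_eq.intros)+

lemma cox_eq_append:
  assumes "u \<doteq> u'" "v \<doteq> v'"
  shows "u @ v \<doteq> u' @ v'"
proof -
  have "u @ v \<doteq> u' @ v"
    using cox_eq_context[OF assms(1), of "[]" v] cox_eq_lists[OF assms(2)] by simp
  moreover have "u' @ v \<doteq> u' @ v'"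
    using cox_eq_context[OF assms(2), of u' "[]"] cox_eq_lists[OF assms(1)] by simp
  ultimately show ?thesis by (rule cox_trans)
qed

lemma cox_eq_double: "s \<in> S \<Longrightarrow> [s, s] \<doteq> []"
  using cox_sq[of "[]" S "[]" s M] by simp

lemma cox_eq_append_rev:
  assumes "w \<in> lists S"
  shows "w @ rev w \<doteq> []"
  using assms
proof (induction w)
  case Nil
  then show ?case by (simp add: cox_eq.cox_refl)
next
  case (Cons a w)
  have "[a] @ (w @ rev w) @ [a] \<doteq> [a] @ [] @ [a]"
    using Cons by (intro cox_eq_context) auto
  moreover have "[a, a] \<doteq> []" using Cons by (intro cox_eq_double) auto
  ultimately show ?case by (auto intro: cox_trans)
qed

lemma cox_eq_rev_append: "w \<in> lists S \<Longrightarrow> rev w @ w \<doteq> []"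
  using cox_eq_append_rev[of "rev w"] by simp

lemma cox_eq_append_left: "a \<in> lists S \<Longrightarrow> u \<doteq> w \<Longrightarrow> a @ u \<doteq> a @ w"
  by (intro cox_eq_append cox_eq.cox_refl)

lemma cox_eq_append_right: "b \<in> lists S \<Longrightarrow> u \<doteq> w \<Longrightarrow> u @ b \<doteq> w @ b"
  by (intro cox_eq_append cox_eq.cox_refl)

lemma cox_eq_cancel_mid:
  assumes "r \<doteq> []" "a \<in> lists S" "b \<in> lists S"
  shows "a @ r @ b \<doteq> a @ b"
  using cox_eq_context[OF assms] by simp

lemma cox_eq_move_left:
  assumes "a \<in> lists S" "w \<in> lists S"
  shows "a @ u \<doteq> w \<longleftrightarrow> u \<doteq> rev a @ w"
proof
  assume *: "a @ u \<doteq> w"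
  hence u: "u \<in> lists S" using cox_eq_lists by fastforce
  have "rev a @ (a @ u) \<doteq> rev a @ w"
    using * assms by (intro cox_eq_append cox_eq.cox_refl) auto
  moreover have "rev a @ a @ u \<doteq> u"
    using cox_eq_cancel_mid[OF cox_eq_rev_append, of a "[]" u] assms u by simp
  ultimately show "u \<doteq> rev a @ w" by (metis cox_trans cox_sym append_assoc)
next
  assume *: "u \<doteq> rev a @ w"
  have "a @ u \<doteq> a @ (rev a @ w)"
    using * assms by (intro cox_eq_append cox_eq.cox_refl) auto
  moreover have "a @ rev a @ w \<doteq> w"
    using cox_eq_cancel_mid[OF cox_eq_append_rev, of a "[]" w] assms by simp
  ultimately show "a @ u \<doteq> w" by (metis cox_trans append_assoc)
qed

lemma cox_eq_move_right:
  assumes "b \<in> lists S" "w \<in> lists S"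
  shows "u @ b \<doteq> w \<longleftrightarrow> u \<doteq> w @ rev b"
proof
  assume *: "u @ b \<doteq> w"
  hence u: "u \<in> lists S" using cox_eq_lists by fastforce
  have "(u @ b) @ rev b \<doteq> w @ rev b"
    using * assms by (intro cox_eq_append cox_eq.cox_refl) auto
  moreover have "u @ b @ rev b \<doteq> u"
    using cox_eq_cancel_mid[OF cox_eq_append_rev, of b u "[]"] assms u by simp
  ultimately show "u \<doteq> w @ rev b" by (metis cox_trans cox_sym append_assoc)
next
  assume *: "u \<doteq> w @ rev b"
  have "u @ b \<doteq> (w @ rev b) @ b"
    using * assms by (intro cox_eq_append cox_eq.cox_refl) auto
  moreover have "w @ rev b @ b \<doteq> w"
    using cox_eq_cancel_mid[OF cox_eq_rev_append, of b w "[]"] assms by simp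
  ultimately show "u @ b \<doteq> w" by (metis cox_trans append_assoc)
qed

lemma cox_eq_cancel_left: "a \<in> lists S \<Longrightarrow> a @ u \<doteq> a @ w \<longleftrightarrow> u \<doteq> w"
proof
  assume a: "a \<in> lists S" and *: "a @ u \<doteq> a @ w"
  have w: "w \<in> lists S" using cox_eq_lists[OF *] by auto
  from * a w have "u \<doteq> rev a @ a @ w" using cox_eq_move_left[of a "a @ w" u] by simp
  moreover have "rev a @ a @ w \<doteq> w"
    using cox_eq_cancel_mid[OF cox_eq_rev_append, of a "[]" w] a w by simp
  ultimately show "u \<doteq> w" by (rule cox_trans)
qed (auto intro: cox_eq_append cox_eq.cox_refl)

lemma cox_eq_cancel_right: "b \<in> lists S \<Longrightarrow> u @ b \<doteq> w @ b \<longleftrightarrow> u \<doteq> w"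
proof
  assume a: "b \<in> lists S" and *: "u @ b \<doteq> w @ b"
  have w: "w \<in> lists S" using cox_eq_lists[OF *] by auto
  from * a w have "u \<doteq> w @ b @ rev b" using cox_eq_move_right[of b "w @ b" u] by simp
  moreover have "w @ b @ rev b \<doteq> w"
    using cox_eq_cancel_mid[OF cox_eq_append_rev, of b w "[]"] a w by simp
  ultimately show "u \<doteq> w" by (rule cox_trans)
qed (auto intro: cox_eq_append cox_eq.cox_refl)

lemma cox_eq_cong_left: "u \<doteq> u' \<Longrightarrow> u \<doteq> w \<longleftrightarrow> u' \<doteq> w"
  by (meson cox_sym cox_trans)

lemma cox_eq_cong_right: "w \<doteq> w' \<Longrightarrow> u \<doteq> w \<longleftrightarrow> u \<doteq> w'"
  by (meson cox_sym cox_trans)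

lemma concat_replicate_lists: "s \<in> S \<Longrightarrow> t \<in> S \<Longrightarrow> concat (replicate k [s, t]) \<in> lists S"
  by (induction k) auto

lemma cox_eq_relator: "s \<in> S \<Longrightarrow> t \<in> S \<Longrightarrow> M s t = enat k \<Longrightarrow> concat (replicate k [s, t]) \<doteq> []"
  using cox_rel[of "[]" S "[]" s t M k] by simp

lemma cox_eq_commute:
  assumes "s \<in> S" "t \<in> S" "M s t = 2"
  shows "[s, t] \<doteq> [t, s]"
proof -
  have "[s, t, s, t] \<doteq> []"
    using cox_eq_relator[of s t 2] assms by (simp add: eval_nat_numeral numeral_eq_enat)
  with assms show ?thesis using cox_eq_move_right[of "[s,t]" "[]" "[s,t]"] by simp
qed

lemma cox_eq_braid:
  assumes "s \<in> S" "t \<in> S" "M s t = 3"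
  shows "[s, t, s] \<doteq> [t, s, t]"
proof -
  have "[s, t, s, t, s, t] \<doteq> []"
    using cox_eq_relator[of s t 3] assms by (simp add: eval_nat_numeral numeral_eq_enat)
  with assms show ?thesis using cox_eq_move_right[of "[t,s,t]" "[]" "[s,t,s]"] by simp
qed

text \<open>All relators have even length, so the sign character is well defined. It is what turns
  "not longer" into "shorter" when a generator is appended.\<close>

lemma cox_eq_parity:
  assumes "u \<doteq> w"
  shows "even (length u) = even (length w)"
  using assms
proof (induction)
  case (cox_rel xs ys s t k)
  have "even (length (concat (replicate k [s, t])))" for s t :: 'v by (induction k) auto
  then show ?case by auto
qed auto

text \<open>The parity of the number of \<open>i\<close> with \<open>w_1 \<dots> w_i \<dots> w_1 = t\<close> in the group. Its invariance
  under the relations yields the strong exchange property.\<close>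

primrec refl_odd :: "'v list \<Rightarrow> 'v list \<Rightarrow> bool" where
  "refl_odd [] t = False"
| "refl_odd (a # w) t = (([a] \<doteq> t) \<noteq> refl_odd w (a # t @ [a]))"

lemma refl_odd_cong:
  assumes "w \<in> lists S" "t \<doteq> t'"
  shows "refl_odd w t = refl_odd w t'"
  using assms
proof (induction w arbitrary: t t' rule: list.induct)
  case (Cons a w)
  have "a # t @ [a] \<doteq> a # t' @ [a]"
    using cox_eq_context[OF Cons.prems(2), of "[a]" "[a]"] Cons.prems by simp
  with Cons.IH Cons.prems show ?case using cox_eq_cong_right[OF Cons.prems(2)] by auto
qed simp

text \<open>With N(w) the set of reflections counted oddly in w, this is the cocycle rule N(uv) =
  N(u) + u N(v) u^{-1}, where + is symmetric difference.\<close>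

lemma refl_odd_append: "refl_odd (u @ v) t = (refl_odd u t \<noteq> refl_odd v (rev u @ t @ u))"
  by (induction u arbitrary: t) auto

lemma refl_odd_double:
  assumes "s \<in> S" "t \<in> lists S"
  shows "\<not> refl_odd [s, s] t"
proof -
  have "[s] \<doteq> [s] @ t @ [s] \<longleftrightarrow> [] @ [s] \<doteq> ([s] @ t) @ [s]" by simp
  also have "\<dots> \<longleftrightarrow> [s] @ t \<doteq> []"
    using assms by (subst cox_eq_cancel_right) (auto intro: cox_sym)
  also have "\<dots> \<longleftrightarrow> t \<doteq> [s]" using assms by (subst cox_eq_move_left) auto
  finally show ?thesis by (auto intro: cox_sym)
qed

text \<open>Counting from 0, the i-th of the 2k letters of (st)^k yields the reflection (st)^i s.
  Peeling off one block \<open>[s, t]\<close> conjugates by st and shifts \<open>i\<close> by 2; the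
  terms i = 0 and i = 1 come from the two letters removed.\<close>

lemma refl_odd_dihedral:
  assumes "s \<in> S" "t \<in> S" "r \<in> lists S"
  shows "refl_odd (concat (replicate k [s, t])) r =
         odd (card {i. i < 2 * k \<and> concat (replicate i [s, t]) @ [s] \<doteq> r})"
  using assms(3)
proof (induction k arbitrary: r)
  case 0
  then show ?case by simp
next
  case (Suc k)
  let ?c = "\<lambda>i. concat (replicate i [s, t])"
  let ?r = "[t, s] @ r @ [s, t]"
  have c: "?c i \<in> lists S" for i using assms concat_replicate_lists by auto
  have crep: "?c i @ [s, t] = [s, t] @ ?c i" for i by (induction i) auto
  have shift: "?c i @ [s] \<doteq> ?r \<longleftrightarrow> ?c (i + 2) @ [s] \<doteq> r" for i
  proof -
    have "?c i @ [s] \<doteq> ?r \<longleftrightarrow> [t, s] @ r @ [s, t] \<doteq> ?c i @ [s]" by (auto intro: cox_sym)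
    also have "\<dots> \<longleftrightarrow> r @ [s, t] \<doteq> [s, t] @ ?c i @ [s]"
      using assms c[of i] by (subst cox_eq_move_left) auto
    also have "\<dots> \<longleftrightarrow> r \<doteq> [s, t] @ ?c i @ [s] @ [t, s]"
      using assms c[of i] Suc.prems by (subst cox_eq_move_right) auto
    also have "[s, t] @ ?c i @ [s] @ [t, s] = ?c (i + 2) @ [s]"
      using crep[of i] by simp
    finally show ?thesis by (auto intro: cox_sym)
  qed
  have 1: "[t] \<doteq> s # r @ [s] \<longleftrightarrow> ?c 1 @ [s] \<doteq> r"
  proof -
    have "[t] \<doteq> s # r @ [s] \<longleftrightarrow> [s] @ (r @ [s]) \<doteq> [t]" by (auto intro: cox_sym)
    also have "\<dots> \<longleftrightarrow> r @ [s] \<doteq> [s, t]"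
      using assms by (subst cox_eq_move_left) auto
    also have "\<dots> \<longleftrightarrow> r \<doteq> [s, t] @ [s]"
      using assms by (subst cox_eq_move_right) auto
    finally show ?thesis by (auto intro: cox_sym)
  qed
  let ?E = "\<lambda>i. ?c i @ [s] \<doteq> r"
  have set_eq: "{i. i < 2 * Suc k \<and> ?E i} =
      ({i. i = 0 \<and> ?E 0} \<union> {i. i = 1 \<and> ?E 1}) \<union> (\<lambda>i. i + 2) ` {i. i < 2 * k \<and> ?E (i + 2)}"
    (is "?L = (?A \<union> ?B) \<union> ?C")
  proof (intro set_eqI iffI)
    fix i assume "i \<in> ?L"
    then show "i \<in> (?A \<union> ?B) \<union> ?C"
      by (cases i; cases "i - 1") (auto simp: image_iff intro!: exI[of _ "i - 2"])
  qed auto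
  have "card ?L = card (?A \<union> ?B) + card ?C"
    unfolding set_eq by (intro card_Un_disjoint) auto
  also have "card (?A \<union> ?B) = card ?A + card ?B" by (intro card_Un_disjoint) auto
  also have "card ?C = card {i. i < 2 * k \<and> ?E (i + 2)}" by (intro card_image inj_onI) auto
  also have "card ?A = of_bool (?E 0)" by auto
  also have "card ?B = of_bool (?E 1)" by auto
  finally have card: "card ?L = of_bool (?E 0) + of_bool (?E 1) + card {i. i < 2 * k \<and> ?E (i + 2)}" .
  have "refl_odd (?c (Suc k)) r = (?E 0 \<noteq> (?E 1 \<noteq> refl_odd (?c k) ?r))"
    using 1 by simp
  also have "refl_odd (?c k) ?r = odd (card {i. i < 2 * k \<and> ?E (i + 2)})"
    using Suc.IH[of ?r] Suc.prems assms shift by simp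
  finally show ?case unfolding card by auto
qed

text \<open>Since (st)^k = 1, the reflections (st)^i s with i < 2k repeat with period k, so each is
  counted an even number of times.\<close>

lemma refl_odd_relator:
  assumes "s \<in> S" "t \<in> S" "r \<in> lists S" "M s t = enat k"
  shows "\<not> refl_odd (concat (replicate k [s, t])) r"
proof -
  let ?c = "\<lambda>i. concat (replicate i [s, t])"
  let ?E = "\<lambda>i. ?c i @ [s] \<doteq> r"
  have c: "?c i \<in> lists S" for i using assms concat_replicate_lists by auto
  have "?c (i + k) @ [s] \<doteq> ?c i @ [s]" for i
    using cox_eq_cancel_mid[OF cox_eq_relator[OF assms(1,2,4)], of "?c i" "[s]"] assms c
    by (simp add: replicate_add)
  hence E: "?E (i + k) \<longleftrightarrow> ?E i" for i by (rule cox_eq_cong_left)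
  have "{i. i < 2 * k \<and> ?E i} = {i. i < k \<and> ?E i} \<union> (\<lambda>i. i + k) ` {i. i < k \<and> ?E i}"
    (is "?L = ?A \<union> ?B")
  proof (intro set_eqI iffI)
    fix i assume "i \<in> ?L"
    then show "i \<in> ?A \<union> ?B"
      using E[of "i - k"] by (cases "i < k") (auto simp: image_iff intro!: exI[of _ "i - k"])
  qed (use E in auto)
  moreover have "card (?A \<union> ?B) = card ?A + card ?B" by (intro card_Un_disjoint) auto
  moreover have "card ?B = card ?A" by (intro card_image inj_onI) auto
  ultimately show ?thesis by (subst refl_odd_dihedral) (use assms in auto)
qed

text \<open>Being trivial in the group, \<open>r\<close> does not change the conjugation seen by the
  letters of \<open>ys\<close>, and by assumption it contributes nothing itself.\<close>

lemma refl_odd_insert_trivial: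
  assumes "xs \<in> lists S" "ys \<in> lists S" "r \<doteq> []" "t \<in> lists S"
    and "\<And>t. t \<in> lists S \<Longrightarrow> \<not> refl_odd r t"
  shows "refl_odd (xs @ r @ ys) t = refl_odd (xs @ ys) t"
proof -
  let ?t = "rev xs @ t @ xs"
  have r: "r \<in> lists S" using assms cox_eq_lists by blast
  have "rev r @ [] \<doteq> []"
    using cox_eq_move_left[of r "[]" "[]"] assms(3) r by (auto intro: cox_sym)
  hence "rev r @ ?t @ r \<doteq> [] @ ?t @ []"
    using assms by (intro cox_eq_append cox_eq.cox_refl) auto
  hence "refl_odd ys (rev r @ ?t @ r) = refl_odd ys ?t"
    using assms by (intro refl_odd_cong) auto
  thus ?thesis using assms(5)[of ?t] assms(1,4) by (simp add: refl_odd_append)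
qed

lemma refl_odd_invariant:
  assumes "u \<doteq> w" "t \<in> lists S"
  shows "refl_odd u t = refl_odd w t"
  using assms
proof (induction)
  case (cox_sq xs ys s)
  thus ?case
    using refl_odd_insert_trivial[of xs ys "[s, s]" t] refl_odd_double cox_eq_double by blast
next
  case (cox_rel xs ys s t' k)
  thus ?case
    using refl_odd_insert_trivial[of xs ys "concat (replicate k [s, t'])" t]
      refl_odd_relator cox_eq_relator by blast
qed auto

text \<open>An odd count is positive, so some prefix of \<open>w\<close> yields \<open>t\<close>.
  Multiplying \<open>w\<close> on the left by this \<open>t\<close> deletes the letter
  \<open>r\<close>, which is how the lemma is applied.\<close>

lemma refl_odd_imp_conjugate:
  assumes "refl_odd w t" "w \<in> lists S" "t \<in> lists S"
  shows "\<exists>a r b. w = a @ [r] @ b \<and> t \<doteq> a @ [r] @ rev a"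
  using assms
proof (induction w arbitrary: t)
  case (Cons c w)
  show ?case
  proof (cases "[c] \<doteq> t")
    case True
    thus ?thesis by (intro exI[of _ "[]"]) (auto intro: cox_sym)
  next
    case False
    with Cons.prems Cons.IH[of "c # t @ [c]"] obtain a r b
      where *: "w = a @ [r] @ b" "[c] @ (t @ [c]) \<doteq> a @ [r] @ rev a" by auto
    have "t @ [c] \<doteq> [c] @ a @ [r] @ rev a"
      using cox_eq_move_left[of "[c]" "a @ [r] @ rev a" "t @ [c]"] * Cons.prems by auto
    hence "t \<doteq> ([c] @ a @ [r] @ rev a) @ [c]"
      using cox_eq_move_right[of "[c]" "[c] @ a @ [r] @ rev a" t] * Cons.prems by auto
    thus ?thesis using *(1) by (intro exI[of _ "c # a"] exI[of _ r] exI[of _ b]) auto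
  qed
qed simp

section \<open>Length, the exchange condition and reduced words in parabolic subgroups\<close>

definition clen :: "'v list \<Rightarrow> nat" where
  "clen w = (LEAST k. \<exists>v. w \<doteq> v \<and> length v = k)"

lemma clen_le: "w \<doteq> v \<Longrightarrow> clen w \<le> length v"
  unfolding clen_def by (rule Least_le) auto

lemma clen_witness: "w \<in> lists S \<Longrightarrow> \<exists>v. w \<doteq> v \<and> length v = clen w"
  unfolding clen_def by (rule LeastI_ex) (auto intro: cox_eq.cox_refl)

lemma clen_cong: "u \<doteq> w \<Longrightarrow> clen u = clen w"
  using cox_eq_cong_left[of u w] by (simp add: clen_def)

lemma clen_parity: "w \<in> lists S \<Longrightarrow> even (clen w) = even (length w)"
  using clen_witness cox_eq_parity by metis

lemma clen_snoc_neq: "w \<in> lists S \<Longrightarrow> s \<in> S \<Longrightarrow> clen (w @ [s]) \<noteq> clen w"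
  using clen_parity[of w] clen_parity[of "w @ [s]"] by fastforce

text \<open>Let v be a reduced word of x s and t = v s v^{-1} = x s x^{-1}. If t were counted oddly
  in v, deleting a letter of v would give a word of x shorter than v. So the last letter of v s
  makes t odd there, and by invariance t is odd in every word \<open>w\<close> of \<open>x\<close>,
  reduced or not; deletion in \<open>w\<close> gives the claim.\<close>

lemma exchange:
  assumes "x \<in> lists S" "s \<in> S" "clen (x @ [s]) < clen x" "x \<doteq> w"
  shows "\<exists>a r b. w = a @ [r] @ b \<and> x @ [s] \<doteq> a @ b"
proof -
  have w: "w \<in> lists S" using assms cox_eq_lists by blast
  \<comment> \<open>If y s y^{-1} is counted oddly in y, it equals a r a^{-1} with y = a r b;
    multiplying y by it on the left gives y s in one form and a b in the other.\<close>
  have del: "\<exists>a r b. y = a @ [r] @ b \<and> y @ [s] \<doteq> a @ b"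
    if "refl_odd y (y @ [s] @ rev y)" "y \<in> lists S" for y
  proof -
    from refl_odd_imp_conjugate[OF that] that(2) assms(2) obtain a r b
      where y: "y = a @ [r] @ b" and eq: "y @ [s] @ rev y \<doteq> a @ [r] @ rev a" by auto
    have S: "a \<in> lists S" "b \<in> lists S" "r \<in> S" using y that by auto
    have "(y @ [s]) @ rev y \<doteq> a @ [r] @ rev a" using eq by simp
    hence "y @ [s] \<doteq> a @ ([r] @ (rev a @ a) @ [r]) @ b"
      using cox_eq_move_right[of "rev y" "a @ [r] @ rev a" "y @ [s]"] y S by auto
    moreover have "a @ ([r] @ (rev a @ a) @ [r]) @ b \<doteq> a @ [] @ b"
    proof (intro cox_eq_context S)
      have "[r] @ (rev a @ a) @ [r] \<doteq> [r] @ [] @ [r]"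
        using S by (intro cox_eq_context cox_eq_rev_append) auto
      thus "[r] @ (rev a @ a) @ [r] \<doteq> []"
        using cox_eq_double[OF S(3)] by (auto intro: cox_trans)
    qed
    ultimately have "y @ [s] \<doteq> a @ b" by (auto intro: cox_trans)
    with y show ?thesis by blast
  qed
  obtain v where v: "x @ [s] \<doteq> v" "length v = clen (x @ [s])"
    using clen_witness[of "x @ [s]"] assms by auto
  have vS: "v \<in> lists S" using v cox_eq_lists by blast
  have xv: "x \<doteq> v @ [s]" using cox_eq_move_right[of "[s]" v x] v vS assms by simp
  have not: "\<not> refl_odd v (v @ [s] @ rev v)"
  proof
    assume "refl_odd v (v @ [s] @ rev v)"
    from del[OF this vS] obtain a r b where "v = a @ [r] @ b" "v @ [s] \<doteq> a @ b" by blast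
    moreover from this have "clen x \<le> length (a @ b)"
      using xv clen_le cox_trans by blast
    ultimately show False using v(2) assms(3) by simp
  qed
  have "rev v @ (v @ [s] @ rev v) @ v \<doteq> [] @ [s] @ []"
    using cox_eq_append[OF cox_eq_rev_append[OF vS] cox_eq_append[OF cox_eq.cox_refl[of "[s]"] cox_eq_rev_append[OF vS]]]
      assms(2) by simp
  hence "[s] \<doteq> rev v @ (v @ [s] @ rev v) @ v" by (simp add: cox_sym)
  hence "refl_odd (v @ [s]) (v @ [s] @ rev v)"
    using not by (simp add: refl_odd_append)
  moreover have wv: "w \<doteq> v @ [s]" using assms(4) xv by (meson cox_sym cox_trans)
  ultimately have "refl_odd w (v @ [s] @ rev v)"
    using refl_odd_invariant[OF wv] vS assms(2) by auto
  moreover have "w @ [s] @ rev w \<doteq> v @ [s] @ rev v"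
  proof -
    have "w @ [s] \<doteq> v"
      using assms v by (meson cox_eq_append cox_eq.cox_refl cox_sym cox_trans lists.intros)
    hence "rev v @ w @ [s] \<doteq> []"
      using cox_eq_move_left[of "rev v" "[]" "w @ [s]"] vS by simp
    hence "rev v \<doteq> [s] @ rev w"
      using cox_eq_move_right[of "w @ [s]" "[]" "rev v"] w assms by simp
    moreover have "w @ ([s] @ rev w) \<doteq> (v @ [s]) @ ([s] @ rev w)"
      using wv w assms by (intro cox_eq_append cox_eq.cox_refl) auto
    ultimately have "w @ ([s] @ rev w) \<doteq> (v @ [s]) @ rev v"
      using wv by (meson cox_eq_append cox_sym cox_trans)
    thus ?thesis by simp
  qed
  ultimately have "refl_odd w (w @ [s] @ rev w)"
    using refl_odd_cong[OF w] by blast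
  from del[OF this w] obtain a r b where ab: "w = a @ [r] @ b" "w @ [s] \<doteq> a @ b" by blast
  have "x @ [s] \<doteq> w @ [s]" using assms by (intro cox_eq_append cox_eq.cox_refl) auto
  with ab show ?thesis by (blast intro: cox_trans)
qed

text \<open>If appending \<open>r\<close> did not lengthen \<open>g @ p\<close>, exchange would
  delete a letter of \<open>g @ p\<close>. A letter of \<open>g\<close> contradicts the minimality
  of \<open>g\<close> in the coset g W_J, because p r p^{-1} lies in W_J; a letter of
  \<open>p\<close> would shorten the word \<open>p @ [r] @ q\<close>.\<close>

lemma coset_path:
  assumes J: "J \<subseteq> S" and g: "g \<in> lists S"
    and gmin: "\<And>z g'. z \<in> lists J \<Longrightarrow> g @ z \<doteq> g' \<Longrightarrow> length g \<le> length g'"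
    and z: "p @ [r] @ q \<in> lists J"
    and zmin: "\<And>z'. z' \<in> lists J \<Longrightarrow> g @ p @ [r] @ q \<doteq> g @ z' \<Longrightarrow> length (p @ [r] @ q) \<le> length z'"
  shows "clen (g @ p) < clen (g @ p @ [r])"
proof (rule ccontr)
  assume "\<not> ?thesis"
  moreover have JS: "lists J \<subseteq> lists S" using J by (rule lists_mono)
  hence S: "p \<in> lists S" "q \<in> lists S" "r \<in> S" using z J by auto
  ultimately have less: "clen ((g @ p) @ [r]) < clen (g @ p)"
    using clen_snoc_neq[of "g @ p" r] g by auto
  have refl: "g @ p \<doteq> g @ p" using g S by (intro cox_eq.cox_refl) auto
  from exchange[OF _ _ less refl] S g obtain a c b
    where ab: "g @ p = a @ [c] @ b" "(g @ p) @ [r] \<doteq> a @ b" by (metis append_in_lists_conv)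
  from ab(1) consider b' where "g = a @ [c] @ b'" "b = b' @ p" | a' where "a = g @ a'" "p = a' @ [c] @ b"
    by (auto simp: append_eq_append_conv2 append_eq_Cons_conv)
  then show False
  proof cases
    case 1
    hence "g @ (p @ [r]) @ rev p \<doteq> a @ b'"
      using ab cox_eq_move_right[of p "g @ p @ [r] @ rev p" "a @ b'"]
        cox_eq_move_right[of "rev p" "a @ b'" "g @ p @ [r]"] S g by simp
    moreover have "(p @ [r]) @ rev p \<in> lists J" using z by auto
    ultimately show False using gmin[of "p @ [r] @ rev p" "a @ b'"] 1 by simp
  next
    case 2
    hence "g @ p @ [r] \<doteq> g @ a' @ b" using ab by simp
    hence "(g @ p @ [r]) @ q \<doteq> (g @ a' @ b) @ q"
      using S(2) by (rule cox_eq_append[OF _ cox_eq.cox_refl])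
    then show False using zmin[of "a' @ b @ q"] 2 z by auto
  qed
qed

text \<open>A shortest word over \<open>J\<close> gains length at each of its letters, by
  \<open>coset_path\<close> with empty \<open>g\<close>, so it is reduced over all of
  \<open>S\<close>.\<close>

lemma reduced_in_parabolic:
  assumes J: "J \<subseteq> S" and u: "u \<in> lists J"
  shows "\<exists>u'\<in>lists J. u \<doteq> u' \<and> length u' = clen u"
proof -
  have JS: "lists J \<subseteq> lists S" using J by (rule lists_mono)
  define P where "P z \<longleftrightarrow> z \<in> lists J \<and> u \<doteq> z" for z
  have "P u" using u JS by (auto simp: P_def intro: cox_eq.cox_refl)
  then obtain z where z: "P z" "\<And>z'. P z' \<Longrightarrow> length z \<le> length z'"
    using exists_least_lemma arg_min_natI[of P u length] arg_min_nat_le[of P _ length] by blast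
  have "length p \<le> clen p" if "z = p @ q" for p q
    using that
  proof (induction p arbitrary: q rule: rev_induct)
    case (snoc r p)
    have "clen ([] @ p) < clen ([] @ p @ [r])"
    proof (rule coset_path[OF J, where q = q])
      fix z' assume "z' \<in> lists J" "[] @ p @ [r] @ q \<doteq> [] @ z'"
      hence "P z'" using z(1) snoc.prems by (auto simp: P_def intro: cox_trans)
      from z(2)[OF this] show "length (p @ [r] @ q) \<le> length z'" using snoc.prems by simp
    qed (use z snoc.prems in \<open>auto simp: P_def\<close>)
    with snoc.IH[of "[r] @ q"] snoc.prems show ?case by simp
  qed simp
  from this[of z "[]"] have "length z \<le> clen z" by simp
  moreover have "clen u = clen z" using z(1) clen_cong by (auto simp: P_def)
  moreover have "clen u \<le> length z" using z(1) clen_le by (auto simp: P_def)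
  ultimately show ?thesis using z(1) by (auto simp: P_def)
qed

section \<open>Commuting generators and parabolic subgroups\<close>

definition cosB :: "'v \<Rightarrow> 'v \<Rightarrow> real" where
  "cosB s t = (if s = t then 1 else case M s t of enat k \<Rightarrow> - cos (pi / real k) | \<infinity> \<Rightarrow> - 1)"

text \<open>\<open>f u\<close> is the value of a functional at the basis vector e_u, and
  \<open>cosB\<close> is the form B of the geometric representation. Precomposing the functional
  with e_u -> e_u - 2 B(e_s, e_u) e_s gives this formula.\<close>

definition cox_refl_act :: "'v \<Rightarrow> ('v \<Rightarrow> real) \<Rightarrow> 'v \<Rightarrow> real" where
  "cox_refl_act s f = (\<lambda>u. f u - 2 * f s * cosB s u)"

definition cox_act :: "'v list \<Rightarrow> ('v \<Rightarrow> real) \<Rightarrow> 'v \<Rightarrow> real" where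
  "cox_act w = foldr cox_refl_act w"

lemma cox_act_simps [simp]:
  "cox_act [] f = f" "cox_act (s # w) f = cox_refl_act s (cox_act w f)"
  "cox_act (u @ w) f = cox_act u (cox_act w f)"
  by (simp_all add: cox_act_def)

lemma cosB_same [simp]: "cosB s s = 1"
  by (simp add: cosB_def)

lemma cox_refl_act_twice: "cox_refl_act s (cox_refl_act s f) = f"
  by (auto simp: cox_refl_act_def)

text \<open>The contragredient of the geometric representation. For finite \<open>M s t\<close> split off the part of
  \<open>f\<close> vanishing at \<open>s\<close> and \<open>t\<close>; on the rest, with \<open>z = l - e^(-i \<theta>) n\<close> as complex coordinate, \<open>s t\<close>
  is multiplication by \<open>e^(2 i \<theta>)\<close>, where \<open>\<theta> = pi / M s t\<close>.\<close>

lemma cox_act_relator: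
  assumes "s \<noteq> t" "M s t = enat k" "M t s = enat k" "2 \<le> k"
  shows "cox_act (concat (replicate k [s, t])) f = f"
proof -
  define \<theta> where "\<theta> = pi / real k"
  define c where "c = cos \<theta>"
  have \<theta>: "0 < \<theta>" "\<theta> < pi" using assms by (auto simp: \<theta>_def field_simps)
  hence sin: "sin \<theta> > 0" by (rule sin_gt_zero)
  have sc: "sin \<theta> ^ 2 + c ^ 2 = 1" by (simp add: c_def)
  hence c2: "1 - c * c \<noteq> 0" using sin by (auto simp: power2_eq_square)
  have B: "cosB s t = - c" "cosB t s = - c"
    using assms by (auto simp: cosB_def c_def \<theta>_def)
  \<comment> \<open>\<open>l0\<close> and \<open>n0\<close> solve the two linear equations that make
    \<open>h\<close> vanish at \<open>s\<close> and \<open>t\<close>; their determinant 1 - c^2 is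
    nonzero because 0 < \<theta> < pi.\<close>
  define l0 where "l0 = (f s + c * f t) / (2 * (1 - c * c))"
  define n0 where "n0 = (f t + c * f s) / (2 * (1 - c * c))"
  define h where "h = (\<lambda>u. f u - 2 * l0 * cosB s u - 2 * n0 * cosB t u)"
  define F where "F = (\<lambda>l n u. h u + 2 * l * cosB s u + 2 * n * cosB t u)"
  have "h s = 0" "h t = 0"
    using c2 by (simp_all add: h_def l0_def n0_def B field_simps)
  hence actF: "cox_refl_act s (F l n) = F (2 * c * n - l) n"
    "cox_refl_act t (F l n) = F l (2 * c * l - n)" for l n
    by (auto simp: cox_refl_act_def F_def B algebra_simps)
  define z where "z = (\<lambda>l n :: real. complex_of_real l - complex_of_real n * cis (- \<theta>))"
  have z_inj: "l = l' \<and> n = n'" if "z l n = z l' n'" for l n l' n'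
  proof -
    from arg_cong[OF that, of Im] have "n = n'" using sin by (auto simp: z_def)
    with arg_cong[OF that, of Re] show ?thesis by (auto simp: z_def)
  qed
  \<comment> \<open>In the coordinate \<open>z\<close> both generators are reflections: s is z ->
    -cnj z and t is z -> -e^(-2 i \<theta>) cnj z. Their composite is the rotation by 2
    \<theta>.\<close>
  have zs: "z (2 * c * n - l) n = - cnj (z l n)" for l n
    by (simp add: complex_eq_iff z_def c_def)
  have c2t: "cos (2 * \<theta>) = 2 * c ^ 2 - 1" "sin (2 * \<theta>) = 2 * sin \<theta> * c"
    by (simp_all add: c_def cos_double_cos sin_double)
  have zt: "z l (2 * c * l - n) = - cis (- 2 * \<theta>) * cnj (z l n)" for l n
    using sc by (simp add: complex_eq_iff z_def c_def[symmetric] c2t) algebra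
  have pow: "\<exists>l n. cox_act (concat (replicate j [s, t])) f = F l n \<and>
      z l n = cis (2 * \<theta>) ^ j * z l0 n0" for j
  proof (induction j)
    case 0
    have "f = F l0 n0" by (auto simp: F_def h_def)
    then show ?case by auto
  next
    case (Suc j)
    then obtain l n where ln: "cox_act (concat (replicate j [s, t])) f = F l n"
      "z l n = cis (2 * \<theta>) ^ j * z l0 n0" by blast
    define n' where "n' = 2 * c * l - n"
    have "cox_act (concat (replicate (Suc j) [s, t])) f = F (2 * c * n' - l) n'"
      using ln(1) by (simp add: actF n'_def)
    moreover have "z (2 * c * n' - l) n' = cis (2 * \<theta>) * z l n"
      by (simp add: zs, simp add: n'_def zt cis_cnj)
    ultimately show ?case
      using ln(2) by (intro exI[of _ "2 * c * n' - l"] exI[of _ n']) (simp add: mult.assoc)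
  qed
  from pow[of k] obtain l n where ln: "cox_act (concat (replicate k [s, t])) f = F l n"
    "z l n = cis (2 * \<theta>) ^ k * z l0 n0" by blast
  have "real k * (2 * \<theta>) = 2 * pi" using assms(4) by (simp add: \<theta>_def)
  hence "cis (2 * \<theta>) ^ k = 1" by (simp only: Complex.DeMoivre cis_2pi)
  with ln(2) z_inj have "l = l0" "n = n0" by auto
  with ln(1) show ?thesis by (auto simp: F_def h_def)
qed

context
  assumes diag: "\<And>s. s \<in> S \<Longrightarrow> M s s = 1"
    and sym: "\<And>s t. s \<in> S \<Longrightarrow> t \<in> S \<Longrightarrow> M s t = M t s"
    and ge2: "\<And>s t. s \<in> S \<Longrightarrow> t \<in> S \<Longrightarrow> s \<noteq> t \<Longrightarrow> 2 \<le> M s t"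
begin

lemma cox_act_invariant:
  assumes "u \<doteq> w"
  shows "cox_act u f = cox_act w f"
  using assms
proof (induction arbitrary: f)
  case (cox_rel xs ys s t k)
  have "cox_act (concat (replicate k [s, t])) f = f" for f
  proof (cases "s = t")
    case True
    hence "k = 1" using diag[of s] cox_rel by (simp add: one_enat_def)
    thus ?thesis using True by (simp add: cox_refl_act_twice)
  next
    case False
    with cox_rel ge2[of s t] sym[of s t] show ?thesis
      by (intro cox_act_relator) (auto simp: numeral_eq_enat)
  qed
  then show ?case by simp
qed (auto simp: cox_refl_act_twice)

text \<open>Evaluated at \<open>s\<close>, the coordinate functional of \<open>s\<close> becomes -1
  under \<open>s\<close> and stays 1 under \<open>t\<close>.\<close>

lemma generators_distinct:
  assumes "s \<in> S" "t \<in> S" "s \<noteq> t"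
  shows "\<not> [s] \<doteq> [t]"
proof
  assume "[s] \<doteq> [t]"
  from cox_act_invariant[OF this, of "\<lambda>u. if u = s then 1 else 0"]
  have "cox_refl_act s (\<lambda>u. if u = s then 1 else 0) s = cox_refl_act t (\<lambda>u. if u = s then 1 else 0) s"
    by simp
  with assms show False by (simp add: cox_refl_act_def)
qed

text \<open>Applied to the coordinate functional of \<open>s\<close> and evaluated at
  \<open>s\<close>, the product st gives -1 and ts gives -1 + 4 B^2 with B =
  \<open>cosB s t\<close>. Equality forces B = 0, which excludes m_{st} > 2.\<close>

lemma commuting_generators:
  assumes "s \<in> S" "t \<in> S" "s \<noteq> t" "[s, t] \<doteq> [t, s]"
  shows "M s t = 2"
proof (rule ccontr)
  assume "M s t \<noteq> 2"
  with ge2[OF assms(1-3)] have "2 < M s t" by (metis order_le_less)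
  have "cosB s t \<noteq> 0"
  proof (cases "M s t")
    case (enat k)
    with \<open>2 < M s t\<close> have "k > 2" by (simp add: numeral_eq_enat)
    hence "pi / real k < pi / 2" "0 < pi / real k" by (auto simp: field_simps)
    hence "cos (pi / real k) > 0" by (intro cos_gt_zero) auto
    then show ?thesis using enat assms by (auto simp: cosB_def)
  qed (use assms in \<open>auto simp: cosB_def\<close>)
  moreover have "cosB t s = cosB s t" using sym[of s t] assms by (simp add: cosB_def)
  moreover from cox_act_invariant[OF assms(4), of "\<lambda>u. if u = s then 1 else 0"]
  have "cox_refl_act s (cox_refl_act t (\<lambda>u. if u = s then 1 else 0)) s =
        cox_refl_act t (cox_refl_act s (\<lambda>u. if u = s then 1 else 0)) s"
    by simp
  ultimately show False using assms by (simp add: cox_refl_act_def)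
qed

section \<open>Conjugating a parabolic subgroup by an outside generator\<close>

lemma generator_notin_parabolic:
  assumes J: "J \<subseteq> S" and "s \<in> S" "s \<notin> J" "u \<in> lists J"
  shows "\<not> [s] \<doteq> u"
proof
  assume su: "[s] \<doteq> u"
  from reduced_in_parabolic[OF J assms(4)] obtain u'
    where u': "u' \<in> lists J" "u \<doteq> u'" "length u' = clen u" by blast
  have eq: "[s] \<doteq> u'" using su u' by (blast intro: cox_trans)
  \<comment> \<open>Length at most 1 together with odd length leaves a single letter of
    \<open>J\<close>, which cannot equal \<open>s\<close> in the group.\<close>
  moreover have "length u' \<le> 1" using u'(3) clen_le[OF cox_sym[OF su]] by simp
  moreover have "odd (length u')" using cox_eq_parity[OF eq] by simp
  ultimately obtain t where "u' = [t]" by (cases u') auto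
  then show False using generators_distinct[of s t] eq u' assms by auto
qed

lemma refl_odd_parabolic:
  assumes "refl_odd u t" "u \<in> lists J" "J \<subseteq> S" "t \<in> lists S"
  shows "\<exists>v\<in>lists J. t \<doteq> v"
  using refl_odd_imp_conjugate[OF assms(1)] assms lists_mono[of J S] by fastforce

text \<open>All reflections counted oddly in words over \<open>J\<close> lie in W_J, and
  \<open>s\<close> does not. So the first letter makes \<open>s\<close> odd in s y, hence
  \<open>s\<close> is odd in x s, and only the last letter can account for it: x s x^{-1} =
  s.\<close>

lemma conjugate_in_parabolic:
  assumes J: "J \<subseteq> S" and s: "s \<in> S" "s \<notin> J" and x: "x \<in> lists J" and y: "y \<in> lists J"
    and eq: "[s] @ x @ [s] \<doteq> y"
  shows "[s] @ x \<doteq> x @ [s]"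
proof -
  have JS: "lists J \<subseteq> lists S" using J by (rule lists_mono)
  have notin: "\<not> refl_odd u [s]" if "u \<in> lists J" for u
    using refl_odd_parabolic[OF _ that J] generator_notin_parabolic[OF J s] s by (meson lists.intros)
  have ss: "[s] @ [s] @ [s] \<doteq> [s]"
    using cox_eq_cancel_mid[OF cox_eq_double, of s "[]" "[s]"] s by simp
  have "refl_odd ([s] @ y) [s] = (\<not> refl_odd y [s])"
    using refl_odd_cong[OF _ ss, of y] y JS cox_eq.cox_refl[of "[s]" S M] s
    by (auto simp: refl_odd_append)
  hence "refl_odd ([s] @ y) [s]" using notin[OF y] by simp
  moreover have xs: "x @ [s] \<doteq> [s] @ y"
    using cox_eq_move_left[of "[s]" y "x @ [s]"] eq s y JS by auto
  ultimately have "refl_odd (x @ [s]) [s]"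
    using refl_odd_invariant[OF xs, of "[s]"] s by auto
  hence "[s] \<doteq> rev x @ [s] @ x"
    using notin[OF x] by (simp add: refl_odd_append)
  hence "[s] @ x \<doteq> x @ [s]"
    using cox_eq_move_left[of "rev x" "[s]" "[s] @ x"] x s JS by (auto intro: cox_sym)
  thus ?thesis .
qed

text \<open>Let t x be the reduced word. The reflection w = s t s is odd in s t x, hence in t x s.
  There the last letter contributes (t x) s (t x)^{-1} = s, which is not w, so w is odd in t x and
  lies in W_J. By the previous conjugation result s commutes with t; cancelling t leaves the same
  situation for x.\<close>

lemma commuting_reduced_word:
  assumes J: "J \<subseteq> S" and s: "s \<in> S" "s \<notin> J"
  shows "x \<in> lists J \<Longrightarrow> clen x = length x \<Longrightarrow> [s] @ x \<doteq> x @ [s] \<Longrightarrow> x \<in> lists {t \<in> J. M s t = 2}"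
proof (induction x)
  case (Cons t x)
  have JS: "lists J \<subseteq> lists S" using J by (rule lists_mono)
  have t: "t \<in> J" "t \<in> S" "s \<noteq> t" and x: "x \<in> lists J" "x \<in> lists S"
    using Cons.prems J JS s by auto
  \<comment> \<open>Reducedness enters here: if \<open>t\<close> were counted oddly in
    \<open>x\<close>, multiplying \<open>x\<close> by \<open>t\<close> would delete a letter, so t x
    would not be reduced.\<close>
  have nx: "\<not> refl_odd x [t]"
  proof
    assume "refl_odd x [t]"
    from refl_odd_imp_conjugate[OF this] t x obtain a r b
      where *: "x = a @ [r] @ b" "[t] \<doteq> a @ [r] @ rev a" by auto
    hence **: "a \<in> lists S" "r \<in> S" "b \<in> lists S" using x by auto
    have "[t] @ (a @ [r] @ b) \<doteq> (a @ [r] @ rev a) @ (a @ [r] @ b)"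
      using * ** by (intro cox_eq_append cox_eq.cox_refl) auto
    also have "(a @ [r] @ rev a) @ (a @ [r] @ b) = (a @ [r]) @ (rev a @ a) @ ([r] @ b)" by simp
    finally have "[t] @ (a @ [r] @ b) \<doteq> (a @ [r]) @ ([r] @ b)"
      using cox_eq_cancel_mid[OF cox_eq_rev_append, of a "a @ [r]" "[r] @ b"] **
      by (auto intro: cox_trans)
    moreover have "(a @ [r]) @ ([r] @ b) \<doteq> a @ b"
      using cox_eq_cancel_mid[OF cox_eq_double, of r a b] ** by simp
    ultimately have "t # x \<doteq> a @ b" using * by (auto intro: cox_trans)
    from clen_le[OF this] Cons.prems(2) * show False by simp
  qed
  define w where "w = [s] @ [t] @ [s]"
  have wS: "w \<in> lists S" using s t by (simp add: w_def)
  have wsw: "[s] @ w @ [s] \<doteq> [t]"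
  proof -
    have "[s] @ [s, t, s] @ [s] \<doteq> [t]"
      using cox_eq_append[OF cox_eq_append[OF cox_eq_double[OF s(1)] cox_eq.cox_refl[of "[t]"]] cox_eq_double[OF s(1)]] t
      by auto
    thus ?thesis by (simp add: w_def)
  qed
  have sw: "\<not> [s] \<doteq> w"
  proof
    assume "[s] \<doteq> w"
    hence "[s] @ [s] @ [s] \<doteq> [s] @ w @ [s]" using s by (intro cox_eq_context) auto
    moreover have "[s] @ [s] @ [s] \<doteq> [s]"
      using cox_eq_cancel_mid[OF cox_eq_double, of s "[]" "[s]"] s by simp
    ultimately have "[s] \<doteq> [t]" using wsw by (meson cox_sym cox_trans)
    with generators_distinct[of s t] s t show False by auto
  qed
  have "refl_odd ([s] @ t # x) w = refl_odd (t # x) ([s] @ w @ [s])"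
    using sw by simp
  also have "\<dots> = refl_odd (t # x) [t]"
    using t x wsw by (intro refl_odd_cong) auto
  also have "\<dots> = (\<not> refl_odd x ([t] @ [t] @ [t]))"
    using t cox_eq.cox_refl[of "[t]" S M] by simp
  also have "refl_odd x ([t] @ [t] @ [t]) = refl_odd x [t]"
    using cox_eq_cancel_mid[OF cox_eq_double, of t "[]" "[t]"] t x by (intro refl_odd_cong) auto
  finally have "refl_odd ([s] @ t # x) w" using nx by simp
  hence "refl_odd ((t # x) @ [s]) w"
    using refl_odd_invariant[OF Cons.prems(3) wS] by simp
  moreover have "\<not> [s] \<doteq> rev (t # x) @ w @ (t # x)"
  proof
    let ?x = "t # x"
    assume "[s] \<doteq> rev ?x @ w @ ?x"
    hence "?x @ [s] \<doteq> w @ ?x"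
      using cox_eq_move_left[of "rev ?x" "[s]" "w @ ?x"] cox_eq_move_left[of "?x" "w @ ?x" "[s]"] t x s wS
      by auto
    hence "[s] @ ?x \<doteq> w @ ?x" using Cons.prems(3) by (blast intro: cox_trans)
    hence "[s] \<doteq> w" using cox_eq_cancel_right[of ?x "[s]" w] t x by simp
    with sw show False by simp
  qed
  ultimately have "refl_odd (t # x) w"
    using refl_odd_append[of "t # x" "[s]" w] by (simp del: refl_odd.simps(2) add: refl_odd.simps(2)[of s "[]"])
  from refl_odd_parabolic[OF this Cons.prems(1) J wS] obtain v
    where v: "v \<in> lists J" "w \<doteq> v" by blast
  have st: "[s] @ [t] \<doteq> [t] @ [s]"
    using conjugate_in_parabolic[OF J s _ v(1), of "[t]"] v t by (simp add: w_def)
  hence M: "M s t = 2" using commuting_generators[of s t] s t by auto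
  have "[t] @ ([s] @ x) \<doteq> [t] @ (x @ [s])"
  proof -
    have "([t] @ [s]) @ x \<doteq> ([s] @ [t]) @ x"
      using cox_eq_append[OF cox_sym[OF st] cox_eq.cox_refl[OF x(2)]] .
    with Cons.prems(3) show ?thesis by (auto intro: cox_trans)
  qed
  hence "[s] @ x \<doteq> x @ [s]" using cox_eq_cancel_left[of "[t]"] t by simp
  moreover have "clen x = length x"
  proof -
    obtain v where v: "x \<doteq> v" "length v = clen x" using clen_witness[OF x(2)] by blast
    have "[t] @ x \<doteq> [t] @ v" using v t by (intro cox_eq_append cox_eq.cox_refl) auto
    from clen_le[OF this] Cons.prems(2) v clen_le[OF cox_eq.cox_refl[OF x(2)]] show ?thesis by simp
  qed
  ultimately show ?case using Cons.IH x t M by simp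
qed simp

text \<open>In group terms, the intersection of W_J and s W_J s lies in the parabolic subgroup on
  the generators of \<open>J\<close> that commute with \<open>s\<close>. For s = s_j and J = S_{j-1}
  this subgroup is W_{j-2}.\<close>

lemma conjugate_in_parabolic_imp_commuting:
  assumes J: "J \<subseteq> S" and s: "s \<in> S" "s \<notin> J" and x: "x \<in> lists J" and y: "y \<in> lists J"
    and eq: "[s] @ x @ [s] \<doteq> y"
  shows "\<exists>x'\<in>lists {t \<in> J. M s t = 2}. x \<doteq> x'"
proof -
  from reduced_in_parabolic[OF J x] obtain x' where x': "x' \<in> lists J" "x \<doteq> x'" "length x' = clen x"
    by blast
  have "[s] @ x' @ [s] \<doteq> y"
    using cox_eq_context[OF x'(2), of "[s]" "[s]"] eq s by (auto intro: cox_sym cox_trans)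
  hence "[s] @ x' \<doteq> x' @ [s]"
    using conjugate_in_parabolic[OF J s x'(1) y] by blast
  moreover have "clen x' = length x'" using x' clen_cong[OF x'(2)] by simp
  ultimately show ?thesis using commuting_reduced_word[OF J s x'(1)] x' by blast
qed

end

end

section \<open>Shelling the complex\<close>

lemma cox_eq_commute_word:
  assumes "s \<in> S" "w \<in> lists {t \<in> S. M s t = 2}"
  shows "cox_eq M S ([s] @ w) (w @ [s])"
  using assms(2)
proof (induction w rule: list.induct)
  case (Cons t w)
  hence t: "t \<in> S" "M s t = 2" and w: "w \<in> lists S" by auto
  have "cox_eq M S ([s, t] @ w) ([t, s] @ w)"
    by (intro cox_eq_append_right cox_eq_commute assms t w)
  moreover have "cox_eq M S ([t] @ [s] @ w) ([t] @ w @ [s])"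
    using Cons t by (intro cox_eq_append_left) auto
  ultimately show ?case by (auto intro: cox_trans)
qed (use assms in \<open>auto intro: cox_refl\<close>)

lemma coset_eq_iff:
  assumes T: "T \<subseteq> S" and c: "c \<in> lists S" "c' \<in> lists S"
  shows "coset M S T c = coset M S T c' \<longleftrightarrow> (\<exists>u\<in>lists T. cox_eq M S (c @ u) c')"
proof
  assume "coset M S T c = coset M S T c'"
  moreover have "c' \<in> coset M S T c'"
    using c by (auto simp: coset_def intro!: bexI[of _ "[]"] cox_refl)
  ultimately show "\<exists>u\<in>lists T. cox_eq M S (c @ u) c'" by (auto simp: coset_def)
next
  assume "\<exists>u\<in>lists T. cox_eq M S (c @ u) c'"
  then obtain u where u: "u \<in> lists T" "cox_eq M S (c @ u) c'" by blast
  have TS: "lists T \<subseteq> lists S" using T by (rule lists_mono)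
  have eq: "cox_eq M S c (c' @ rev u)"
    using cox_eq_move_right[of u S c' M c] u c TS by auto
  show "coset M S T c = coset M S T c'"
  proof (intro set_eqI iffI)
    fix w assume "w \<in> coset M S T c"
    then obtain y where y: "y \<in> lists T" "cox_eq M S (c @ y) w" by (auto simp: coset_def)
    have "cox_eq M S ((c' @ rev u) @ y) (c @ y)"
      using eq y TS by (intro cox_eq_append cox_refl) (auto intro: cox_sym)
    with y have "cox_eq M S (c' @ rev u @ y) w" by (auto intro: cox_trans)
    thus "w \<in> coset M S T c'" using u y by (auto simp: coset_def intro!: bexI[of _ "rev u @ y"])
  next
    fix w assume "w \<in> coset M S T c'"
    then obtain y where y: "y \<in> lists T" "cox_eq M S (c' @ y) w" by (auto simp: coset_def)
    have "cox_eq M S ((c @ u) @ y) (c' @ y)"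
      using u y TS by (intro cox_eq_append cox_refl) auto
    with y have "cox_eq M S (c @ u @ y) w" by (auto intro: cox_trans)
    thus "w \<in> coset M S T c" using u y by (auto simp: coset_def intro!: bexI[of _ "u @ y"])
  qed
qed

text \<open>Bubble sort: the head of \<open>ys\<close> is moved to the front by adjacent swaps, and
  the tail is sorted under the predicate \<open>\<lambda>l. P (y # l)\<close>, which inherits
  closure under swaps.\<close>

lemma adjacent_swaps_induct:
  assumes "mset xs = mset ys" "P xs"
    and "\<And>a x y b. P (a @ x # y # b) \<Longrightarrow> P (a @ y # x # b)"
  shows "P ys"
  using assms
proof (induction ys arbitrary: xs P)
  case (Cons y ys)
  hence "y \<in> set xs" by (metis list.set_intros(1) set_mset_mset)
  then obtain p q where xs: "xs = p @ y # q" by (meson split_list)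
  have "P (p @ y # q) \<Longrightarrow> P (y # p @ q)" for q
  proof (induction p arbitrary: q rule: rev_induct)
    case (snoc z p)
    then show ?case using Cons.prems(3)[of p z y q] by simp
  qed simp
  hence *: "P (y # p @ q)" using Cons.prems(2) xs by simp
  show ?case
  proof (rule Cons.IH[of "p @ q" "\<lambda>l. P (y # l)"])
    show "mset (p @ q) = mset ys" using Cons.prems(1) xs by simp
    show "P (y # a @ z # x # b)" if "P (y # a @ x # z # b)" for a x z b
      using Cons.prems(3)[of "y # a" x z b] that by simp
  qed (use * in simp)
qed simp

section \<open>The generators s_1, ..., s_n and their relations\<close>

locale coxeter_chain =
  fixes V :: "'g set" and s1 :: 'g and m :: "'g \<Rightarrow> 'g \<Rightarrow> enat" and n :: nat
  assumes fin: "finite V" and s1: "s1 \<in> V"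
    and m_diag: "\<forall>a\<in>V. m a a = 1"
    and m_sym: "\<forall>a\<in>V. \<forall>b\<in>V. m a b = m b a"
    and m_ge2: "\<forall>a\<in>V. \<forall>b\<in>V. a \<noteq> b \<longrightarrow> 2 \<le> m a b"
begin

abbreviation "gen \<equiv> sv s1"
abbreviation "gens \<equiv> Sset V s1"
abbreviation "cox \<equiv> Mext s1 m"
abbreviation weq (infix "\<doteq>" 50) where "u \<doteq> w \<equiv> cox_eq cox (gens n) u w"

lemma gen_eq_iff: "1 \<le> i \<Longrightarrow> 1 \<le> j \<Longrightarrow> gen i = gen j \<longleftrightarrow> i = j"
  by (auto simp: sv_def)

lemma gens_cases:
  assumes "s \<in> gens k"
  obtains a where "s = Inl a" "a \<in> V" "a \<noteq> s1" | i where "s = gen i" "1 \<le> i" "i \<le> k"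
  using assms by (auto simp: Sset_def)

lemma gen_in_gens: "1 \<le> i \<Longrightarrow> i \<le> k \<Longrightarrow> gen i \<in> gens k"
  by (auto simp: Sset_def)

lemma gens_mono: "k \<le> l \<Longrightarrow> gens k \<subseteq> gens l"
  by (auto simp: Sset_def)

lemma finite_gens: "finite (gens k)"
  using fin by (simp add: Sset_def)

lemma Sprev_subset_gens: "i \<le> Suc k \<Longrightarrow> Sprev V s1 m i \<subseteq> gens k"
  using gens_mono[of "i - 1" k] by (auto simp: Sprev_def Sm1_def Sset_def)

lemma Sprev_Suc [simp]: "Sprev V s1 m (Suc i) = gens i"
  by (simp add: Sprev_def)

lemma gen_notin_gens: "gen (Suc k) \<notin> gens k"
  by (auto simp: Sset_def sv_def)

lemma chain_adj_gen:
  assumes "1 \<le> i" "1 \<le> j"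
  shows "chain_adj s1 (gen i) (gen j) \<longleftrightarrow> j = Suc i \<or> i = Suc j"
proof
  assume "chain_adj s1 (gen i) (gen j)"
  then obtain k where "k \<ge> 1"
    "(gen i = gen k \<and> gen j = gen (Suc k)) \<or> (gen j = gen k \<and> gen i = gen (Suc k))"
    unfolding chain_adj_def by blast
  thus "j = Suc i \<or> i = Suc j"
    using gen_eq_iff[of i k] gen_eq_iff[of j "Suc k"] gen_eq_iff[of j k] gen_eq_iff[of i "Suc k"] assms
    by auto
qed (use assms in \<open>auto simp: chain_adj_def\<close>)

lemma cox_gen_gen:
  assumes "1 \<le> i" "1 \<le> j" "i \<noteq> j"
  shows "cox (gen i) (gen j) = (if j = Suc i \<or> i = Suc j then 3 else 2)"
  using chain_adj_gen[of i j] assms by (auto simp: Mext_def sv_def split: if_splits)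

lemma cox_Inl_gen:
  assumes "a \<noteq> s1" "2 \<le> j"
  shows "cox (Inl a) (gen j) = 2" "cox (gen j) (Inl a) = 2"
  using assms by (auto simp: Mext_def sv_def chain_adj_def)

lemma cox_Inl_gen1: "a \<noteq> s1 \<Longrightarrow> cox (Inl a) (gen 1) = m a s1" "a \<noteq> s1 \<Longrightarrow> cox (gen 1) (Inl a) = m s1 a"
  by (auto simp: Mext_def sv_def)

lemma cox_diag: "s \<in> gens n \<Longrightarrow> cox s s = 1"
  by (simp add: Mext_def)

lemma cox_sym: "s \<in> gens n \<Longrightarrow> t \<in> gens n \<Longrightarrow> cox s t = cox t s"
  using m_sym s1
  by (auto simp: Mext_def Sset_def sv_def chain_adj_def split: sum.splits)

lemma cox_ge2: "s \<in> gens n \<Longrightarrow> t \<in> gens n \<Longrightarrow> s \<noteq> t \<Longrightarrow> 2 \<le> cox s t"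
  using m_ge2 s1 by (auto simp: Mext_def Sset_def sv_def split: sum.splits)

lemma gen_notin_parabolic:
  assumes "J \<subseteq> gens n" "s \<in> gens n" "s \<notin> J" "u \<in> lists J"
  shows "\<not> [s] \<doteq> u"
  using cox_diag cox_sym cox_ge2 assms by (rule generator_notin_parabolic)

lemma gen_conjugate:
  assumes "J \<subseteq> gens n" "s \<in> gens n" "s \<notin> J" "x \<in> lists J" "y \<in> lists J"
    and "[s] @ x @ [s] \<doteq> y"
  shows "\<exists>x'\<in>lists {t \<in> J. cox s t = 2}. x \<doteq> x'"
  using cox_diag cox_sym cox_ge2 assms by (rule conjugate_in_parabolic_imp_commuting)

section \<open>Vertices of an n-simplex and the action of the generators on them\<close>

abbreviation tail :: "nat \<Rightarrow> ('g + nat) list" where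
  "tail j \<equiv> map gen [j..<Suc n]"

text \<open>The vertex number \<open>j\<close> of the n-simplex with lift \<open>c\<close>, for 1
  \<le> j \<le> n + 1. As \<open>tail (Suc n)\<close> is empty, the last one is c W_{n-1}.\<close>

definition vert :: "('g + nat) list \<Rightarrow> nat \<Rightarrow> ('g + nat) list set" where
  "vert c j = vtx V s1 m n (c @ tail j)"

lemma gens_word: "1 \<le> j \<Longrightarrow> k \<le> Suc n \<Longrightarrow> map gen [j..<k] \<in> lists (gens n)"
  by (auto intro!: gen_in_gens)

lemma tail_Suc: "j \<le> n \<Longrightarrow> tail j = gen j # tail (Suc j)"
  by (simp add: upt_conv_Cons del: upt_Suc)

lemma vtx_eq_iff:
  assumes "c \<in> lists (gens n)" "c' \<in> lists (gens n)"
  shows "vtx V s1 m n c = vtx V s1 m n c' \<longleftrightarrow> (\<exists>u\<in>lists (Sprev V s1 m n). c @ u \<doteq> c')"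
  unfolding vtx_def using assms Sprev_subset_gens[of n n] by (intro coset_eq_iff) auto

lemma vert_cong:
  assumes "c \<doteq> c'" "1 \<le> j"
  shows "vert c j = vert c' j"
proof -
  have "c @ tail j \<doteq> c' @ tail j"
    using assms gens_word[of j "Suc n"] by (intro cox_eq_append cox_refl) auto
  thus ?thesis
    using vtx_eq_iff[of "c @ tail j" "c' @ tail j"] cox_eq_lists[of cox "gens n"]
    unfolding vert_def by (metis append_Nil2 lists.Nil)
qed

text \<open>Pushed through the word s_j ... s_n, the generator \<open>s\<close> comes out as a
  generator \<open>t\<close> of W_{n-1}, which the coset absorbs.\<close>

lemma vert_absorb:
  assumes "c \<in> lists (gens n)" "1 \<le> j" "s \<in> gens n" "t \<in> Sprev V s1 m n" "[s] @ tail j \<doteq> tail j @ [t]"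
  shows "vert (c @ [s]) j = vert c j"
proof -
  have "c @ ([s] @ tail j) \<doteq> c @ (tail j @ [t])"
    using assms by (intro cox_eq_append_left) auto
  hence "(c @ tail j) @ [t] \<doteq> (c @ [s]) @ tail j"
    by (simp add: cox_eq.cox_sym del: upt_Suc)
  moreover have "[t] \<in> lists (Sprev V s1 m n)" using assms by simp
  ultimately have "vtx V s1 m n (c @ tail j) = vtx V s1 m n ((c @ [s]) @ tail j)"
    using assms gens_word[of j "Suc n"] by (subst vtx_eq_iff) (auto simp del: upt_Suc)
  thus ?thesis by (simp add: vert_def del: upt_Suc)
qed

lemma vert_gen_Suc: "j \<le> n \<Longrightarrow> vert (c @ [gen j]) (Suc j) = vert c j"
  by (simp add: vert_def tail_Suc del: upt_Suc)

lemma vert_gen_same: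
  assumes "c \<in> lists (gens n)" "1 \<le> j" "j \<le> n"
  shows "vert (c @ [gen j]) j = vert c (Suc j)"
proof -
  have "c @ [gen j, gen j] \<doteq> c @ []"
    using assms gen_in_gens by (intro cox_eq_append_left cox_eq_double) auto
  hence "vert (c @ [gen j, gen j]) (Suc j) = vert c (Suc j)"
    by (intro vert_cong) auto
  thus ?thesis using vert_gen_Suc[of j "c @ [gen j]"] assms by simp
qed

lemma commute_gens:
  assumes "1 \<le> i" "i \<le> n" "1 \<le> j" "k \<le> Suc n" "\<And>l. j \<le> l \<Longrightarrow> l < k \<Longrightarrow> Suc l < i \<or> Suc i < l"
  shows "[gen i] @ map gen [j..<k] \<doteq> map gen [j..<k] @ [gen i]"
proof (rule cox_eq_commute_word)
  show "map gen [j..<k] \<in> lists {t \<in> gens n. cox (gen i) t = 2}"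
    unfolding in_lists_conv_set
  proof
    fix t assume "t \<in> set (map gen [j..<k])"
    then obtain l where "t = gen l" "j \<le> l" "l < k" by auto
    thus "t \<in> {t \<in> gens n. cox (gen i) t = 2}"
      using cox_gen_gen[of i l] gen_in_gens[of l n] assms(1-4) assms(5)[of l] by auto
  qed
qed (use assms gen_in_gens in auto)

lemma vert_gen_less:
  assumes "c \<in> lists (gens n)" "1 \<le> i" "Suc i < j" "j \<le> Suc n"
  shows "vert (c @ [gen i]) j = vert c j"
proof (rule vert_absorb)
  show "gen i \<in> gens n" using assms by (intro gen_in_gens) auto
  show "[gen i] @ tail j \<doteq> tail j @ [gen i]"
    using assms by (intro commute_gens) auto
  show "gen i \<in> Sprev V s1 m n"
    using assms gen_in_gens[of i "n - 1"] by (auto simp: Sprev_def)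
qed (use assms in auto)

text \<open>s_i passes s_j ... s_{i-2}, the braid relation turns s_i s_{i-1} s_i into s_{i-1} s_i
  s_{i-1}, and the last s_{i-1} passes s_{i+1} ... s_n. It emerges as an element of W_{n-1}.\<close>

lemma vert_gen_greater:
  assumes "c \<in> lists (gens n)" "1 \<le> j" "j < i" "i \<le> n"
  shows "vert (c @ [gen i]) j = vert c j"
proof (rule vert_absorb)
  show i: "gen i \<in> gens n" using assms by (intro gen_in_gens) auto
  show "gen (i - 1) \<in> Sprev V s1 m n"
    using assms gen_in_gens[of "i - 1" "n - 1"] by (auto simp: Sprev_def)
  hence i1: "gen (i - 1) \<in> gens n" using Sprev_subset_gens[of n n] by auto
  let ?a = "map gen [j..<i - 1]" and ?b = "map gen [Suc i..<Suc n]"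
  have a: "?a \<in> lists (gens n)" using assms by (intro gens_word) auto
  have b: "?b \<in> lists (gens n)" by (intro gens_word) auto
  have "[j..<Suc n] = [j..<i - 1] @ [i - 1..<Suc n]"
    using assms upt_add_eq_append[of j "i - 1" "Suc n - (i - 1)"] by (simp del: upt_Suc)
  moreover have "[i - 1..<Suc n] = [i - 1, i] @ [Suc i..<Suc n]"
    using assms by (simp add: upt_conv_Cons del: upt_Suc)
  ultimately have split: "tail j = ?a @ [gen (i - 1), gen i] @ ?b" by (simp del: upt_Suc)
  have "[gen i] @ ?a \<doteq> ?a @ [gen i]"
    using assms by (intro commute_gens) auto
  hence "([gen i] @ ?a) @ [gen (i - 1), gen i] @ ?b \<doteq> (?a @ [gen i]) @ [gen (i - 1), gen i] @ ?b"
    using i i1 b by (intro cox_eq_append_right) (auto simp del: upt_Suc)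
  moreover have "?a @ [gen i, gen (i - 1), gen i] @ ?b \<doteq> ?a @ [gen (i - 1), gen i, gen (i - 1)] @ ?b"
    using a b i i1 assms
    by (intro cox_eq_append_left cox_eq_append_right cox_eq_braid)
      (auto simp: cox_gen_gen simp del: upt_Suc)
  moreover have "(?a @ [gen (i - 1), gen i]) @ [gen (i - 1)] @ ?b \<doteq> (?a @ [gen (i - 1), gen i]) @ ?b @ [gen (i - 1)]"
    using a i i1 assms by (intro cox_eq_append_left commute_gens) auto
  ultimately show "[gen i] @ tail j \<doteq> tail j @ [gen (i - 1)]"
    unfolding split by (auto intro: cox_trans simp del: upt_Suc)
qed (use assms in auto)

text \<open>The bound \<open>2 \<le> j\<close> keeps s_1 out of the tail, the only s_k that an old
  generator may fail to commute with. So an old generator can move vertex number 1 only.\<close>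

lemma vert_Inl:
  assumes "c \<in> lists (gens n)" "a \<in> V" "a \<noteq> s1" "2 \<le> j" "j \<le> Suc n"
  shows "vert (c @ [Inl a]) j = vert c j"
proof (rule vert_absorb)
  show "Inl a \<in> gens n" using assms by (auto simp: Sset_def)
  thus "[Inl a] @ tail j \<doteq> tail j @ [Inl a]"
    using assms by (intro cox_eq_commute_word) (auto simp: gen_in_gens cox_Inl_gen simp del: upt_Suc)
  show "Inl a \<in> Sprev V s1 m n"
    using assms by (auto simp: Sprev_def Sset_def)
qed (use assms in auto)

lemma vert_Sm1:
  assumes "c \<in> lists (gens n)" "s \<in> Sm1 V s1 m" "1 \<le> j"
  shows "vert (c @ [s]) j = vert c j"
proof (rule vert_absorb)
  from assms obtain a where a: "s = Inl a" "a \<in> V" "a \<noteq> s1" "m s1 a = 2" by (auto simp: Sm1_def)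
  thus s: "s \<in> gens n" by (auto simp: Sset_def)
  have "cox s (gen i) = 2" if "1 \<le> i" for i
    using a cox_Inl_gen[of a i] cox_Inl_gen1[of a] m_sym s1 that by (cases "i = 1") auto
  thus "[s] @ tail j \<doteq> tail j @ [s]"
    using assms s by (intro cox_eq_commute_word) (auto simp: gen_in_gens simp del: upt_Suc)
  show "s \<in> Sprev V s1 m n"
    using assms a by (auto simp: Sprev_def Sset_def)
qed (use assms in auto)

text \<open>The index is shifted: \<open>Sprev V s1 m i\<close> is S_{i-1}. So W_{i-1} fixes the
  vertices numbered above \<open>i\<close>; the converse is \<open>lift_unique\<close>.\<close>

lemma vert_Sprev:
  assumes "c \<in> lists (gens n)" "s \<in> Sprev V s1 m i" "i < j" "j \<le> Suc n"
  shows "vert (c @ [s]) j = vert c j"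
proof (cases i)
  case 0
  thus ?thesis using assms vert_Sm1[of c s j] by (simp add: Sprev_def)
next
  case (Suc k)
  hence "s \<in> gens k" using assms by simp
  thus ?thesis
    using assms Suc vert_Inl[of c _ j] vert_gen_less[of c _ j] by (cases rule: gens_cases) auto
qed

text \<open>For j = n + 1 an equality would put s_n into W_{n-1}. For smaller j, passing from c to c
  s_j leaves vertex number i in place and gives the vertex number j of c the number j + 1.\<close>

lemma vert_distinct:
  assumes "c \<in> lists (gens n)" "1 \<le> i" "i < j" "j \<le> Suc n"
  shows "vert c i \<noteq> vert c j"
  using assms(4,1-3)
proof (induction arbitrary: c rule: inc_induct)
  case base
  show ?case
  proof
    assume "vert c i = vert c (Suc n)"
    moreover have i: "i \<le> n" using base assms(3,4) by simp
    have "tail i \<in> lists (gens n)" using base by (intro gens_word) auto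
    ultimately obtain u where u: "u \<in> lists (Sprev V s1 m n)" "(c @ tail i) @ u \<doteq> c"
      unfolding vert_def using vtx_eq_iff[of "c @ tail i" c] base by (auto simp del: upt_Suc)
    have n: "n \<ge> 1" using i base by simp
    have uS: "u \<in> lists (gens n)" using u(1) lists_mono[OF Sprev_subset_gens[of n n]] by auto
    let ?p = "map gen [i..<n]"
    have p: "?p \<in> lists (Sprev V s1 m n)"
      using n base by (fastforce simp: Sprev_def intro!: gen_in_gens)
    have pS: "?p \<in> lists (gens n)" using base by (intro gens_word) auto
    have "tail i = ?p @ [gen n]" using i by simp
    hence "c @ (?p @ [gen n] @ u) \<doteq> c @ []" using u(2) by (simp del: upt_Suc)
    moreover have "c @ (?p @ [gen n] @ u) \<doteq> c @ [] \<longleftrightarrow> ?p @ [gen n] @ u \<doteq> []"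
      using base by (intro cox_eq_cancel_left)
    ultimately have "?p @ [gen n] @ u \<doteq> []" by blast
    hence "[gen n] @ u \<doteq> rev ?p" using cox_eq_move_left[of ?p "gens n" "[]" cox] pS by simp
    hence "[gen n] \<doteq> rev ?p @ rev u"
      using cox_eq_move_right[of u "gens n" "rev ?p" cox "[gen n]"] pS uS by simp
    moreover have "rev ?p @ rev u \<in> lists (Sprev V s1 m n)"
      using p u(1) by simp
    moreover have "gen n \<notin> Sprev V s1 m n" using n gen_notin_gens[of "n - 1"] by (simp add: Sprev_def)
    ultimately show False
      using gen_notin_parabolic[OF Sprev_subset_gens[of n n], of "gen n"]
        gen_in_gens[of n n] n by auto
  qed
next
  case (step k)
  have k: "1 \<le> k" "k \<le> n" "i < k" using step by auto
  have "vert (c @ [gen k]) i \<noteq> vert (c @ [gen k]) (Suc k)"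
    using step gen_in_gens[of k n] k by (intro step.IH) auto
  thus ?case using vert_gen_greater[of c i k] vert_gen_Suc[of k c] step k by simp
qed

text \<open>Iterated for decreasing \<open>j\<close>, this shows that the pointwise stabiliser of the vertices
  \<open>s_i \<dots> s_n W_{n-1}\<close> with \<open>i \<ge> j\<close> is \<open>W_{j-2}\<close>.\<close>

lemma vertex_stabiliser:
  assumes "1 \<le> j" "j \<le> Suc n" "x \<in> lists (gens (j - 1))" "u \<in> lists (Sprev V s1 m n)"
    and "x @ tail j @ u \<doteq> tail j"
  shows "\<exists>x'\<in>lists (Sprev V s1 m (j - 1)). x \<doteq> x'"
  using assms(2,1,3-)
proof (induction arbitrary: x rule: inc_induct)
  case base
  have uS: "u \<in> lists (gens n)" using base lists_mono[OF Sprev_subset_gens[of n n]] by auto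
  have "x \<doteq> rev u"
    using cox_eq_move_right[of u "gens n" "[]" cox x] base uS by simp
  thus ?case using base by auto
next
  case (step j)
  have uS: "u \<in> lists (gens n)" using step lists_mono[OF Sprev_subset_gens[of n n]] by auto
  have sub: "gens (j - 1) \<subseteq> gens j" "gens j \<subseteq> gens n" "gens (j - 1) \<subseteq> gens n"
    using step by (auto intro!: gens_mono)
  have sj: "gen j \<in> gens n" "gen j \<notin> gens (j - 1)" "gen j \<in> gens j"
    using step gen_in_gens gen_notin_gens[of "j - 1"] by auto
  have t: "tail j = [gen j] @ tail (Suc j)" using step by (simp add: tail_Suc del: upt_Suc)
  have tS: "tail (Suc j) \<in> lists (gens n)" by (intro gens_word) auto
  have x: "x \<in> lists (gens j)" "x \<in> lists (gens n)" using step sub by auto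
  let ?y = "[gen j] @ x @ [gen j]"
  have "[gen j] @ (x @ tail j @ u) \<doteq> [gen j] @ tail j"
    using step sj by (intro cox_eq_append cox_refl) auto
  moreover have "[] @ [gen j, gen j] @ tail (Suc j) \<doteq> [] @ tail (Suc j)"
    using sj tS by (intro cox_eq_cancel_mid cox_eq_double) auto
  ultimately have "?y @ tail (Suc j) @ u \<doteq> tail (Suc j)"
    unfolding t by (auto intro: cox_trans simp del: upt_Suc)
  then obtain y where y: "y \<in> lists (gens (j - 1))" "?y \<doteq> y"
    using step.IH[of ?y] step.hyps step.prems x sj Sprev_Suc[of "j - 1"] by (auto simp del: upt_Suc Sprev_Suc)
  from gen_conjugate[OF sub(3) sj(1,2) _ y(1) y(2)] step
  obtain x' where x': "x' \<in> lists {t \<in> gens (j - 1). cox (gen j) t = 2}" "x \<doteq> x'"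
    by auto
  \<comment> \<open>\<open>Sprev V s1 m (j - 1)\<close> is S_{j-2}. For j \<ge> 2 the condition
    removes s_{j-1} from S_{j-1}; for j = 1 it removes the neighbours of s_1 and leaves
    S_{-1}.\<close>
  have "{t \<in> gens (j - 1). cox (gen j) t = 2} \<subseteq> Sprev V s1 m (j - 1)"
  proof safe
    fix t assume t: "t \<in> gens (j - 1)" "cox (gen j) t = 2"
    show "t \<in> Sprev V s1 m (j - 1)"
      using t(1)
    proof (cases rule: gens_cases)
      case (1 a)
      then show ?thesis
        using t(2) cox_Inl_gen1(2)[of a] step by (cases "j = 1") (auto simp: Sprev_def Sm1_def Sset_def)
    next
      case (2 i)
      have "j \<noteq> Suc i" using t(2) cox_gen_gen[of j i] 2 by (auto simp: numeral_eq_enat)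
      hence "i \<le> j - 1 - 1" "j - 1 \<noteq> 0" using 2 by auto
      then show ?thesis
        using 2 gen_in_gens[of i "j - 1 - 1"] by (simp add: Sprev_def)
    qed
  qed
  thus ?case using x' by (meson lists_mono subsetD)
qed

section \<open>The n-simplices as ordered lists of vertices\<close>

definition facet_list :: "('g + nat) list \<Rightarrow> ('g + nat) list set list" where
  "facet_list c = map (vert c) [1..<Suc (Suc n)]"

text \<open>The set forgets the ordering in \<open>facet_list c\<close>, which determines the lift
  \<open>c\<close> up to W_{-1}; keeping both separates the stabiliser into reorderings and
  W_{-1}.\<close>

definition facet :: "('g + nat) list \<Rightarrow> ('g + nat) list set set" where
  "facet c = set (facet_list c)"

lemma length_facet_list [simp]: "length (facet_list c) = Suc n"
  by (simp add: facet_list_def del: upt_Suc)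

lemma facet_list_nth: "i \<le> n \<Longrightarrow> facet_list c ! i = vert c (Suc i)"
  by (simp add: facet_list_def del: upt_Suc)

lemma distinct_facet_list:
  assumes "c \<in> lists (gens n)"
  shows "distinct (facet_list c)"
proof -
  have "vert c i \<noteq> vert c j" if "i \<noteq> j" "1 \<le> i" "i \<le> Suc n" "1 \<le> j" "j \<le> Suc n" for i j
    using vert_distinct[of c i j] vert_distinct[of c j i] that assms by (cases "i < j") auto
  thus ?thesis
    unfolding facet_list_def distinct_map inj_on_def
    by (metis distinct_upt atLeastLessThan_iff less_Suc_eq_le set_upt)
qed

lemma facet_list_cong: "c \<doteq> c' \<Longrightarrow> facet_list c = facet_list c'"
  by (auto simp: facet_list_def vert_cong simp del: upt_Suc)

lemma facet_cong: "c \<doteq> c' \<Longrightarrow> facet c = facet c'"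
  by (simp add: facet_def facet_list_cong)

lemma facet_list_gen:
  assumes "c \<in> lists (gens n)" "facet_list c = a @ x # y # b"
  shows "\<exists>s\<in>gen ` {1..n}. facet_list (c @ [s]) = a @ y # x # b"
proof (intro bexI)
  \<comment> \<open>List positions count from 0 and vertices from 1, so exchanging the entries at
    \<open>length a\<close> and \<open>length a + 1\<close> is multiplication by s_k with k =
    \<open>length a + 1\<close>.\<close>
  let ?k = "Suc (length a)"
  have len: "length a + 2 + length b = Suc n"
    using arg_cong[OF assms(2), of length] by simp
  show "facet_list (c @ [gen ?k]) = a @ y # x # b"
  proof (rule nth_equalityI)
    show "length (facet_list (c @ [gen ?k])) = length (a @ y # x # b)" using len by simp
    fix i assume "i < length (facet_list (c @ [gen ?k]))"
    hence i: "i \<le> n" by simp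
    have old: "vert c (Suc l) = (a @ x # y # b) ! l" if "l \<le> n" for l
      using facet_list_nth[OF that, of c] assms(2) by simp
    consider "i < length a" | "i = length a" | "i = ?k" | "i > ?k" by linarith
    then show "facet_list (c @ [gen ?k]) ! i = (a @ y # x # b) ! i"
    proof cases
      case 1
      then show ?thesis
        using i facet_list_nth[OF i, of "c @ [gen ?k]"] vert_gen_greater[of c "Suc i" ?k] old[of i] assms len
        by (simp add: nth_append)
    next
      case 2
      then show ?thesis
        using i facet_list_nth[OF i, of "c @ [gen ?k]"] vert_gen_same[of c ?k] old[of "Suc i"] assms len
        by (simp add: nth_append)
    next
      case 3
      then show ?thesis
        using i facet_list_nth[OF i, of "c @ [gen ?k]"] vert_gen_Suc[of ?k c] old[of "length a"] assms len
        by (simp add: nth_append)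
    next
      case 4
      hence "(a @ x # y # b) ! i = (a @ y # x # b) ! i"
        by (auto simp: nth_append nth_Cons split: nat.splits)
      then show ?thesis
        using 4 i facet_list_nth[OF i, of "c @ [gen ?k]"] vert_gen_less[of c ?k "Suc i"] old[of i] assms len
        by simp
    qed
  qed
  show "gen ?k \<in> gen ` {1..n}" using len by auto
qed

lemma gen_words: "lists (gen ` {1..n}) \<subseteq> lists (gens n)"
  by (intro lists_mono) (auto simp: gen_in_gens)

text \<open>s_1, ..., s_n act on the n + 1 positions as adjacent transpositions, which generate all
  permutations.\<close>

lemma facet_list_reorder:
  assumes "c \<in> lists (gens n)" "mset xs = mset (facet_list c)"
  shows "\<exists>y\<in>lists (gen ` {1..n}). facet_list (c @ y) = xs"
proof (rule adjacent_swaps_induct[of "facet_list c" xs])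
  show "\<exists>y\<in>lists (gen ` {1..n}). facet_list (c @ y) = facet_list c"
    by (intro bexI[of _ "[]"]) auto
  fix a x z b assume "\<exists>y\<in>lists (gen ` {1..n}). facet_list (c @ y) = a @ x # z # b"
  then obtain y where y: "y \<in> lists (gen ` {1..n})" "facet_list (c @ y) = a @ x # z # b" by blast
  hence "c @ y \<in> lists (gens n)" using gen_words assms by auto
  from facet_list_gen[OF this y(2)] obtain s
    where "s \<in> gen ` {1..n}" "facet_list ((c @ y) @ [s]) = a @ z # x # b" by blast
  thus "\<exists>y\<in>lists (gen ` {1..n}). facet_list (c @ y) = a @ z # x # b"
    using y by (intro bexI[of _ "y @ [s]"]) auto
qed (use assms in auto)

lemma facet_gen:
  assumes "c \<in> lists (gens n)" "1 \<le> i" "i \<le> n"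
  shows "facet (c @ [gen i]) = facet c"
proof -
  have img: "facet c = vert c ` {1..Suc n}" for c
    by (auto simp: facet_def facet_list_def simp del: upt_Suc)
  have sub: "facet (c @ [gen i]) \<subseteq> facet c" if "c \<in> lists (gens n)" for c
  proof
    fix v assume "v \<in> facet (c @ [gen i])"
    then obtain j where j: "v = vert (c @ [gen i]) j" "1 \<le> j" "j \<le> Suc n" by (auto simp: img)
    consider "Suc i < j" | "j = Suc i" | "j = i" | "j < i" by linarith
    hence "v \<in> {vert c j, vert c i, vert c (Suc i)}"
      using j assms that vert_gen_less[of c i j] vert_gen_Suc[of i c] vert_gen_same[of c i]
        vert_gen_greater[of c j i] by cases auto
    thus "v \<in> facet c" using j assms by (auto simp: img)
  qed
  have "facet (c @ [gen i, gen i]) = facet (c @ [])"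
    using assms gen_in_gens by (intro facet_cong cox_eq_append_left cox_eq_double) auto
  with sub[of c] sub[of "c @ [gen i]"] assms gen_in_gens[of i n] show ?thesis by auto
qed

lemma facet_list_Sprev:
  assumes "c \<in> lists (gens n)" "i \<le> Suc n" "z \<in> lists (Sprev V s1 m i)"
  shows "drop i (facet_list (c @ z)) = drop i (facet_list c)"
  using assms(3)
proof (induction z rule: rev_induct)
  case (snoc s z)
  have "c @ z \<in> lists (gens n)"
    using assms snoc Sprev_subset_gens[of i n] lists_mono[of "Sprev V s1 m i" "gens n"] by auto
  hence "vert ((c @ z) @ [s]) j = vert (c @ z) j" if "i < j" "j \<le> Suc n" for j
    using vert_Sprev[of "c @ z" s i j] that snoc by auto
  hence "drop i (facet_list ((c @ z) @ [s])) = drop i (facet_list (c @ z))"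
    by (intro nth_equalityI) (auto simp: facet_list_nth)
  then show ?case using snoc by simp
qed simp

lemma facet_stabiliser:
  assumes "c \<in> lists (gens n)" "y \<in> lists (Sm1 V s1 m \<union> gen ` {1..n})"
  shows "facet (c @ y) = facet c"
  using assms(2)
proof (induction y rule: rev_induct)
  case (snoc s y)
  have "Sm1 V s1 m \<subseteq> gens n" by (auto simp: Sm1_def Sset_def)
  hence cy: "c @ y \<in> lists (gens n)" using assms(1) snoc.prems gen_in_gens by auto
  from snoc.prems consider "s \<in> Sm1 V s1 m" | i where "s = gen i" "1 \<le> i" "i \<le> n" by auto
  hence "facet ((c @ y) @ [s]) = facet (c @ y)"
  proof cases
    case 1
    then show ?thesis using facet_list_Sprev[OF cy, of 0 "[s]"] by (simp add: facet_def Sprev_def)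
  qed (use facet_gen[OF cy] in auto)
  then show ?case using snoc by simp
qed simp

text \<open>Downward induction on \<open>i\<close>. For i = n + 1 the quotient of the lifts is an
  arbitrary element of W_n. One more common vertex means that the quotient, so far in W_i, fixes
  s_{i+1} ... s_n W_{n-1}, and \<open>vertex_stabiliser\<close> puts it into W_{i-1}.\<close>

lemma lift_unique:
  assumes "c \<in> lists (gens n)" "c' \<in> lists (gens n)" "i \<le> Suc n"
    and "drop i (facet_list c) = drop i (facet_list c')"
  shows "\<exists>w\<in>lists (Sprev V s1 m i). c @ w \<doteq> c'"
  using assms(3,4)
proof (induction rule: inc_induct)
  case base
  have "c @ (rev c @ c') \<doteq> c'"
    using cox_eq_cancel_mid[OF cox_eq_append_rev, of c "gens n" "[]" c' cox] assms by simp
  then show ?case using assms by (intro bexI[of _ "rev c @ c'"]) auto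
next
  case (step i)
  have i: "i \<le> n" using step by simp
  have "drop (Suc i) (facet_list c) = drop (Suc i) (facet_list c')"
    using arg_cong[OF step.prems, of tl] by (simp add: drop_Suc tl_drop)
  with step.IH obtain w where w: "w \<in> lists (gens i)" "c @ w \<doteq> c'" by auto
  hence wS: "w \<in> lists (gens n)" using lists_mono[OF gens_mono[OF i]] by auto
  have t: "tail (Suc i) \<in> lists (gens n)" by (intro gens_word) auto
  have "facet_list c ! i = facet_list c' ! i"
    using arg_cong[OF step.prems, of "\<lambda>l. l ! 0"] i by simp
  hence "vert (c @ w) (Suc i) = vert c (Suc i)"
    using vert_cong[OF w(2), of "Suc i"] i by (simp add: facet_list_nth)
  then obtain u where u: "u \<in> lists (Sprev V s1 m n)" "((c @ w) @ tail (Suc i)) @ u \<doteq> c @ tail (Suc i)"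
    unfolding vert_def using vtx_eq_iff[of "(c @ w) @ tail (Suc i)" "c @ tail (Suc i)"] assms wS t
    by (auto simp del: upt_Suc)
  hence "c @ (w @ tail (Suc i) @ u) \<doteq> c @ tail (Suc i)" by simp
  hence "w @ tail (Suc i) @ u \<doteq> tail (Suc i)"
    using cox_eq_cancel_left[of c "gens n" cox] assms by simp
  with vertex_stabiliser[of "Suc i" w u] w u i obtain w'
    where w': "w' \<in> lists (Sprev V s1 m i)" "w \<doteq> w'" by auto
  have "c @ w' \<doteq> c @ w" using w' assms by (intro cox_eq_append cox_refl) (auto intro: cox_eq.cox_sym)
  with w w' show ?case by (blast intro: cox_trans)
qed

section \<open>Length of an n-simplex and the shelling condition\<close>

definition facets :: "('g + nat) list set set set" where
  "facets = facet ` lists (gens n)"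

definition flen :: "('g + nat) list set set \<Rightarrow> nat" where
  "flen A = (LEAST k. \<exists>c\<in>lists (gens n). facet c = A \<and> length c = k)"

lemma flen_le: "c \<in> lists (gens n) \<Longrightarrow> flen (facet c) \<le> length c"
  unfolding flen_def by (rule Least_le) auto

lemma flen_witness:
  assumes "A \<in> facets"
  obtains c where "c \<in> lists (gens n)" "facet c = A" "length c = flen A"
proof -
  have "\<exists>c\<in>lists (gens n). facet c = A \<and> length c = flen A"
    unfolding flen_def by (rule LeastI_ex) (use assms in \<open>auto simp: facets_def\<close>)
  with that show ?thesis by blast
qed

lemma finite_flen_le: "finite {A \<in> facets. flen A \<le> N}"
proof (rule finite_subset)
  show "{A \<in> facets. flen A \<le> N} \<subseteq> facet ` {c. set c \<subseteq> gens n \<and> length c \<le> N}"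
  proof
    fix A assume A: "A \<in> {A \<in> facets. flen A \<le> N}"
    then obtain c where "c \<in> lists (gens n)" "facet c = A" "length c = flen A"
      by (auto elim: flen_witness)
    with A show "A \<in> facet ` {c. set c \<subseteq> gens n \<and> length c \<le> N}" by (auto simp: in_lists_conv_set)
  qed
  show "finite (facet ` {c. set c \<subseteq> gens n \<and> length c \<le> N})"
    using finite_lists_length_le[OF finite_gens] by blast
qed

text \<open>After a word in s_1, ..., s_n has matched the two orderings, the lifts differ by an
  element of W_{-1}.\<close>

lemma facet_same_lift:
  assumes "c \<in> lists (gens n)" "d \<in> lists (gens n)" "facet c = facet d"
  shows "\<exists>y\<in>lists (Sm1 V s1 m \<union> gen ` {1..n}). d @ y \<doteq> c"
proof -
  have "mset (facet_list c) = mset (facet_list d)"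
    using assms distinct_facet_list by (simp add: facet_def set_eq_iff_mset_eq_distinct)
  with facet_list_reorder[of d "facet_list c"] assms obtain y
    where y: "y \<in> lists (gen ` {1..n})" "facet_list (d @ y) = facet_list c" by blast
  with lift_unique[of "d @ y" c 0] assms gen_words obtain w
    where w: "w \<in> lists (Sm1 V s1 m)" "(d @ y) @ w \<doteq> c" by (auto simp: Sprev_def)
  thus ?thesis using y by (intro bexI[of _ "y @ w"]) auto
qed

text \<open>Write x s = d y with \<open>d\<close> a shortest lift of the new simplex and
  \<open>y\<close> stabilising it. Since x is shorter than x s, exchange deletes a letter of the
  possibly unreduced word d y. A letter of \<open>y\<close> shows that x lifts the same simplex; a
  letter of \<open>d\<close> yields a lift of the old simplex shorter than \<open>d\<close>.\<close>

lemma flen_step: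
  assumes "x \<in> lists (gens n)" "s \<in> gens n"
    and less: "clen cox (gens n) x < clen cox (gens n) (x @ [s])"
  shows "facet (x @ [s]) = facet x \<or> flen (facet x) < flen (facet (x @ [s]))"
proof -
  have xs: "x @ [s] \<in> lists (gens n)" using assms by simp
  have "facet (x @ [s]) \<in> facets" using xs by (simp add: facets_def)
  then obtain d where d: "d \<in> lists (gens n)" "facet d = facet (x @ [s])"
    "length d = flen (facet (x @ [s]))"
    by (rule flen_witness)
  obtain y where y: "y \<in> lists (Sm1 V s1 m \<union> gen ` {1..n})" "d @ y \<doteq> x @ [s]"
    using facet_same_lift[OF xs d(1)] d by auto
  have "x @ ([s, s]) @ [] \<doteq> x @ []"
    by (intro cox_eq_cancel_mid cox_eq_double) (use assms in auto)
  hence xss: "(x @ [s]) @ [s] \<doteq> x" by simp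
  from exchange[OF xs assms(2) _ cox_eq.cox_sym[OF y(2)]] less clen_cong[OF xss]
  obtain a r b where ab: "d @ y = a @ [r] @ b" "(x @ [s]) @ [s] \<doteq> a @ b" by auto
  have x: "x \<doteq> a @ b" using ab(2) xss by (meson cox_eq.cox_sym cox_trans)
  from ab(1) consider b' where "d = a @ [r] @ b'" "b = b' @ y" | a' where "a = d @ a'" "y = a' @ [r] @ b"
    by (auto simp: append_eq_append_conv2 append_eq_Cons_conv)
  then show ?thesis
  proof cases
    case 1
    hence "a @ b' \<in> lists (gens n)" using d by auto
    hence "facet x = facet (a @ b')" "flen (facet (a @ b')) \<le> length (a @ b')"
      using facet_cong[OF x] facet_stabiliser[of "a @ b'" y] y 1 flen_le[of "a @ b'"] by auto
    thus ?thesis using d 1 by simp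
  next
    case 2
    hence "facet x = facet d"
      using facet_cong[OF x] facet_stabiliser[of d "a' @ b"] y d by auto
    thus ?thesis using d by simp
  qed
qed

lemma facets_shelling:
  assumes A: "A \<in> facets" and B: "B \<in> facets" and neq: "A \<noteq> B" and le: "flen B \<le> flen A"
  shows "\<exists>D\<in>facets. flen D < flen A \<and> (\<exists>x\<in>A - B. A - {x} \<subseteq> D)"
proof -
  obtain a where a: "a \<in> lists (gens n)" "facet a = A" using A by (auto simp: facets_def)
  obtain b where b: "b \<in> lists (gens n)" "facet b = B" using B by (auto simp: facets_def)
  have finA: "finite A" "card A = Suc n" and finB: "finite B" "card B = Suc n"
    using a b distinct_facet_list distinct_card unfolding facet_def by fastforce+
  obtain f pa pb where f: "set f = A \<inter> B" "distinct f" and pa: "set pa = A - B" "distinct pa"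
    and pb: "set pb = B - A" "distinct pb"
    using finite_distinct_list[of "A \<inter> B"] finite_distinct_list[of "A - B"]
      finite_distinct_list[of "B - A"] finA finB by (metis finite_Diff finite_Int)
  \<comment> \<open>Both orderings end with the common vertices \<open>f\<close>, so the lifts
    \<open>e\<close> and \<open>e'\<close> agree beyond position \<open>i\<close> = card (A - B) and
    differ by an element of W_{i-1}.\<close>
  have "mset (pa @ f) = mset (facet_list a)" "mset (pb @ f) = mset (facet_list b)"
    using a b f pa pb distinct_facet_list
    by (subst set_eq_iff_mset_eq_distinct[symmetric]; force simp: facet_def)+
  then obtain ya yb where ya: "ya \<in> lists (gen ` {1..n})" "facet_list (a @ ya) = pa @ f"
    and yb: "yb \<in> lists (gen ` {1..n})" "facet_list (b @ yb) = pb @ f"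
    using facet_list_reorder a b by meson
  define e e' where "e = a @ ya" and "e' = b @ yb"
  have e: "e \<in> lists (gens n)" "facet_list e = pa @ f" "facet e = A"
    and e': "e' \<in> lists (gens n)" "facet_list e' = pb @ f" "facet e' = B"
    using a b ya yb gen_words f pa pb by (auto simp: e_def e'_def facet_def)
  define i where "i = length pa"
  have len: "length pa + length f = Suc n" "length pb + length f = Suc n"
    using arg_cong[OF e(2), of length] arg_cong[OF e'(2), of length] by auto
  have i: "1 \<le> i" "i \<le> Suc n" "length pb = i"
  proof -
    have "A - B \<noteq> {}" using neq finA finB by (metis Diff_eq_empty_iff card_subset_eq)
    thus "1 \<le> i" using pa by (cases pa) (auto simp: i_def)
  qed (use len in \<open>auto simp: i_def\<close>)
  let ?R = "Sprev V s1 m i"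
  have R: "?R \<subseteq> gens n" using Sprev_subset_gens i by auto
  hence RS: "lists ?R \<subseteq> lists (gens n)" by (rule lists_mono)
  obtain w where w: "w \<in> lists ?R" "e @ w \<doteq> e'"
    using lift_unique[OF e(1) e'(1) i(2)] e e' i by (auto simp: i_def)
  define P where "P g \<longleftrightarrow> (\<exists>z\<in>lists ?R. e @ z \<doteq> g)" for g
  have "P e" using e by (auto simp: P_def intro!: bexI[of _ "[]"] cox_refl)
  then obtain g where g: "P g" "\<And>g'. P g' \<Longrightarrow> length g \<le> length g'"
    using arg_min_natI[of P e length] arg_min_nat_le[of P _ length] by blast
  then obtain z0 where z0: "z0 \<in> lists ?R" "e @ z0 \<doteq> g" by (auto simp: P_def)
  have gS: "g \<in> lists (gens n)" using cox_eq_lists[OF z0(2)] by simp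
  have gmin: "length g \<le> length g'" if "z \<in> lists ?R" "g @ z \<doteq> g'" for z g'
  proof (rule g(2))
    have "(e @ z0) @ z \<doteq> g @ z" using z0 that RS by (intro cox_eq_append cox_refl) auto
    with that z0 show "P g'" unfolding P_def by (intro bexI[of _ "z0 @ z"]) (auto intro: cox_trans)
  qed
  have eg: "g @ rev z0 \<doteq> e"
    using cox_eq_move_right[of z0 "gens n" g cox e] z0 gS RS by (auto intro: cox_eq.cox_sym)
  \<comment> \<open>Shortest words over R, not arbitrary ones, have to lead from \<open>g\<close> to
    \<open>e\<close> and \<open>e'\<close>: only along these does \<open>coset_path\<close> show
    that every letter increases the length.\<close>
  have minword: "\<exists>z\<in>lists ?R. g @ z \<doteq> y \<and> (\<forall>z'\<in>lists ?R. y \<doteq> g @ z' \<longrightarrow> length z \<le> length z')"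
    if ex: "\<exists>z\<in>lists ?R. g @ z \<doteq> y" for y
  proof -
    define Q where "Q z \<longleftrightarrow> z \<in> lists ?R \<and> g @ z \<doteq> y" for z
    obtain z where "Q z" using ex by (auto simp: Q_def)
    hence "Q (arg_min length Q)" "\<forall>z'. Q z' \<longrightarrow> length (arg_min length Q) \<le> length z'"
      using arg_min_natI[of Q z length] arg_min_nat_le[of Q _ length] by auto
    thus ?thesis by (auto simp: Q_def intro: cox_eq.cox_sym)
  qed
  have "\<exists>z\<in>lists ?R. g @ z \<doteq> e" using eg z0 by (intro bexI[of _ "rev z0"]) auto
  from minword[OF this] obtain z where z: "z \<in> lists ?R" "g @ z \<doteq> e"
    "\<And>z'. z' \<in> lists ?R \<Longrightarrow> e \<doteq> g @ z' \<Longrightarrow> length z \<le> length z'" by blast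
  have "(g @ rev z0) @ w \<doteq> e @ w" using eg w RS by (intro cox_eq_append cox_refl) auto
  hence "\<exists>z\<in>lists ?R. g @ z \<doteq> e'"
    using z0 w by (intro bexI[of _ "rev z0 @ w"]) (auto intro: cox_trans)
  from minword[OF this] obtain z' where z': "z' \<in> lists ?R" "g @ z' \<doteq> e'"
    "\<And>x. x \<in> lists ?R \<Longrightarrow> e' \<doteq> g @ x \<Longrightarrow> length z' \<le> length x" by blast
  have path: "facet (g @ p @ [r]) = facet (g @ p) \<or> flen (facet (g @ p)) < flen (facet (g @ p @ [r]))"
    if "x = p @ [r] @ q" "x \<in> lists ?R" "g @ x \<doteq> y"
      "\<And>x'. x' \<in> lists ?R \<Longrightarrow> y \<doteq> g @ x' \<Longrightarrow> length x \<le> length x'" for x y p r q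
  proof -
    have "clen cox (gens n) (g @ p) < clen cox (gens n) (g @ p @ [r])"
    proof (rule coset_path[OF R gS])
      show "p @ [r] @ q \<in> lists ?R" using that by auto
      show "length (p @ [r] @ q) \<le> length x'" if "x' \<in> lists ?R" "g @ p @ [r] @ q \<doteq> g @ x'" for x'
        using \<open>\<And>x'. x' \<in> lists ?R \<Longrightarrow> y \<doteq> g @ x' \<Longrightarrow> length x \<le> length x'\<close>[of x'] that
          \<open>x = p @ [r] @ q\<close> \<open>g @ x \<doteq> y\<close> by (metis cox_eq.cox_sym cox_trans)
    qed (use gmin in auto)
    moreover have "g @ p \<in> lists (gens n)" "r \<in> gens n" using that gS R RS by auto
    ultimately show ?thesis using flen_step[of "g @ p" r] by auto
  qed
  have up: "facet (g @ p) = facet g \<or> flen (facet g) < flen (facet (g @ p))" if "z' = p @ q" for p q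
    using that
  proof (induction p arbitrary: q rule: rev_induct)
    case (snoc r p)
    with snoc.IH[of "[r] @ q"] path[of z' p r q e'] z' show ?case by auto
  qed simp
  \<comment> \<open>The path towards \<open>e'\<close> bounds the simplex of \<open>g\<close> by
    that of B; with \<open>flen B \<le> flen A\<close> it cannot be A. So the path towards
    \<open>e\<close> enters A at some letter \<open>r\<close>.\<close>
  have "facet g = B \<or> flen (facet g) < flen B"
    using up[of z' "[]"] facet_cong[OF z'(2)] e' by auto
  hence gA: "facet g \<noteq> A" using neq le by auto
  have "\<exists>p r q. z = p @ [r] @ q \<and> facet (g @ p @ [r]) = A \<and> facet (g @ p) \<noteq> A"
  proof (rule ccontr)
    assume no: "\<not> ?thesis"
    have "facet (g @ p) \<noteq> A" if "z = p @ q" for p q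
      using that
    proof (induction p arbitrary: q rule: rev_induct)
      case (snoc r p)
      with snoc.IH[of "[r] @ q"] no show ?case by auto
    qed (use gA in simp)
    from this[of z "[]"] show False using facet_cong[OF z(2)] e by simp
  qed
  then obtain p r q where pr: "z = p @ [r] @ q" "facet (g @ p @ [r]) = A" "facet (g @ p) \<noteq> A" by blast
  have less: "flen (facet (g @ p)) < flen A" using path[OF pr(1) z(1,2,3)] pr by auto
  have gp: "g @ p \<in> lists (gens n)" and r: "r \<in> ?R" "r \<in> gens n" using gS pr z RS R by auto
  \<comment> \<open>s_1, ..., s_n preserve the simplex, so the letter entering A is an old generator
    and affects vertex number 1 alone.\<close>
  obtain c where c: "r = Inl c" "c \<in> V" "c \<noteq> s1"
    using r(2)
  proof (cases rule: gens_cases)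
    case (2 j)
    hence "facet ((g @ p) @ [r]) = facet (g @ p)" using facet_gen[OF gp] by simp
    then show ?thesis using pr by simp
  qed
  let ?y = "g @ p @ [r]"
  have y: "?y \<in> lists (gens n)" using gp r by simp
  have tail_eq: "vert ?y j = vert (g @ p) j" if "2 \<le> j" "j \<le> Suc n" for j
    using vert_Inl[OF gp c(2,3) that] c by simp
  \<comment> \<open>All words used lie over R, so the last positions still hold A \<inter> B. As i
    \<ge> 1, the first vertex is not among them; it is the vertex in which A leaves the new
    simplex.\<close>
  have set_drop: "drop i (facet_list ?y) = f"
  proof -
    have "drop i (facet_list ?y) = drop i (facet_list g)"
      using facet_list_Sprev[OF gS i(2), of "p @ [r]"] z pr by auto
    also have "\<dots> = drop i (facet_list (g @ z))" using facet_list_Sprev[OF gS i(2), of z] z by simp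
    also have "\<dots> = f" using facet_list_cong[OF z(2)] e by (simp add: i_def)
    finally show ?thesis .
  qed
  define x where "x = hd (facet_list ?y)"
  have cons: "facet_list ?y = x # tl (facet_list ?y)"
    unfolding x_def by (metis length_facet_list list.collapse list.size(3) nat.distinct(1))
  have xA: "x \<in> A" using pr(2) cons by (metis facet_def list.set_intros(1))
  have dist: "distinct (facet_list ?y)" by (rule distinct_facet_list[OF y])
  have "x \<notin> set (tl (facet_list ?y))" using dist cons by (metis distinct.simps(2))
  moreover have "set f \<subseteq> set (tl (facet_list ?y))"
  proof -
    have "drop i (facet_list ?y) = drop (i - 1) (tl (facet_list ?y))"
      using i(1) by (cases i) (auto simp: drop_Suc)
    thus ?thesis using set_drop set_drop_subset by metis
  qed
  ultimately have "x \<notin> B" using f xA by auto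
  moreover have "A - {x} \<subseteq> facet (g @ p)"
  proof
    fix v assume v: "v \<in> A - {x}"
    hence "v \<in> set (tl (facet_list ?y))" using pr(2) cons unfolding facet_def by (metis Diff_iff insertI1 insertE list.simps(15))
    then obtain j where "j < n" "v = facet_list ?y ! Suc j"
      by (auto simp: in_set_conv_nth nth_tl)
    hence "v = facet_list (g @ p) ! Suc j" "Suc j < Suc n"
      using tail_eq[of "Suc (Suc j)"] by (auto simp: facet_list_nth)
    thus "v \<in> facet (g @ p)" unfolding facet_def by (metis length_facet_list nth_mem)
  qed
  moreover have "facet (g @ p) \<in> facets" using gp by (auto simp: facets_def)
  ultimately show ?thesis using less xA by blast
qed

lemma facet_finite_card: "A \<in> facets \<Longrightarrow> finite A \<and> card A = Suc n"
  using distinct_facet_list distinct_card unfolding facet_def facets_def by fastforce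

section \<open>Simplices as nonempty subsets of n-simplices\<close>

lemma simplex_of_eq:
  assumes "k \<le> n"
  shows "simplex_of V s1 m n c k = set (drop (n - k) (facet_list c))"
proof -
  have "drop (n - k) (facet_list c) = map (vert c) [Suc n - k..<Suc (Suc n)]"
    using assms by (simp add: facet_list_def drop_map Suc_diff_le del: upt_Suc)
  thus ?thesis by (auto simp: simplex_of_def vert_def less_Suc_eq_le simp del: upt_Suc)
qed

text \<open>A simplex is a final segment of the vertex list of some lift. Reordering moves any
  nonempty subset of an n-simplex to the end of the list for another lift of the same
  n-simplex.\<close>

lemma Cn_eq: "Cn V s1 m n = {A. A \<noteq> {} \<and> (\<exists>B\<in>facets. A \<subseteq> B)}"
proof (intro set_eqI iffI)
  fix A assume "A \<in> Cn V s1 m n"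
  then obtain c k where "A = simplex_of V s1 m n c k" "c \<in> lists (gens n)" "k \<le> n" by (auto simp: Cn_def)
  moreover from this have "A = set (drop (n - k) (facet_list c))" by (simp add: simplex_of_eq)
  ultimately show "A \<in> {A. A \<noteq> {} \<and> (\<exists>B\<in>facets. A \<subseteq> B)}"
    using set_drop_subset[of "n - k" "facet_list c"] by (auto simp: facets_def facet_def)
next
  fix A assume "A \<in> {A. A \<noteq> {} \<and> (\<exists>B\<in>facets. A \<subseteq> B)}"
  then obtain c where c: "A \<noteq> {}" "c \<in> lists (gens n)" "A \<subseteq> facet c" by (auto simp: facets_def)
  have fc: "finite (facet c)" "card (facet c) = Suc n"
    using facet_finite_card[of "facet c"] c by (auto simp: facets_def)
  then obtain p q where p: "set p = facet c - A" "distinct p" and q: "set q = A" "distinct q"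
    using finite_distinct_list[of "facet c - A"] finite_distinct_list[of A] c by (metis finite_Diff finite_subset)
  have "mset (p @ q) = mset (facet_list c)"
    using p q c distinct_facet_list by (subst set_eq_iff_mset_eq_distinct[symmetric]) (auto simp: facet_def)
  then obtain y where y: "y \<in> lists (gen ` {1..n})" "facet_list (c @ y) = p @ q"
    using facet_list_reorder c by blast
  have len: "length p + length q = Suc n" using arg_cong[OF y(2), of length] by simp
  have q0: "length q \<ge> 1" using c q by (cases q) auto
  have "n - (length q - 1) = length p" using len q0 by linarith
  hence "simplex_of V s1 m n (c @ y) (length q - 1) = A"
    using simplex_of_eq[of "length q - 1" "c @ y"] y q len q0 by simp
  moreover have "c @ y \<in> lists (gens n)" "length q - 1 \<le> n" using c y gen_words len q0 by auto
  ultimately show "A \<in> Cn V s1 m n" unfolding Cn_def by blast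
qed

end

section \<open>The weak topology on the realization\<close>

lemma continuous_on_Min_image:
  fixes f :: "'b \<Rightarrow> 'c::topological_space \<Rightarrow> real"
  assumes "finite X" "X \<noteq> {}" "\<And>x. x \<in> X \<Longrightarrow> continuous_on S (f x)"
  shows "continuous_on S (\<lambda>s. Min ((\<lambda>x. f x s) ` X))"
  using assms
proof (induction X rule: finite_ne_induct)
  case (insert x X)
  hence "continuous_on S (\<lambda>s. min (f x s) (Min ((\<lambda>x. f x s) ` X)))"
    by (intro continuous_on_min) auto
  then show ?case using insert by simp
qed auto

lemma continuous_on_apply [continuous_intros]:
  "continuous_on S (\<lambda>f :: 'a \<Rightarrow> 'b::topological_space. f v)"
  by (rule continuous_on_subset[OF continuous_on_product_coordinates]) simp

lemma closed_fun_singleton: "closed {f :: 'a \<Rightarrow> real}"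
proof -
  have "closed {g :: 'a \<Rightarrow> real. g v = f v}" for v
    by (intro closed_Collect_eq continuous_on_apply continuous_on_const)
  hence "closed (\<Inter>v. {g :: 'a \<Rightarrow> real. g v = f v})" by blast
  also have "(\<Inter>v. {g :: 'a \<Rightarrow> real. g v = f v}) = {f}" by auto
  finally show ?thesis .
qed

lemma closed_fun_finite: "finite A \<Longrightarrow> closed (A :: ('a \<Rightarrow> real) set)"
  by (induction A rule: finite_induct) (auto simp: closed_insert closed_fun_singleton intro: closed_Un[OF closed_fun_singleton, simplified])

section \<open>Closed simplices\<close>

lemma closed_closed_simplex:
  assumes "finite s"
  shows "closed (closed_simplex s :: ('a \<Rightarrow> real) set)"
proof -
  have "closed {f :: 'a \<Rightarrow> real. 0 \<le> f v}" for v
    by (intro closed_Collect_le continuous_on_apply continuous_on_const)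
  moreover have "closed {f :: 'a \<Rightarrow> real. f v = 0}" for v
    by (intro closed_Collect_eq continuous_on_apply continuous_on_const)
  moreover have "closed {f :: 'a \<Rightarrow> real. sum f s = 1}"
    by (intro closed_Collect_eq continuous_on_sum continuous_on_apply continuous_on_const)
  ultimately have "closed ((\<Inter>v. {f. 0 \<le> f v}) \<inter> (\<Inter>v\<in>-s. {f. f v = 0}) \<inter> {f :: 'a \<Rightarrow> real. sum f s = 1})"
    by (intro closed_Int closed_INT) auto
  also have "\<dots> = closed_simplex s" by (auto simp: closed_simplex_def)
  finally show ?thesis .
qed

lemma closed_simplex_mono:
  assumes "s \<subseteq> t" "finite t"
  shows "closed_simplex s \<subseteq> closed_simplex t"
proof
  fix f assume f: "f \<in> closed_simplex s"
  hence "sum f s = sum f t"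
    using assms by (intro sum.mono_neutral_left) (auto simp: closed_simplex_def)
  with f assms show "f \<in> closed_simplex t" by (auto simp: closed_simplex_def)
qed

lemma closed_simplex_convex:
  assumes "f \<in> closed_simplex s" "g \<in> closed_simplex s" "0 \<le> \<tau>" "\<tau> \<le> 1"
  shows "(\<lambda>v. (1 - \<tau>) * f v + \<tau> * g v) \<in> closed_simplex s"
  using assms by (auto simp: closed_simplex_def sum.distrib sum_distrib_left[symmetric])

lemma closed_simplex_le_1:
  assumes "f \<in> closed_simplex s" "finite s"
  shows "f v \<le> 1"
  using assms member_le_sum[of v s f] by (cases "v \<in> s") (auto simp: closed_simplex_def)

lemma closed_simplex_nonempty:
  assumes "finite s" "s \<noteq> {}"
  shows "closed_simplex s \<noteq> {}"
proof -
  from assms obtain x where "x \<in> s" by blast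
  hence "(\<lambda>v. if v = x then 1 else 0) \<in> closed_simplex s"
    using assms by (auto simp: closed_simplex_def)
  thus ?thesis by blast
qed

section \<open>Continuous maps and compact sets in the weak topology\<close>

lemma openin_geom_top:
  "openin (geom_top K) U \<longleftrightarrow> U \<subseteq> realization K \<and>
     (\<forall>s\<in>K. openin (top_of_set (closed_simplex s)) (U \<inter> closed_simplex s))"
proof -
  let ?P = "\<lambda>U. U \<subseteq> realization K \<and>
     (\<forall>s\<in>K. openin (top_of_set (closed_simplex s)) (U \<inter> closed_simplex s))"
  have "istopology ?P"
    unfolding istopology_def
  proof (intro conjI allI impI)
    fix U W assume "?P U" "?P W"
    moreover have "U \<inter> W \<inter> C = (U \<inter> C) \<inter> (W \<inter> C)" for C by blast
    ultimately show "U \<inter> W \<subseteq> realization K"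
      "\<forall>s\<in>K. openin (top_of_set (closed_simplex s)) (U \<inter> W \<inter> closed_simplex s)"
      by (blast, metis openin_Int)
  next
    fix \<K> assume *: "\<forall>U\<in>\<K>. ?P U"
    thus "\<Union> \<K> \<subseteq> realization K" by blast
    have "\<Union> \<K> \<inter> C = \<Union> ((\<lambda>U. U \<inter> C) ` \<K>)" for C by blast
    moreover have "openin (top_of_set (closed_simplex s)) (\<Union> ((\<lambda>U. U \<inter> closed_simplex s) ` \<K>))"
      if "s \<in> K" for s using * that by (intro openin_Union) auto
    ultimately show "\<forall>s\<in>K. openin (top_of_set (closed_simplex s)) (\<Union> \<K> \<inter> closed_simplex s)"
      by simp
  qed
  thus ?thesis unfolding geom_top_def by (simp add: topology_inverse')
qed

lemma topspace_geom_top: "topspace (geom_top K) = realization K"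
proof -
  have "closed_simplex s \<subseteq> realization K" if "s \<in> K" for s
    using that by (auto simp: realization_def)
  hence "openin (geom_top K) (realization K)"
    unfolding openin_geom_top by (simp add: Int_absorb1)
  thus ?thesis unfolding topspace_def using openin_geom_top by (metis Sup_upper Union_least mem_Collect_eq subset_antisym)
qed

lemma continuous_map_geom_top_euclidean: "continuous_map (geom_top K) euclidean (\<lambda>f. f)"
  unfolding continuous_map_def topspace_geom_top openin_geom_top
proof (intro conjI allI impI ballI)
  fix U :: "('a \<Rightarrow> real) set" and s assume "openin euclidean U" "s \<in> K"
  moreover from this have "{x \<in> realization K. x \<in> U} \<inter> closed_simplex s = closed_simplex s \<inter> U"
    by (auto simp: realization_def)
  ultimately show "openin (top_of_set (closed_simplex s)) ({x \<in> realization K. x \<in> U} \<inter> closed_simplex s)"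
    by (auto intro: openin_open_Int)
qed auto

text \<open>The complement of the preimage of a weakly open set is the union, over the finitely many
  simplices in \<open>P\<close>, of preimages of closed sets. Finiteness is what allows continuity
  in the product topology to suffice.\<close>

lemma continuous_map_into_geom_top:
  assumes h: "continuous_on Z h" "h ` Z \<subseteq> (\<Union>s\<in>P. closed_simplex s)"
    and P: "finite P" "P \<subseteq> K" "\<And>s. s \<in> P \<Longrightarrow> finite s"
  shows "continuous_map (top_of_set Z) (geom_top K) h"
  unfolding continuous_map_def topspace_geom_top
proof (intro conjI allI impI)
  show "h \<in> topspace (top_of_set Z) \<rightarrow> realization K"
    using h(2) P(2) unfolding realization_def by fastforce
  fix U assume U: "openin (geom_top K) U"
  have "closedin (top_of_set Z) (Z \<inter> h -` (closed_simplex s - U))" if s: "s \<in> P" for s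
  proof (rule continuous_closedin_preimage[OF h(1)])
    have "openin (top_of_set (closed_simplex s)) (U \<inter> closed_simplex s)"
      using U s P by (auto simp: openin_geom_top)
    hence "closedin (top_of_set (closed_simplex s)) (closed_simplex s - U \<inter> closed_simplex s)"
      by (simp add: closedin_diff)
    moreover have "closed_simplex s - U \<inter> closed_simplex s = closed_simplex s - U" by blast
    ultimately show "closed (closed_simplex s - U)"
      using closed_closed_simplex[OF P(3)[OF s]] by (metis closedin_closed_trans)
  qed
  hence "closedin (top_of_set Z) (\<Union>s\<in>P. Z \<inter> h -` (closed_simplex s - U))"
    using P by (intro closedin_Union) auto
  hence "openin (top_of_set Z) (Z - (\<Union>s\<in>P. Z \<inter> h -` (closed_simplex s - U)))"
    by (metis openin_diff openin_subtopology_self)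
  also have "Z - (\<Union>s\<in>P. Z \<inter> h -` (closed_simplex s - U)) = {x \<in> topspace (top_of_set Z). h x \<in> U}"
    using h(2) by auto
  finally show "openin (top_of_set Z) {x \<in> topspace (top_of_set Z). h x \<in> U}" .
qed

text \<open>Otherwise pick a point of the image outside each \<open>Q N\<close>. A closed simplex
  contains only finitely many of these points, so deleting the points from index \<open>N\<close> on
  leaves an open set; these sets increase, cover the image and have no finite subcover.\<close>

lemma geom_top_compact_image:
  fixes Q :: "nat \<Rightarrow> ('a \<Rightarrow> real) set"
  assumes Z: "compact Z" and g: "continuous_map (top_of_set Z) (geom_top K) g"
    and Q: "\<And>s. s \<in> K \<Longrightarrow> \<exists>N. \<forall>k\<ge>N. closed_simplex s \<subseteq> Q k"
  shows "\<exists>N. g ` Z \<subseteq> Q N"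
proof (rule ccontr)
  assume "\<not> ?thesis"
  hence "\<forall>N. \<exists>y. y \<in> g ` Z \<and> y \<notin> Q N" by blast
  then obtain y where y: "\<And>N. y N \<in> g ` Z" "\<And>N. y N \<notin> Q N" by metis
  define U where "U N = realization K - y ` {N..}" for N
  have gZ: "g ` Z \<subseteq> realization K"
    using g continuous_map_funspace[OF g] by (auto simp: topspace_geom_top)
  have openU: "openin (geom_top K) (U N)" for N
    unfolding openin_geom_top
  proof (intro conjI ballI)
    fix s assume s: "s \<in> K"
    then obtain M where M: "\<forall>k\<ge>M. closed_simplex s \<subseteq> Q k" using Q by blast
    let ?T = "y ` {N..} \<inter> closed_simplex s"
    have "?T \<subseteq> y ` {..<M}"
    proof
      fix f assume "f \<in> ?T"
      then obtain k where "f = y k" "y k \<in> closed_simplex s" by blast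
      moreover from this have "\<not> M \<le> k" using M y(2)[of k] by blast
      hence "k \<in> {..<M}" by simp
      ultimately show "f \<in> y ` {..<M}" by blast
    qed
    hence "closed ?T" by (intro closed_fun_finite) (auto intro: finite_subset)
    hence "openin (top_of_set (closed_simplex s)) (closed_simplex s \<inter> - ?T)"
      by (intro openin_open_Int open_Compl)
    also have "closed_simplex s \<inter> - ?T = U N \<inter> closed_simplex s"
      using s by (auto simp: U_def realization_def)
    finally show "openin (top_of_set (closed_simplex s)) (U N \<inter> closed_simplex s)" .
  qed (auto simp: U_def)
  have "g ` Z \<subseteq> \<Union> (range U)"
  proof
    fix f assume "f \<in> g ` Z"
    with gZ obtain s where s: "s \<in> K" "f \<in> closed_simplex s" by (auto simp: realization_def)
    then obtain M where "\<forall>k\<ge>M. closed_simplex s \<subseteq> Q k" using Q by blast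
    hence "f \<in> U M" using s y(2) by (auto simp: U_def realization_def)
    thus "f \<in> \<Union> (range U)" by blast
  qed
  moreover have "compactin (geom_top K) (g ` Z)"
    using image_compactin[OF _ g, of Z] Z by (simp add: compactin_subtopology)
  ultimately obtain \<F> where F: "finite \<F>" "\<F> \<subseteq> range U" "g ` Z \<subseteq> \<Union> \<F>"
    using compactinD[of "geom_top K" "g ` Z" "range U"] openU by (metis (no_types, lifting) imageE)
  then obtain I where I: "finite I" "\<F> = U ` I" by (meson finite_subset_image)
  obtain N where N: "\<forall>i\<in>I. i \<le> N" using I(1) unfolding finite_nat_set_iff_bounded_le by blast
  have "y N \<in> \<Union> \<F>" using F(3) y(1)[of N] by blast
  then obtain i where "i \<in> I" "y N \<in> U i" unfolding I(2) by blast
  thus False using N by (auto simp: U_def)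
qed

section \<open>Spheres, disks and extension along a collar\<close>

lemma compact_sphere_d: "compact (sphere_d d)"
proof -
  let ?I = "\<lambda>j :: nat. if j < d then {-1..1 :: real} else {0}"
  have "compactin (product_topology (\<lambda>_. euclidean) UNIV) (PiE UNIV ?I)"
    by (subst compactin_PiE) auto
  hence "compact (PiE UNIV ?I)" by (simp add: euclidean_product_topology)
  moreover have "closed (sphere_d d)"
  proof -
    have "closed {x :: nat \<Rightarrow> real. x j = 0}" for j
      by (intro closed_Collect_eq continuous_on_apply continuous_on_const)
    moreover have "closed {x :: nat \<Rightarrow> real. (\<Sum>j<d. (x j)\<^sup>2) = 1}"
      by (intro closed_Collect_eq continuous_intros)
    ultimately have "closed ((\<Inter>j\<in>{d..}. {x. x j = 0}) \<inter> {x :: nat \<Rightarrow> real. (\<Sum>j<d. (x j)\<^sup>2) = 1})"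
      by (intro closed_Int closed_INT) auto
    also have "\<dots> = sphere_d d" by (auto simp: sphere_d_def)
    finally show ?thesis .
  qed
  moreover have "sphere_d d \<subseteq> PiE UNIV ?I"
  proof
    fix x assume x: "x \<in> sphere_d d"
    have "\<bar>x j\<bar> \<le> 1" if "j < d" for j
    proof -
      have "(x j)\<^sup>2 \<le> (\<Sum>j<d. (x j)\<^sup>2)" using that by (intro member_le_sum) auto
      thus ?thesis using x by (simp add: sphere_d_def abs_square_le_1)
    qed
    thus "x \<in> PiE UNIV ?I" using x by (fastforce simp: sphere_d_def abs_le_iff)
  qed
  ultimately show ?thesis by (meson closed_subset compact_Int_closed inf.absorb_iff2 closedin_compact)
qed

text \<open>The disk of radius 1/2 carries a rescaled copy of \<open>h1\<close>; the collar outside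
  carries the straight-line homotopy, with \<open>\<tau>\<close> falling from 1 at radius 1/2 to 0
  on the unit sphere.\<close>

lemma straight_line_extension:
  fixes g0 g1 :: "(nat \<Rightarrow> real) \<Rightarrow> 'a \<Rightarrow> real"
  assumes g0: "continuous_on (sphere_d d) g0" and g1: "continuous_on (sphere_d d) g1"
    and line: "\<And>x \<tau>. x \<in> sphere_d d \<Longrightarrow> 0 \<le> \<tau> \<Longrightarrow> \<tau> \<le> 1 \<Longrightarrow>
                 (\<lambda>v. (1 - \<tau>) * g0 x v + \<tau> * g1 x v) \<in> C"
    and h1: "continuous_on (disk_d d) h1" "h1 ` disk_d d \<subseteq> C" "\<forall>x\<in>sphere_d d. h1 x = g1 x"
  shows "\<exists>h. continuous_on (disk_d d) h \<and> h ` disk_d d \<subseteq> C \<and> (\<forall>x\<in>sphere_d d. h x = g0 x)"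
proof -
  define r where "r x = sqrt (\<Sum>j<d. (x j)\<^sup>2)" for x :: "nat \<Rightarrow> real"
  have r0: "r x \<ge> 0" for x by (auto simp: r_def intro: sum_nonneg)
  have r2: "(\<Sum>j<d. (x j)\<^sup>2) = (r x)\<^sup>2" for x by (simp add: r_def sum_nonneg)
  have rcont: "continuous_on S r" for S unfolding r_def by (intro continuous_intros)
  have disk: "x \<in> disk_d d \<longleftrightarrow> (\<forall>j\<ge>d. x j = 0) \<and> r x \<le> 1" for x
    unfolding disk_d_def using r2 r0 by (auto simp: abs_square_le_1)
  have sphere: "x \<in> sphere_d d \<longleftrightarrow> (\<forall>j\<ge>d. x j = 0) \<and> r x = 1" for x
    unfolding sphere_d_def using r2 r0[of x] by (auto simp: power2_eq_1_iff)
  have rscale: "r (\<lambda>j. a * x j) = a * r x" if "a \<ge> 0" for a x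
    using that by (simp add: r_def power_mult_distrib sum_distrib_left[symmetric] real_sqrt_mult)
  define p where "p x = (\<lambda>j. x j / r x)" for x :: "nat \<Rightarrow> real"
  have p: "p x \<in> sphere_d d" if "x \<in> disk_d d" "r x \<ge> 1/2" for x
    using rscale[of "1 / r x" x] that by (auto simp: sphere disk p_def)
  define \<tau> where "\<tau> x = 2 * (1 - r x)" for x
  define h where "h x = (if r x \<le> 1/2 then h1 (\<lambda>j. 2 * x j)
     else (\<lambda>v. (1 - \<tau> x) * g0 (p x) v + \<tau> x * g1 (p x) v))" for x
  have dbl: "(\<lambda>j. 2 * x j) \<in> disk_d d" if "x \<in> disk_d d" "r x \<le> 1/2" for x
    using that rscale[of 2 x] by (auto simp: disk)
  have "continuous_on (disk_d d) h"
    unfolding h_def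
  proof (rule continuous_on_cases_le)
    show "continuous_on {t \<in> disk_d d. r t \<le> 1/2} (\<lambda>x. h1 (\<lambda>j. 2 * x j))"
    proof (rule continuous_on_compose2[OF h1(1)])
      show "continuous_on {t \<in> disk_d d. r t \<le> 1/2} (\<lambda>x j. 2 * x j)"
        by (intro continuous_on_coordinatewise_then_product continuous_intros)
    qed (use dbl in auto)
    have pc: "continuous_on {t \<in> disk_d d. 1/2 \<le> r t} p"
      unfolding p_def
      by (intro continuous_on_coordinatewise_then_product continuous_intros rcont) auto
    have "p ` {t \<in> disk_d d. 1/2 \<le> r t} \<subseteq> sphere_d d" using p by auto
    hence "continuous_on {t \<in> disk_d d. 1/2 \<le> r t} (\<lambda>x. g0 (p x))"
      "continuous_on {t \<in> disk_d d. 1/2 \<le> r t} (\<lambda>x. g1 (p x))"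
      by (rule continuous_on_compose2[OF g0 pc], rule continuous_on_compose2[OF g1 pc])
    thus "continuous_on {t \<in> disk_d d. 1/2 \<le> r t} (\<lambda>x v. (1 - \<tau> x) * g0 (p x) v + \<tau> x * g1 (p x) v)"
      unfolding \<tau>_def
      by (intro continuous_on_coordinatewise_then_product continuous_intros rcont)
        (auto dest: continuous_on_product_then_coordinatewise)
    show "h1 (\<lambda>j. 2 * t j) = (\<lambda>v. (1 - \<tau> t) * g0 (p t) v + \<tau> t * g1 (p t) v)"
      if "t \<in> disk_d d" "r t = 1/2" for t
    proof -
      have "p t = (\<lambda>j. 2 * t j)" unfolding p_def that(2) by (simp add: mult.commute)
      moreover have "\<tau> t = 1" using that by (simp add: \<tau>_def)
      ultimately show ?thesis using h1(3) p[of t] that by simp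
    qed
  qed (rule rcont)
  moreover have "h ` disk_d d \<subseteq> C"
  proof safe
    fix x assume x: "x \<in> disk_d d"
    show "h x \<in> C"
    proof (cases "r x \<le> 1/2")
      case True
      then show ?thesis using h1(2) dbl[OF x] by (auto simp: h_def)
    next
      case False
      then show ?thesis using line[of "p x" "\<tau> x"] p[OF x] x by (auto simp: h_def \<tau>_def disk)
    qed
  qed
  moreover have "h x = g0 x" if "x \<in> sphere_d d" for x
    using that by (auto simp: h_def sphere \<tau>_def p_def)
  ultimately show ?thesis by blast
qed

section \<open>General position\<close>

definition l1dist :: "nat \<Rightarrow> (nat \<Rightarrow> real) \<Rightarrow> (nat \<Rightarrow> real) \<Rightarrow> real" where
  "l1dist d p q = (\<Sum>j<d. \<bar>p j - q j\<bar>)"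

lemma l1dist_simps [simp]: "l1dist d p p = 0" "l1dist d p q \<ge> 0"
  by (auto simp: l1dist_def intro: sum_nonneg)

lemma l1dist_sym: "l1dist d p q = l1dist d q p"
  by (simp add: l1dist_def abs_minus_commute)

lemma l1dist_triangle: "l1dist d p r \<le> l1dist d p q + l1dist d q r"
  unfolding l1dist_def sum.distrib[symmetric] by (intro sum_mono) auto

text \<open>The pairs on which \<open>f\<close> differs by at least \<epsilon> form a compact set,
  and the least distance on it serves as \<delta>.\<close>

lemma l1dist_uniformly_continuous:
  fixes f :: "(nat \<Rightarrow> real) \<Rightarrow> real"
  assumes f: "continuous_on (sphere_d d) f" and "\<epsilon> > 0"
  shows "\<exists>\<delta>>0. \<forall>p\<in>sphere_d d. \<forall>q\<in>sphere_d d. l1dist d p q < \<delta> \<longrightarrow> \<bar>f p - f q\<bar> < \<epsilon>"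
proof -
  let ?S = "sphere_d d"
  let ?D = "\<lambda>z :: (nat \<Rightarrow> real) \<times> (nat \<Rightarrow> real). l1dist d (fst z) (snd z)"
  define T where "T = {z \<in> ?S \<times> ?S. \<epsilon> \<le> \<bar>f (fst z) - f (snd z)\<bar>}"
  have comp: "compact (?S \<times> ?S)" by (intro compact_Times compact_sphere_d)
  have fc: "continuous_on (?S \<times> ?S) (\<lambda>z. \<bar>f (fst z) - f (snd z)\<bar>)"
    by (intro continuous_intros continuous_on_compose2[OF f]) auto
  have "closedin (top_of_set (?S \<times> ?S)) (?S \<times> ?S \<inter> (\<lambda>z. \<bar>f (fst z) - f (snd z)\<bar>) -` {\<epsilon>..})"
    by (intro continuous_closedin_preimage[OF fc]) auto
  also have "?S \<times> ?S \<inter> (\<lambda>z. \<bar>f (fst z) - f (snd z)\<bar>) -` {\<epsilon>..} = T" by (auto simp: T_def)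
  finally have T: "compact T" using comp closedin_compact by blast
  have Dc: "continuous_on T ?D"
    unfolding l1dist_def
    by (intro continuous_intros continuous_on_compose2[OF continuous_on_product_coordinates]) auto
  show ?thesis
  proof (cases "T = {}")
    case True
    have "\<bar>f p - f q\<bar> < \<epsilon>" if "p \<in> ?S" "q \<in> ?S" for p q
    proof (rule ccontr)
      assume "\<not> ?thesis"
      hence "(p, q) \<in> T" using that by (auto simp: T_def)
      with True show False by auto
    qed
    then show ?thesis by (intro exI[of _ 1]) auto
  next
    case False
    from continuous_attains_inf[OF T False Dc] obtain z where z: "z \<in> T" "\<And>w. w \<in> T \<Longrightarrow> ?D z \<le> ?D w" by blast
    have "?D z \<noteq> 0"
    proof
      assume "?D z = 0"
      hence "\<forall>j<d. fst z j = snd z j" by (auto simp: l1dist_def sum_nonneg_eq_0_iff)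
      moreover have "\<forall>j\<ge>d. fst z j = snd z j" using z(1) by (auto simp: T_def sphere_d_def)
      ultimately have "fst z = snd z" by (metis ext not_less)
      with z(1) \<open>\<epsilon> > 0\<close> show False by (simp add: T_def)
    qed
    hence "?D z > 0" using l1dist_simps(2)[of d "fst z" "snd z"] by linarith
    moreover have "\<bar>f p - f q\<bar> < \<epsilon>" if "p \<in> ?S" "q \<in> ?S" "l1dist d p q < ?D z" for p q
      using z(2)[of "(p, q)"] that by (force simp: T_def)
    ultimately show ?thesis by blast
  qed
qed

text \<open>\<open>q\<close> is the infimal convolution of \<open>f\<close> with L times the
  distance, which is Lipschitz with constant L. The choice L = 1 / \<delta> makes the penalty beyond
  distance \<delta> at least 1, hence at least \<open>f p\<close>.\<close>

lemma l1dist_lipschitz_approximation: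
  fixes f :: "(nat \<Rightarrow> real) \<Rightarrow> real"
  assumes f: "continuous_on (sphere_d d) f" and "\<epsilon> > 0"
    and bd: "\<And>p. p \<in> sphere_d d \<Longrightarrow> 0 \<le> f p \<and> f p \<le> 1"
  shows "\<exists>q L. L > 0 \<and> (\<forall>p\<in>sphere_d d. \<bar>q p - f p\<bar> \<le> \<epsilon>) \<and>
           (\<forall>p\<in>sphere_d d. \<forall>p'\<in>sphere_d d. \<bar>q p - q p'\<bar> \<le> L * l1dist d p p')"
proof -
  let ?S = "sphere_d d"
  obtain \<delta> where \<delta>: "\<delta> > 0" "\<And>p q. p \<in> ?S \<Longrightarrow> q \<in> ?S \<Longrightarrow> l1dist d p q < \<delta> \<Longrightarrow> \<bar>f p - f q\<bar> < \<epsilon>"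
    using l1dist_uniformly_continuous[OF f \<open>\<epsilon> > 0\<close>] by blast
  define L where "L = 1 / \<delta>"
  have L: "L > 0" using \<delta> by (simp add: L_def)
  define q where "q p = (INF z\<in>?S. f z + L * l1dist d p z)" for p
  have below: "bdd_below ((\<lambda>z. f z + L * l1dist d p z) ` ?S)" for p
    using bd L by (intro bdd_belowI[of _ 0]) auto
  have upper: "q p \<le> f z + L * l1dist d p z" if "z \<in> ?S" for p z
    unfolding q_def using that by (rule cINF_lower[OF below])
  have "\<bar>q p - f p\<bar> \<le> \<epsilon>" if p: "p \<in> ?S" for p
  proof -
    have "f p - \<epsilon> \<le> q p"
      unfolding q_def
    proof (rule cINF_greatest)
      fix z assume z: "z \<in> ?S"
      show "f p - \<epsilon> \<le> f z + L * l1dist d p z"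
      proof (cases "l1dist d p z < \<delta>")
        case True
        have "0 \<le> L * l1dist d p z" using L by simp
        with \<delta>(2)[OF p z True] show ?thesis by linarith
      next
        case False
        hence "1 \<le> L * l1dist d p z" using \<delta>(1) by (simp add: L_def field_simps)
        then show ?thesis using bd[OF p] bd[OF z] \<open>\<epsilon> > 0\<close> by linarith
      qed
    qed (use p in auto)
    moreover have "q p \<le> f p" using upper[OF p, of p] by simp
    ultimately show ?thesis using \<open>\<epsilon> > 0\<close> by linarith
  qed
  moreover have half: "q p \<le> q p' + L * l1dist d p p'" if "p' \<in> ?S" for p p'
  proof -
    have "q p - L * l1dist d p p' \<le> q p'"
      unfolding q_def[of p']
    proof (rule cINF_greatest)
      fix z assume z: "z \<in> ?S"
      have "L * l1dist d p z \<le> L * (l1dist d p p' + l1dist d p' z)"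
        using L l1dist_triangle by (intro mult_left_mono) auto
      with upper[OF z, of p] show "q p - L * l1dist d p p' \<le> f z + L * l1dist d p' z"
        by (simp add: distrib_left)
    qed (use that in auto)
    thus ?thesis by simp
  qed
  have "\<bar>q p - q p'\<bar> \<le> L * l1dist d p p'" if "p \<in> ?S" "p' \<in> ?S" for p p'
    using half[OF that(1), of p'] half[OF that(2), of p] l1dist_sym[of d p p'] by (simp add: abs_le_iff)
  ultimately show ?thesis using L by blast
qed

lemma continuous_on_l1dist_lipschitz:
  fixes q :: "(nat \<Rightarrow> real) \<Rightarrow> real"
  assumes "\<And>p p'. p \<in> S \<Longrightarrow> p' \<in> S \<Longrightarrow> \<bar>q p - q p'\<bar> \<le> L * l1dist d p p'"
  shows "continuous_on S q"
  unfolding continuous_on_def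
proof
  fix a assume a: "a \<in> S"
  have "continuous_on S (\<lambda>p. L * l1dist d p a)"
    unfolding l1dist_def by (intro continuous_intros continuous_on_apply)
  hence "((\<lambda>p. L * l1dist d p a) \<longlongrightarrow> 0) (at a within S)"
    using a by (auto simp: continuous_on_def)
  hence "((\<lambda>p. q p - q a) \<longlongrightarrow> 0) (at a within S)"
    by (rule Lim_null_comparison[rotated]) (use assms a in \<open>auto simp: eventually_at_filter\<close>)
  thus "(q \<longlongrightarrow> q a) (at a within S)" by (rule LIM_zero_cancel)
qed

text \<open>A \<open>(d - 1)\<close>-dimensional sphere is covered by \<open>O(N^(d - 1))\<close> sets of diameter \<open>O(1 / N)\<close>: cut
  up the coordinates other than one of absolute value at least \<open>1 / d\<close>.\<close>

definition big_coord :: "nat \<Rightarrow> (nat \<Rightarrow> real) \<Rightarrow> nat" where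
  "big_coord d p = (SOME j. j < d \<and> 1 / real d \<le> \<bar>p j\<bar>)"

definition sphere_cell :: "nat \<Rightarrow> nat \<Rightarrow> (nat \<Rightarrow> real) \<Rightarrow> nat \<times> bool \<times> (nat \<Rightarrow> int)" where
  "sphere_cell d N p = (big_coord d p, p (big_coord d p) > 0,
     restrict (\<lambda>i. \<lfloor>real N * p i\<rfloor>) ({..<d} - {big_coord d p}))"

lemma sphere_d_abs_le_1:
  assumes "p \<in> sphere_d d"
  shows "\<bar>p j\<bar> \<le> 1"
proof (cases "j < d")
  case True
  have "(p j)\<^sup>2 \<le> (\<Sum>j<d. (p j)\<^sup>2)" using True by (intro member_le_sum) auto
  thus ?thesis using assms by (simp add: sphere_d_def abs_square_le_1)
qed (use assms in \<open>auto simp: sphere_d_def\<close>)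

lemma big_coord:
  assumes "p \<in> sphere_d d"
  shows "big_coord d p < d" "1 / real d \<le> \<bar>p (big_coord d p)\<bar>"
proof -
  have "\<exists>j. j < d \<and> 1 / real d \<le> \<bar>p j\<bar>"
  proof (rule ccontr)
    assume no: "\<not> ?thesis"
    have "d > 0" using assms by (cases d) (auto simp: sphere_d_def)
    have "(p j)\<^sup>2 < 1 / real d" if "j < d" for j
    proof -
      have "(p j)\<^sup>2 = \<bar>p j\<bar> * \<bar>p j\<bar>" by (simp add: power2_eq_square)
      also have "\<dots> \<le> \<bar>p j\<bar> * 1" using sphere_d_abs_le_1[OF assms] by (intro mult_left_mono) auto
      also have "\<dots> < 1 / real d" using no that by auto
      finally show ?thesis .
    qed
    hence "(\<Sum>j<d. (p j)\<^sup>2) < (\<Sum>j<d. 1 / real d)"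
      using \<open>d > 0\<close> by (intro sum_strict_mono) auto
    thus False using assms \<open>d > 0\<close> by (simp add: sphere_d_def)
  qed
  hence "big_coord d p < d \<and> 1 / real d \<le> \<bar>p (big_coord d p)\<bar>"
    unfolding big_coord_def by (rule someI_ex)
  thus "big_coord d p < d" "1 / real d \<le> \<bar>p (big_coord d p)\<bar>" by auto
qed

text \<open>The coordinates other than j differ by at most 1 / N. The equation of the sphere bounds
  the difference of the squares of the j-th coordinates, and since these have equal signs and size
  at least 1 / d, their sum has size at least 2 / d and can be divided out.\<close>

lemma sphere_cell_diameter:
  assumes p: "p \<in> sphere_d d" and p': "p' \<in> sphere_d d" and N: "N > 0"
    and cell: "sphere_cell d N p = sphere_cell d N p'"
  shows "l1dist d p p' \<le> 2 * real d * real d / real N"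
proof -
  define j where "j = big_coord d p"
  have j': "big_coord d p' = j" and sgn: "p j > 0 \<longleftrightarrow> p' j > 0"
    and fl: "restrict (\<lambda>i. \<lfloor>real N * p i\<rfloor>) ({..<d} - {j}) = restrict (\<lambda>i. \<lfloor>real N * p' i\<rfloor>) ({..<d} - {j})"
    using cell by (auto simp: sphere_cell_def j_def)
  have j: "j < d" "1 / real d \<le> \<bar>p j\<bar>" "1 / real d \<le> \<bar>p' j\<bar>"
    using big_coord[OF p] big_coord[OF p'] j' by (auto simp: j_def)
  hence d: "d > 0" by simp
  let ?J = "{..<d} - {j}"
  let ?\<Sigma> = "\<Sum>i\<in>?J. \<bar>p i - p' i\<bar>"
  have each: "\<bar>p i - p' i\<bar> \<le> 1 / real N" if i: "i \<in> ?J" for i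
  proof -
    have "\<lfloor>real N * p i\<rfloor> = \<lfloor>real N * p' i\<rfloor>" using fun_cong[OF fl, of i] i by simp
    hence "\<bar>real N * p i - real N * p' i\<bar> \<le> 1" by linarith
    hence "real N * \<bar>p i - p' i\<bar> \<le> 1" by (simp add: right_diff_distrib[symmetric] abs_mult)
    thus ?thesis using \<open>N > 0\<close> by (simp add: field_simps)
  qed
  have split: "sum f {..<d} = f j + sum f ?J" for f :: "nat \<Rightarrow> real"
    using j by (simp add: sum.remove)
  have "(p j)\<^sup>2 - (p' j)\<^sup>2 = (\<Sum>i\<in>?J. (p' i)\<^sup>2 - (p i)\<^sup>2)"
    using p p' split[of "\<lambda>i. (p i)\<^sup>2"] split[of "\<lambda>i. (p' i)\<^sup>2"] by (simp add: sphere_d_def sum_subtractf)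
  hence "\<bar>(p j)\<^sup>2 - (p' j)\<^sup>2\<bar> \<le> (\<Sum>i\<in>?J. \<bar>(p' i)\<^sup>2 - (p i)\<^sup>2\<bar>)" by simp
  also have "\<dots> \<le> (\<Sum>i\<in>?J. 2 * \<bar>p i - p' i\<bar>)"
  proof (intro sum_mono)
    fix i
    have "\<bar>(p' i)\<^sup>2 - (p i)\<^sup>2\<bar> = \<bar>p' i + p i\<bar> * \<bar>p i - p' i\<bar>"
      by (simp add: power2_eq_square square_diff_square_factored abs_mult abs_minus_commute)
    also have "\<dots> \<le> 2 * \<bar>p i - p' i\<bar>"
      using sphere_d_abs_le_1[OF p, of i] sphere_d_abs_le_1[OF p', of i] by (intro mult_right_mono) auto
    finally show "\<bar>(p' i)\<^sup>2 - (p i)\<^sup>2\<bar> \<le> 2 * \<bar>p i - p' i\<bar>" .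
  qed
  also have "\<dots> = 2 * ?\<Sigma>" by (simp add: sum_distrib_left)
  finally have sq: "\<bar>(p j)\<^sup>2 - (p' j)\<^sup>2\<bar> \<le> 2 * ?\<Sigma>" .
  have "2 / real d \<le> \<bar>p j + p' j\<bar>" using sgn j by auto
  hence "2 / real d * \<bar>p j - p' j\<bar> \<le> \<bar>p j + p' j\<bar> * \<bar>p j - p' j\<bar>" by (intro mult_right_mono) auto
  also have "\<dots> = \<bar>(p j)\<^sup>2 - (p' j)\<^sup>2\<bar>"
    by (simp add: power2_eq_square square_diff_square_factored abs_mult)
  finally have "2 / real d * \<bar>p j - p' j\<bar> \<le> 2 * ?\<Sigma>" using sq by linarith
  hence "\<bar>p j - p' j\<bar> \<le> real d * ?\<Sigma>" using d by (simp add: field_simps)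
  hence "l1dist d p p' \<le> (real d + 1) * ?\<Sigma>"
    unfolding l1dist_def split by (simp add: distrib_right)
  also have "?\<Sigma> \<le> (\<Sum>i\<in>?J. 1 / real N)" using each by (intro sum_mono)
  hence "(real d + 1) * ?\<Sigma> \<le> (real d + 1) * (real d * (1 / real N))"
    using j N by (intro mult_left_mono) (auto simp: field_simps)
  also have "\<dots> \<le> (2 * real d) * (real d * (1 / real N))"
    using d by (intro mult_right_mono) auto
  finally show ?thesis by simp
qed

lemma sphere_cell_range:
  "sphere_cell d N ` sphere_d d \<subseteq>
     (SIGMA j:{..<d}. (UNIV :: bool set) \<times> (PiE ({..<d} - {j}) (\<lambda>_. {- int N..int N})))"
proof (rule image_subsetI)
  fix p assume p: "p \<in> sphere_d d"
  have "\<lfloor>real N * p i\<rfloor> \<in> {- int N..int N}" for i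
  proof -
    have "\<bar>real N * p i\<bar> \<le> real N * 1"
      unfolding abs_mult using sphere_d_abs_le_1[OF p, of i] by (intro mult_mono) auto
    hence "- real N \<le> real N * p i" "real N * p i \<le> real N" by auto
    thus ?thesis by (auto simp: le_floor_iff floor_le_iff)
  qed
  thus "sphere_cell d N p \<in> (SIGMA j:{..<d}. (UNIV :: bool set) \<times> (PiE ({..<d} - {j}) (\<lambda>_. {- int N..int N})))"
    using big_coord[OF p] by (auto simp: sphere_cell_def)
qed

lemma card_sphere_cell_range:
  "card (SIGMA j:{..<d}. (UNIV :: bool set) \<times> (PiE ({..<d} - {j}) (\<lambda>_. {- int N..int N})))
     = 2 * d * (2 * N + 1) ^ (d - 1)"
proof -
  have "card (PiE ({..<d} - {j}) (\<lambda>_. {- int N..int N})) = (2 * N + 1) ^ (d - 1)" if "j < d" for j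
    using that by (subst card_PiE) (auto simp: nat_add_distrib nat_mult_distrib)
  thus ?thesis
    by (subst card_SigmaI) (auto simp: card_cartesian_product finite_PiE)
qed

text \<open>A grid of \<open>M^n\<close> points is too large for the \<open>O(M^(d - 1))\<close> sets of diameter \<open>O(1 / M)\<close> that cover
  the image of the sphere.\<close>

lemma lipschitz_misses_grid_point:
  fixes q :: "'a \<Rightarrow> (nat \<Rightarrow> real) \<Rightarrow> real"
  assumes B: "finite B" "card B = n" "d \<le> n" and pos: "\<eta> > 0" "L > 0"
    and lip: "\<And>x p p'. x \<in> B \<Longrightarrow> p \<in> sphere_d d \<Longrightarrow> p' \<in> sphere_d d \<Longrightarrow> \<bar>q x p - q x p'\<bar> \<le> L * l1dist d p p'"
  shows "\<exists>c. (\<forall>x\<in>B. lo \<le> c x \<and> c x \<le> lo + \<eta>) \<and> (\<forall>p\<in>sphere_d d. \<exists>x\<in>B. q x p \<noteq> c x)"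
proof (cases "d = 0")
  case True
  hence "sphere_d d = {}" by (auto simp: sphere_d_def)
  with pos show ?thesis by (intro exI[of _ "\<lambda>_. lo"]) auto
next
  case False
  hence n: "n \<ge> 1" using B by simp
  \<comment> \<open>With N = M K, a cell has diameter at most 2 d^2 / N, so its image varies by at
    most 2 L d^2 / (M K) in each coordinate. This bound on \<open>K\<close> makes that less than the
    grid spacing \<eta> / M.\<close>
  obtain K :: nat where K: "real K > 2 * L * real d * real d / \<eta>" using reals_Archimedean2 by blast
  have "2 * L * real d * real d / \<eta> > 0" using pos False by simp
  hence K0: "K > 0" using K by (cases K) auto
  \<comment> \<open>\<open>M\<close> exceeds 2 d (3K)^(n-1), so that M^n is larger than 2 d
    (3N)^(n-1), an upper bound for the number of cells.\<close>
  define M where "M = Suc (2 * d * (3 * K) ^ (n - 1))"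
  define N where "N = M * K"
  have N0: "N > 0" using K0 by (simp add: N_def M_def)
  define c where "c k x = lo + \<eta> * real (k x) / real M" for k :: "'a \<Rightarrow> nat" and x
  define G where "G = PiE B (\<lambda>_. {..<M})"
  show ?thesis
  proof (rule ccontr)
    assume no: "\<not> ?thesis"
    have "\<exists>p\<in>sphere_d d. \<forall>x\<in>B. q x p = c k x" if k: "k \<in> G" for k
    proof (rule ccontr)
      assume "\<not> (\<exists>p\<in>sphere_d d. \<forall>x\<in>B. q x p = c k x)"
      hence "\<forall>p\<in>sphere_d d. \<exists>x\<in>B. q x p \<noteq> c k x" by simp
      moreover have "lo \<le> c k x \<and> c k x \<le> lo + \<eta>" if "x \<in> B" for x
      proof -
        have "k x < M" using k that by (auto simp: G_def)
        moreover from this have "real M > 0" by linarith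
        ultimately have "\<eta> * real (k x) / real M \<le> \<eta>" using pos by (simp add: pos_divide_le_eq)
        moreover have "0 \<le> \<eta> * real (k x) / real M" using pos by simp
        ultimately show ?thesis by (simp add: c_def)
      qed
      ultimately show False
        using no by (metis (no_types, lifting))
    qed
    then obtain P where P: "\<And>k. k \<in> G \<Longrightarrow> P k \<in> sphere_d d" "\<And>k x. k \<in> G \<Longrightarrow> x \<in> B \<Longrightarrow> q x (P k) = c k x"
      by metis
    let ?C = "SIGMA j:{..<d}. (UNIV :: bool set) \<times> (PiE ({..<d} - {j}) (\<lambda>_. {- int N..int N}))"
    \<comment> \<open>If two grid points were hit from the same cell, they would be closer than the
      grid spacing in a coordinate where they differ.\<close>
    have "inj_on (\<lambda>k. sphere_cell d N (P k)) G"
    proof (rule inj_onI, rule ccontr)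
      fix k k' assume k: "k \<in> G" "k' \<in> G" "sphere_cell d N (P k) = sphere_cell d N (P k')" "k \<noteq> k'"
      then obtain x where x: "x \<in> B" "k x \<noteq> k' x" unfolding G_def by (metis PiE_ext)
      have "l1dist d (P k) (P k') \<le> 2 * real d * real d / real N"
        using k N0 P by (intro sphere_cell_diameter) auto
      hence "L * l1dist d (P k) (P k') \<le> L * (2 * real d * real d / real N)"
        using pos by (intro mult_left_mono) auto
      also have "\<dots> = (2 * L * real d * real d) / (real M * real K)" by (simp add: N_def)
      also have "\<dots> < \<eta> / real M"
        using K K0 pos N0 by (simp add: N_def pos_divide_less_eq mult.commute)
      finally have "\<bar>c k x - c k' x\<bar> < \<eta> / real M"
        using lip[OF x(1), of "P k" "P k'"] P k x by auto
      moreover have "c k x - c k' x = \<eta> / real M * (real (k x) - real (k' x))"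
        by (simp add: c_def algebra_simps diff_divide_distrib)
      moreover have "\<bar>real (k x) - real (k' x)\<bar> \<ge> 1" using x by linarith
      hence "\<eta> / real M * 1 \<le> \<eta> / real M * \<bar>real (k x) - real (k' x)\<bar>"
        using pos by (intro mult_left_mono) auto
      ultimately show False using pos by (simp add: abs_mult)
    qed
    moreover have "(\<lambda>k. sphere_cell d N (P k)) ` G \<subseteq> ?C"
      using sphere_cell_range[of d N] P by blast
    moreover have "finite ?C" by (intro finite_SigmaI finite_cartesian_product finite_PiE) auto
    ultimately have "card G \<le> card ?C" by (rule card_inj_on_le)
    hence "M ^ n \<le> 2 * d * (2 * N + 1) ^ (d - 1)"
      unfolding card_sphere_cell_range using B by (simp add: G_def card_PiE)
    also have "\<dots> \<le> 2 * d * (3 * N) ^ (d - 1)" using N0 by (intro mult_le_mono power_mono) auto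
    also have "\<dots> \<le> 2 * d * (3 * N) ^ (n - 1)" using N0 B by (intro mult_le_mono power_increasing) auto
    also have "\<dots> = 2 * d * (3 * K) ^ (n - 1) * M ^ (n - 1)" by (simp add: N_def power_mult_distrib)
    also have "\<dots> < M * M ^ (n - 1)" by (simp add: M_def)
    also have "\<dots> = M ^ n" using n by (cases n) auto
    finally show False by simp
  qed
qed

text \<open>The coordinates are replaced by Lipschitz approximations with a common constant, since a
  map that is merely continuous could hit every \<open>c\<close> in the cube.\<close>

lemma general_position:
  fixes f :: "'a \<Rightarrow> (nat \<Rightarrow> real) \<Rightarrow> real"
  assumes B: "finite B" "card B = n" "d \<le> n" and pos: "\<eta> > 0" "\<epsilon> > 0"
    and f: "\<And>x. x \<in> B \<Longrightarrow> continuous_on (sphere_d d) (f x)"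
    and bd: "\<And>x p. x \<in> B \<Longrightarrow> p \<in> sphere_d d \<Longrightarrow> 0 \<le> f x p \<and> f x p \<le> 1"
  shows "\<exists>q c. (\<forall>x\<in>B. continuous_on (sphere_d d) (q x) \<and> (\<forall>p\<in>sphere_d d. \<bar>q x p - f x p\<bar> \<le> \<epsilon>)) \<and>
           (\<forall>x\<in>B. lo \<le> c x \<and> c x \<le> lo + \<eta>) \<and> (\<forall>p\<in>sphere_d d. \<exists>x\<in>B. q x p \<noteq> c x)"
proof -
  let ?S = "sphere_d d"
  have "\<forall>x\<in>B. \<exists>q L. L > 0 \<and> (\<forall>p\<in>?S. \<bar>q p - f x p\<bar> \<le> \<epsilon>) \<and>
           (\<forall>p\<in>?S. \<forall>p'\<in>?S. \<bar>q p - q p'\<bar> \<le> L * l1dist d p p')"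
    using l1dist_lipschitz_approximation[OF f pos(2)] bd by blast
  then obtain q L where q: "\<And>x. x \<in> B \<Longrightarrow> L x > 0"
    "\<And>x p. x \<in> B \<Longrightarrow> p \<in> ?S \<Longrightarrow> \<bar>q x p - f x p\<bar> \<le> \<epsilon>"
    "\<And>x p p'. x \<in> B \<Longrightarrow> p \<in> ?S \<Longrightarrow> p' \<in> ?S \<Longrightarrow> \<bar>q x p - q x p'\<bar> \<le> L x * l1dist d p p'"
    by metis
  define L' where "L' = 1 + sum L B"
  have L': "L x \<le> L'" if "x \<in> B" for x
    using member_le_sum[of x B L] that B q(1) by (force simp: L'_def intro: less_imp_le)
  have "L' > 0" unfolding L'_def using q(1) by (smt (verit) sum_nonneg)
  moreover have "\<bar>q x p - q x p'\<bar> \<le> L' * l1dist d p p'" if "x \<in> B" "p \<in> ?S" "p' \<in> ?S" for x p p'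
    using q(3)[OF that] mult_right_mono[OF L'[OF that(1)], of "l1dist d p p'"] by simp
  ultimately obtain c where "\<forall>x\<in>B. lo \<le> c x \<and> c x \<le> lo + \<eta>" "\<forall>p\<in>?S. \<exists>x\<in>B. q x p \<noteq> c x"
    using lipschitz_misses_grid_point[OF B pos(1), of L' q lo] by blast
  moreover have "continuous_on ?S (q x)" if "x \<in> B" for x
    using q(3)[OF that] by (rule continuous_on_l1dist_lipschitz)
  ultimately show ?thesis using q(2) by blast
qed

section \<open>Connectivity of shelled complexes\<close>

text \<open>\<open>height\<close> is a linear order with ties. Because \<open>D\<close> is strictly
  lower than \<open>A\<close> even when \<open>height B = height A\<close>, every linear refinement
  of \<open>height\<close> is a shelling order.\<close>

locale shelled_complex =
  fixes F :: "'a set set" and height :: "'a set \<Rightarrow> nat" and n :: nat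
  assumes nonempty: "F \<noteq> {}"
    and facet: "\<And>A. A \<in> F \<Longrightarrow> finite A \<and> card A = Suc n"
    and finite_height: "\<And>N. finite {A \<in> F. height A \<le> N}"
    and shelling: "\<And>A B. A \<in> F \<Longrightarrow> B \<in> F \<Longrightarrow> A \<noteq> B \<Longrightarrow> height B \<le> height A \<Longrightarrow>
                     \<exists>D\<in>F. height D < height A \<and> (\<exists>x\<in>A - B. A - {x} \<subseteq> D)"
begin

section \<open>Extending maps into finite unions of facets\<close>

definition region :: "'a set set \<Rightarrow> ('a \<Rightarrow> real) set" where
  "region P = (\<Union>A\<in>P. closed_simplex A)"

text \<open>Continuity is taken in the product topology on \<open>'a \<Rightarrow> real\<close>,
  where coordinatewise formulas apply. For finite \<open>P\<close>,
  \<open>continuous_map_into_geom_top\<close> carries the result over to the weak topology.\<close>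

definition extendable :: "nat \<Rightarrow> 'a set set \<Rightarrow> ((nat \<Rightarrow> real) \<Rightarrow> 'a \<Rightarrow> real) \<Rightarrow> bool" where
  "extendable d P g \<longleftrightarrow> (\<exists>h. continuous_on (disk_d d) h \<and> h ` disk_d d \<subseteq> region P \<and> (\<forall>x\<in>sphere_d d. h x = g x))"

lemma extendable_straight_line:
  assumes "continuous_on (sphere_d d) g0" "continuous_on (sphere_d d) g1"
    and "\<And>x \<tau>. x \<in> sphere_d d \<Longrightarrow> 0 \<le> \<tau> \<Longrightarrow> \<tau> \<le> 1 \<Longrightarrow>
           (\<lambda>v. (1 - \<tau>) * g0 x v + \<tau> * g1 x v) \<in> region P"
    and "extendable d P g1"
  shows "extendable d P g0"
proof -
  obtain h1 where "continuous_on (disk_d d) h1" "h1 ` disk_d d \<subseteq> region P" "\<forall>x\<in>sphere_d d. h1 x = g1 x"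
    using assms(4) by (auto simp: extendable_def)
  from straight_line_extension[OF assms(1-3) this] show ?thesis by (simp add: extendable_def)
qed

lemma extendable_mono: "extendable d P g \<Longrightarrow> P \<subseteq> Q \<Longrightarrow> extendable d Q g"
  unfolding extendable_def region_def by (meson UN_mono order_refl order_trans)

lemma extendable_simplex:
  assumes "A \<in> F" and g: "continuous_on (sphere_d d) g" "g ` sphere_d d \<subseteq> region {A}"
  shows "extendable d {A} g"
proof -
  have reg: "region {A} = closed_simplex A" by (simp add: region_def)
  have "A \<noteq> {}" using facet[OF assms(1)] by auto
  then obtain c where c: "c \<in> closed_simplex A"
    using closed_simplex_nonempty[of A] facet[OF assms(1)] by auto
  show ?thesis
  proof (rule extendable_straight_line[OF g(1), of "\<lambda>_. c"])
    show "extendable d {A} (\<lambda>_. c)"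
      unfolding extendable_def reg using c by (intro exI[of _ "\<lambda>_. c"]) auto
    show "(\<lambda>v. (1 - \<tau>) * g x v + \<tau> * c v) \<in> region {A}" if "x \<in> sphere_d d" "0 \<le> \<tau>" "\<tau> \<le> 1" for x \<tau>
      using that g(2) c unfolding reg by (intro closed_simplex_convex) auto
  qed auto
qed

text \<open>\<open>X\<close> consists of the vertices opposite to the facets along which \<open>A\<close> is attached. If \<open>X \<noteq> A\<close>, move
  weight from \<open>X\<close> to a vertex outside \<open>X\<close> until a coordinate in \<open>X\<close> vanishes; if \<open>X = A\<close>, perturb
  the map to miss the interior point \<open>c\<close> and project radially from \<open>c\<close>.\<close>

lemma push_off_top:
  assumes A: "A \<in> F" and P': "P' \<subseteq> F" "A \<notin> P'"
    and X: "X \<subseteq> A" "X \<noteq> {}"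
    and bd: "\<And>f x. f \<in> closed_simplex A \<Longrightarrow> x \<in> X \<Longrightarrow> f x = 0 \<Longrightarrow> f \<in> region P'"
    and zero: "\<And>f. f \<in> region P' \<Longrightarrow> \<exists>x\<in>X. f x = 0"
    and d: "d \<le> n" and g: "continuous_on (sphere_d d) g" "g ` sphere_d d \<subseteq> region (insert A P')"
    and ext: "\<And>g'. continuous_on (sphere_d d) g' \<Longrightarrow> g' ` sphere_d d \<subseteq> region P' \<Longrightarrow> extendable d P' g'"
  shows "extendable d (insert A P') g"
proof -
  let ?S = "sphere_d d" and ?R = "region (insert A P')"
  have finA: "finite A" "card A = Suc n" using facet[OF A] by auto
  have finX: "finite X" using X finA finite_subset by blast
  have R: "?R = closed_simplex A \<union> region P'" by (auto simp: region_def)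
  have nonneg: "0 \<le> f v" if "f \<in> ?R" for f v
    using that by (auto simp: region_def closed_simplex_def)
  have gS: "g p \<in> ?R" if "p \<in> ?S" for p using g that by blast
  have gc: "continuous_on ?S (\<lambda>p. g p v)" for v using g(1) by (rule continuous_on_product_then_coordinatewise)
  have extR: "extendable d (insert A P') g'" if "continuous_on ?S g'" "g' ` ?S \<subseteq> region P'" for g'
    using ext[OF that] by (rule extendable_mono) auto
  have zerom: "Min ((\<lambda>x. f x) ` X) = 0" if "f \<in> region P'" for f
  proof -
    obtain x where "x \<in> X" "f x = 0" using zero[OF \<open>f \<in> region P'\<close>] by blast
    moreover have "0 \<le> f v" for v using nonneg[of f] \<open>f \<in> region P'\<close> by (simp add: R)
    ultimately show ?thesis using finX by (intro Min_eqI) (auto simp: image_iff)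
  qed
  have minin: "\<exists>x\<in>X. f x = Min ((\<lambda>x. f x) ` X)" for f :: "'a \<Rightarrow> real"
    using Min_in[of "(\<lambda>x. f x) ` X"] finX X by fastforce
  have minle: "Min ((\<lambda>x. f x) ` X) \<le> f x" if "x \<in> X" for f :: "'a \<Rightarrow> real" and x
    using that finX by (intro Min_le) auto
  show ?thesis
  proof (cases "X = A")
    case False
    then obtain y where y: "y \<in> A" "y \<notin> X" using X by blast
    \<comment> \<open>\<open>u\<close> has sum 0, so subtracting \<open>t f\<close> times
      \<open>u\<close> preserves the total weight: each coordinate in \<open>X\<close> loses the
      least of them, and \<open>y\<close> receives the sum. Some coordinate in \<open>X\<close>
      becomes 0, and where one is 0 already nothing moves.\<close>
    define t where "t f = Min ((\<lambda>x. f x) ` X)" for f :: "'a \<Rightarrow> real"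
    define u where "u v = (if v \<in> X then 1 else if v = y then - real (card X) else 0)" for v
    define r where "r f = (\<lambda>v. f v - t f * u v)" for f
    have sumu: "sum u A = 0"
    proof -
      have "sum u A = sum u X + sum u (A - X)"
        using sum.subset_diff[OF X(1) finA(1), of u] by simp
      also have "sum u (A - X) = sum u {y}"
        using y finA by (intro sum.mono_neutral_right) (auto simp: u_def)
      finally show ?thesis using y by (simp add: u_def)
    qed
    have rA: "r f \<in> closed_simplex A \<and> r f \<in> region P'" if f: "f \<in> closed_simplex A" for f
    proof -
      have f0: "0 \<le> f v" for v using f by (auto simp: closed_simplex_def)
      obtain x where x: "x \<in> X" "f x = t f" using minin[of f] by (auto simp: t_def)
      hence t0: "t f \<ge> 0" using f0[of x] by simp
      have "0 \<le> r f v" for v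
      proof (cases "v \<in> X")
        case True
        then show ?thesis using minle[of v f] by (simp add: r_def u_def t_def)
      next
        case False
        have "0 \<le> f v + t f * real (card X)" using f0[of v] t0 by simp
        then show ?thesis using False f0[of v] by (auto simp: r_def u_def)
      qed
      moreover have "r f v = 0" if "v \<notin> A" for v
        using that f X y by (auto simp: r_def u_def closed_simplex_def)
      moreover have "sum (r f) A = 1"
        using f sumu by (simp add: r_def sum_subtractf sum_distrib_left[symmetric] closed_simplex_def)
      ultimately have "r f \<in> closed_simplex A" by (auto simp: closed_simplex_def)
      moreover have "r f x = 0" using x by (simp add: r_def u_def)
      ultimately show ?thesis using bd x by blast
    qed
    have rP: "r f = f" if "f \<in> region P'" for f
      using zerom[OF that] by (simp add: r_def t_def)
    have rc: "continuous_on ?S (\<lambda>p. r (g p))"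
      unfolding r_def t_def
      by (intro continuous_on_coordinatewise_then_product continuous_intros gc continuous_on_Min_image finX X)
    show ?thesis
    proof (rule extendable_straight_line[OF g(1) rc])
      show "extendable d (insert A P') (\<lambda>p. r (g p))"
        using rc
      proof (rule extR)
        show "(\<lambda>p. r (g p)) ` ?S \<subseteq> region P'"
        proof (rule image_subsetI)
          fix p assume "p \<in> ?S"
          hence "g p \<in> closed_simplex A \<or> g p \<in> region P'" using gS R by blast
          thus "r (g p) \<in> region P'" using rA[of "g p"] rP[of "g p"] by auto
        qed
      qed
      fix p \<tau> assume p: "p \<in> ?S" "0 \<le> \<tau>" "\<tau> \<le> (1 :: real)"
      show "(\<lambda>v. (1 - \<tau>) * g p v + \<tau> * r (g p) v) \<in> ?R"
      proof (cases "g p \<in> closed_simplex A")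
        case True
        then show ?thesis using closed_simplex_convex[OF True, of "r (g p)" \<tau>] rA p by (auto simp: R)
      next
        case False
        hence "g p \<in> region P'" using gS[OF p(1)] by (auto simp: R)
        moreover have "(1 - \<tau>) * a + \<tau> * a = a" for a by (simp add: algebra_simps)
        ultimately show ?thesis using rP by (auto simp: R)
      qed
    qed
  next
    case True
    \<comment> \<open>The identity 8 \<epsilon> (n + 1) = 1 leaves room for \<open>c\<close>: if n
      coordinates lie between 4 \<epsilon> and 8 \<epsilon>, the remaining one is at least 8
      \<epsilon>.\<close>
    define \<epsilon> where "\<epsilon> = 1 / (8 * (real n + 1))"
    have \<epsilon>: "\<epsilon> > 0" by (simp add: \<epsilon>_def)
    have \<epsilon>n: "8 * \<epsilon> * (real n + 1) = 1" by (simp add: \<epsilon>_def)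
    obtain x0 where x0: "x0 \<in> A" using X True by blast
    define B where "B = A - {x0}"
    have B: "finite B" "card B = n" using finA x0 by (auto simp: B_def)
    have bd01: "0 \<le> g p x \<and> g p x \<le> 1" if "p \<in> ?S" for p x
    proof -
      from gS[OF that] obtain D where "D \<in> insert A P'" "g p \<in> closed_simplex D" by (auto simp: region_def)
      moreover from this have "finite D" using A P' facet by auto
      ultimately show ?thesis using closed_simplex_le_1[of "g p" D x] by (auto simp: closed_simplex_def)
    qed
    \<comment> \<open>Only the n coordinates in \<open>B\<close> are perturbed freely; the one at
      \<open>x0\<close> is fixed by the sum 1. Errors of \<epsilon> / (n + 1) keep its error, a sum
      of n of them, below \<epsilon>.\<close>
    have "4 * \<epsilon> > 0" "\<epsilon> / (real n + 1) > 0" using \<epsilon> by auto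
    from general_position[OF B d this, of "\<lambda>x p. g p x" "4 * \<epsilon>"] gc bd01 obtain q0 c0 where
      "\<forall>x\<in>B. continuous_on ?S (q0 x) \<and> (\<forall>p\<in>?S. \<bar>q0 x p - g p x\<bar> \<le> \<epsilon> / (real n + 1))"
      "\<forall>x\<in>B. 4 * \<epsilon> \<le> c0 x \<and> c0 x \<le> 4 * \<epsilon> + 4 * \<epsilon>"
      "\<forall>p\<in>?S. \<exists>x\<in>B. q0 x p \<noteq> c0 x"
      by blast
    hence q0: "\<And>x. x \<in> B \<Longrightarrow> continuous_on ?S (q0 x)"
      "\<And>x p. x \<in> B \<Longrightarrow> p \<in> ?S \<Longrightarrow> \<bar>q0 x p - g p x\<bar> \<le> \<epsilon> / (real n + 1)"
      "\<And>x. x \<in> B \<Longrightarrow> 4 * \<epsilon> \<le> c0 x \<and> c0 x \<le> 4 * \<epsilon> + 4 * \<epsilon>"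
      "\<And>p. p \<in> ?S \<Longrightarrow> \<exists>x\<in>B. q0 x p \<noteq> c0 x"
      by auto
    define q where "q p v = (if v \<in> B then q0 v p else if v = x0 then 1 - (\<Sum>x\<in>B. q0 x p) else 0)" for p v
    define c where "c v = (if v \<in> B then c0 v else if v = x0 then 1 - (\<Sum>x\<in>B. c0 x) else 0)" for v
    have sumA: "sum f A = f x0 + sum f B" for f :: "'a \<Rightarrow> real"
      using x0 finA by (simp add: B_def sum.remove)
    have x0B: "x0 \<notin> B" by (simp add: B_def)
    have AB: "A = insert x0 B" using x0 by (auto simp: B_def)
    have sumq: "sum (q p) A = 1" for p
      unfolding sumA using x0B by (simp add: q_def)
    have sumc: "sum c A = 1"
      unfolding sumA using x0B by (simp add: c_def)
    have cA: "4 * \<epsilon> \<le> c x" if "x \<in> A" for x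
    proof (cases "x \<in> B")
      case True
      then show ?thesis using q0(3) by (simp add: c_def)
    next
      case False
      hence "x = x0" using that AB by auto
      have "(\<Sum>x\<in>B. c0 x) \<le> (\<Sum>x\<in>B. 8 * \<epsilon>)" using q0(3) by (intro sum_mono) force
      also have "\<dots> = 1 - 8 * \<epsilon>" using \<epsilon>n B by (simp add: algebra_simps)
      finally show ?thesis using \<open>x = x0\<close> x0B \<epsilon> by (simp add: c_def)
    qed
    hence cpos: "c x > 0" if "x \<in> A" for x using that \<epsilon> by force
    have c_out: "c v = 0" if "v \<notin> A" for v using that AB by (simp add: c_def)
    have "0 \<le> c v" for v using cpos[of v] c_out[of v] by (cases "v \<in> A") auto
    hence cS: "c \<in> closed_simplex A"
      using sumc c_out unfolding closed_simplex_def by auto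
    have close: "\<bar>q p x - g p x\<bar> \<le> \<epsilon>" if p: "p \<in> ?S" "g p \<in> closed_simplex A" and x: "x \<in> A" for p x
    proof -
      have small: "\<bar>q0 x p - g p x\<bar> \<le> \<epsilon> / (real n + 1)" if "x \<in> B" for x
        using q0(2)[OF that p(1)] .
      show ?thesis
      proof (cases "x \<in> B")
        case True
        have "\<epsilon> / (real n + 1) \<le> \<epsilon>" using \<epsilon> by (simp add: field_simps)
        then show ?thesis using small[OF True] True by (simp add: q_def)
      next
        case False
        hence "x = x0" using x AB by auto
        have "g p x0 = 1 - (\<Sum>x\<in>B. g p x)" using p(2) sumA[of "g p"] by (simp add: closed_simplex_def)
        hence "q p x - g p x = (\<Sum>x\<in>B. g p x - q0 x p)"
          using \<open>x = x0\<close> x0B by (simp add: q_def sum_subtractf)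
        hence "\<bar>q p x - g p x\<bar> \<le> (\<Sum>x\<in>B. \<bar>g p x - q0 x p\<bar>)" by simp
        also have "\<dots> \<le> (\<Sum>x\<in>B. \<epsilon> / (real n + 1))"
          using small by (intro sum_mono) (simp add: abs_minus_commute)
        also have "\<dots> \<le> \<epsilon>" using B \<epsilon> by (simp add: field_simps)
        finally show ?thesis .
      qed
    qed
    define t where "t f = Min ((\<lambda>x. f x) ` A)" for f :: "'a \<Rightarrow> real"
    have tle: "t f \<le> f x" if "x \<in> A" for f x using minle[of x f] that True by (simp add: t_def)
    have tin: "\<exists>x\<in>A. f x = t f" for f using minin[of f] True by (simp add: t_def)
    have tP: "t f = 0" if "f \<in> region P'" for f using zerom[OF that] True by (simp add: t_def)
    \<comment> \<open>The cutoff is 0 where the least coordinate is at most 2 \<epsilon> and 1 where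
      it is at least 3 \<epsilon>. Where it is positive, an error of \<epsilon> cannot make a
      coordinate negative; and if \<open>g1 p = c\<close>, whose coordinates are at least 4
      \<epsilon>, those of \<open>g p\<close> are at least 3 \<epsilon>, so the perturbation is in
      full force there.\<close>
    define \<phi> where "\<phi> p = max 0 (min 1 ((t (g p) - 2 * \<epsilon>) / \<epsilon>))" for p
    have \<phi>01: "0 \<le> \<phi> p" "\<phi> p \<le> 1" for p by (auto simp: \<phi>_def)
    define g1 where "g1 p = (\<lambda>v. if v \<in> A then (1 - \<phi> p) * g p v + \<phi> p * q p v else g p v)" for p
    have A_ne: "A \<noteq> {}" using x0 by blast
    have \<phi>c: "continuous_on ?S \<phi>"
      unfolding \<phi>_def t_def using \<epsilon>
      by (intro continuous_intros continuous_on_Min_image finA A_ne gc) auto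
    have qc: "continuous_on ?S (\<lambda>p. q p v)" for v
      using q0(1) by (cases "v \<in> B"; cases "v = x0") (auto simp: q_def intro!: continuous_intros)
    have g1c: "continuous_on ?S g1"
    proof (rule continuous_on_coordinatewise_then_product)
      fix v show "continuous_on ?S (\<lambda>p. g1 p v)"
        by (cases "v \<in> A") (auto simp: g1_def intro!: continuous_intros gc qc \<phi>c)
    qed
    have g1P: "g1 p = g p" if "g p \<in> region P'" for p
    proof -
      have "\<phi> p = 0" using tP[OF that] \<epsilon> by (simp add: \<phi>_def)
      thus ?thesis by (auto simp: g1_def)
    qed
    have g1A: "g1 p \<in> closed_simplex A" if p: "p \<in> ?S" "g p \<in> closed_simplex A" for p
    proof (cases "\<phi> p = 0")
      case True
      hence "g1 p = g p" by (auto simp: g1_def)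
      thus ?thesis using p by simp
    next
      case False
      hence tp: "t (g p) > 2 * \<epsilon>"
        using \<epsilon> by (auto simp: \<phi>_def max_def min_def field_simps split: if_splits)
      have "0 \<le> q p x" if "x \<in> A" for x
        using tle[OF that, of "g p"] close[OF p that] tp \<epsilon> by (auto simp: abs_le_iff)
      moreover have q_out: "q p v = 0" if "v \<notin> A" for v using that AB by (simp add: q_def)
      ultimately have "0 \<le> q p v" for v by (cases "v \<in> A") auto
      hence "q p \<in> closed_simplex A" using sumq q_out unfolding closed_simplex_def by auto
      from closed_simplex_convex[OF p(2) this \<phi>01]
      have "(\<lambda>v. (1 - \<phi> p) * g p v + \<phi> p * q p v) \<in> closed_simplex A" .
      moreover have "g p v = 0 \<and> q p v = 0" if "v \<notin> A" for v
        using that p(2) AB by (auto simp: closed_simplex_def q_def)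
      hence "g1 p = (\<lambda>v. (1 - \<phi> p) * g p v + \<phi> p * q p v)" by (auto simp: g1_def)
      ultimately show ?thesis by simp
    qed
    have g1_ne: "g1 p \<noteq> c" if p: "p \<in> ?S" for p
    proof
      assume eq: "g1 p = c"
      show False
      proof (cases "g p \<in> closed_simplex A")
        case inA: True
        have "3 * \<epsilon> \<le> g p x" if x: "x \<in> A" for x
        proof -
          have "c x = g p x + \<phi> p * (q p x - g p x)"
            using fun_cong[OF eq, of x] x by (simp add: g1_def algebra_simps)
          moreover have "\<bar>\<phi> p * (q p x - g p x)\<bar> \<le> 1 * \<epsilon>"
            unfolding abs_mult using close[OF p inA x] \<phi>01 by (intro mult_mono) auto
          ultimately show ?thesis using cA[OF x] by (simp add: abs_le_iff)
        qed
        hence "3 * \<epsilon> \<le> t (g p)" using tin[of "g p"] by force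
        hence "\<phi> p = 1" using \<epsilon> by (simp add: \<phi>_def max_def min_def field_simps)
        hence "q0 x p = c0 x" if "x \<in> B" for x
          using fun_cong[OF eq, of x] that AB x0B by (auto simp: g1_def q_def c_def)
        thus False using q0(4)[OF p] by blast
      next
        case False
        hence gP: "g p \<in> region P'" using gS[OF p] by (auto simp: R)
        then obtain x where "x \<in> A" "g p x = 0" using zero True by blast
        thus False using eq g1P[OF gP] cpos[of x] by auto
      qed
    qed
    have g1R: "g1 p \<in> ?R" if "p \<in> ?S" for p
      using gS[OF that] g1A[OF that] g1P by (auto simp: R)
    \<comment> \<open>\<rho> is the gauge of the simplex centred at \<open>c\<close>: dividing f - c
      by it moves f along the ray from \<open>c\<close> until the first coordinate vanishes, so
      \<open>r\<close> is the radial projection to the boundary.\<close>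
    define \<rho> where "\<rho> f = 1 - Min ((\<lambda>x. f x / c x) ` A)" for f :: "'a \<Rightarrow> real"
    define r where "r f = (\<lambda>v. c v + (f v - c v) / \<rho> f)" for f
    have \<rho>ge: "1 - f x / c x \<le> \<rho> f" if "x \<in> A" for f x
      using Min_le[of "(\<lambda>x. f x / c x) ` A" "f x / c x"] finA that by (simp add: \<rho>_def)
    have \<rho>in: "\<exists>x\<in>A. 1 - f x / c x = \<rho> f" for f
      using Min_in[of "(\<lambda>x. f x / c x) ` A"] finA A_ne by (fastforce simp: \<rho>_def)
    have \<rho>P: "\<rho> f = 1" if f: "f \<in> region P'" for f
    proof -
      obtain x where x: "x \<in> A" "f x = 0" using zero[OF f] True by blast
      have "1 \<le> \<rho> f" using \<rho>ge[OF x(1), of f] x by simp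
      moreover obtain x' where x': "x' \<in> A" "1 - f x' / c x' = \<rho> f" using \<rho>in by blast
      moreover have "0 \<le> f x' / c x'"
        using nonneg[of f x'] f cpos[OF x'(1)] by (simp add: R)
      ultimately show ?thesis by linarith
    qed
    \<comment> \<open>If \<rho> were not positive, f would be at least c in every coordinate, and
      equal sums would force f = c.\<close>
    have \<rho>A: "\<rho> f > 0" if f: "f \<in> closed_simplex A" "f \<noteq> c" for f
    proof (rule ccontr)
      assume no: "\<not> \<rho> f > 0"
      have le: "c x \<le> f x" if "x \<in> A" for x
      proof -
        have "1 \<le> f x / c x" using \<rho>ge[OF that, of f] no by linarith
        thus ?thesis using cpos[OF that] by (simp add: pos_le_divide_eq)
      qed
      have "f x = c x" if "x \<in> A" for x
      proof (rule ccontr)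
        assume "f x \<noteq> c x"
        hence "c x < f x" using le[OF that] by simp
        hence "sum c A < sum f A" using le that finA by (intro sum_strict_mono_ex1) auto
        thus False using f sumc by (simp add: closed_simplex_def)
      qed
      moreover have "f x = c x" if "x \<notin> A" for x using that f cS by (simp add: closed_simplex_def)
      ultimately show False using f(2) by blast
    qed
    have rP: "r f = f" if "f \<in> region P'" for f using \<rho>P[OF that] by (simp add: r_def)
    have rA: "r f \<in> closed_simplex A \<and> r f \<in> region P'" if f: "f \<in> closed_simplex A" "f \<noteq> c" for f
    proof -
      have pos: "\<rho> f > 0" using \<rho>A[OF f] .
      have rx: "r f v = (f v - (1 - \<rho> f) * c v) / \<rho> f" for v
        using pos by (simp add: r_def field_simps)
      have out: "r f v = 0" if "v \<notin> A" for v using that f cS by (simp add: r_def closed_simplex_def)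
      have "0 \<le> r f v" for v
      proof (cases "v \<in> A")
        case True
        have "(1 - f v / c v) * c v \<le> \<rho> f * c v"
          using \<rho>ge[OF True, of f] cpos[OF True] by (intro mult_right_mono) auto
        hence "0 \<le> f v - (1 - \<rho> f) * c v" using cpos[OF True] by (simp add: algebra_simps)
        thus ?thesis unfolding rx using pos by simp
      qed (simp add: out)
      moreover have "sum (r f) A = 1"
        using f sumc by (simp add: r_def sum.distrib sum_subtractf sum_divide_distrib[symmetric] closed_simplex_def)
      ultimately have rS: "r f \<in> closed_simplex A" using out by (auto simp: closed_simplex_def)
      obtain x where x: "x \<in> A" "1 - f x / c x = \<rho> f" using \<rho>in by blast
      have "r f x = 0" unfolding rx x(2)[symmetric] using cpos[OF x(1)] by simp
      thus ?thesis using rS bd[OF rS] x True by blast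
    qed
    have \<rho>pos: "\<rho> (g1 p) > 0" if "p \<in> ?S" for p
      using g1R[OF that] g1_ne[OF that] \<rho>A \<rho>P by (auto simp: R)
    have g1vc: "continuous_on ?S (\<lambda>p. g1 p v)" for v
      using g1c by (rule continuous_on_product_then_coordinatewise)
    have rc: "continuous_on ?S (\<lambda>p. r (g1 p))"
    proof (rule continuous_on_coordinatewise_then_product)
      fix v
      have "continuous_on ?S (\<lambda>p. \<rho> (g1 p))"
        unfolding \<rho>_def using cpos
        by (intro continuous_intros continuous_on_Min_image finA A_ne g1vc) force
      moreover have "\<forall>p\<in>?S. \<rho> (g1 p) \<noteq> 0" using \<rho>pos by force
      ultimately show "continuous_on ?S (\<lambda>p. r (g1 p) v)"
        unfolding r_def by (intro continuous_intros g1vc)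
    qed
    have const: "(\<lambda>v. (1 - \<tau>) * f v + \<tau> * f v) = f" for f :: "'a \<Rightarrow> real" and \<tau>
      by (simp add: algebra_simps)
    have "extendable d (insert A P') g1"
    proof (rule extendable_straight_line[OF g1c rc])
      show "extendable d (insert A P') (\<lambda>p. r (g1 p))"
        using rc
      proof (rule extR)
        show "(\<lambda>p. r (g1 p)) ` ?S \<subseteq> region P'"
        proof (rule image_subsetI)
          fix p assume p: "p \<in> ?S"
          hence "g1 p \<in> closed_simplex A \<or> g1 p \<in> region P'" using g1R R by blast
          thus "r (g1 p) \<in> region P'" using rA[of "g1 p"] rP[of "g1 p"] g1_ne[OF p] by auto
        qed
      qed
      fix p \<tau> assume p: "p \<in> ?S" "0 \<le> \<tau>" "\<tau> \<le> (1 :: real)"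
      show "(\<lambda>v. (1 - \<tau>) * g1 p v + \<tau> * r (g1 p) v) \<in> ?R"
      proof (cases "g1 p \<in> closed_simplex A")
        case inA: True
        then show ?thesis
          using closed_simplex_convex[OF inA, of "r (g1 p)" \<tau>] rA[OF inA g1_ne[OF p(1)]] p by (simp add: R)
      next
        case False
        hence gP: "g1 p \<in> region P'" using g1R[OF p(1)] by (auto simp: R)
        show ?thesis unfolding rP[OF gP] const using g1R[OF p(1)] .
      qed
    qed
    thus ?thesis
    proof (rule extendable_straight_line[OF g(1) g1c, rotated])
      fix p \<tau> assume p: "p \<in> ?S" "0 \<le> \<tau>" "\<tau> \<le> (1 :: real)"
      show "(\<lambda>v. (1 - \<tau>) * g p v + \<tau> * g1 p v) \<in> ?R"
      proof (cases "g p \<in> closed_simplex A")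
        case inA: True
        then show ?thesis
          using closed_simplex_convex[OF inA g1A[OF p(1) inA] p(2,3)] by (simp add: R)
      next
        case False
        hence gP: "g p \<in> region P'" using gS[OF p(1)] by (auto simp: R)
        show ?thesis unfolding g1P[OF gP] const using gS[OF p(1)] .
      qed
    qed
  qed
qed

text \<open>Remove a facet \<open>A\<close> of maximal height, which leaves a lower set
  \<open>P'\<close>. For each \<open>B\<close> in \<open>P'\<close>, shelling provides a facet of
  \<open>P'\<close> containing \<open>A\<close> without some vertex outside \<open>B\<close>. So
  \<open>A\<close> meets the rest exactly in the points with a vanishing coordinate in
  \<open>X\<close>, as \<open>push_off_top\<close> requires.\<close>

lemma extendable_lower_set:
  assumes "finite P" "P \<noteq> {}" "P \<subseteq> F" "\<And>A B. A \<in> P \<Longrightarrow> B \<in> F \<Longrightarrow> height B < height A \<Longrightarrow> B \<in> P"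
    and "d \<le> n" "continuous_on (sphere_d d) g" "g ` sphere_d d \<subseteq> region P"
  shows "extendable d P g"
  using assms
proof (induction P arbitrary: g rule: finite_psubset_induct)
  case (psubset P)
  have "Max (height ` P) \<in> height ` P" using psubset by (intro Max_in) auto
  then obtain A where A: "A \<in> P" "height A = Max (height ` P)" by auto
  hence A: "A \<in> P" "\<And>B. B \<in> P \<Longrightarrow> height B \<le> height A"
    using psubset.hyps by auto
  hence AF: "A \<in> F" using psubset by blast
  define P' where "P' = P - {A}"
  have P: "P = insert A P'" using A by (auto simp: P'_def)
  show ?case
  proof (cases "P' = {}")
    case True
    then show ?thesis using extendable_simplex[OF AF] psubset.prems P by auto
  next
    case False
    define X where "X = {x \<in> A. \<exists>D\<in>P'. A - {x} \<subseteq> D}"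
    have sh: "\<exists>x\<in>X. x \<notin> B" if B: "B \<in> P'" for B
    proof -
      obtain D x where D: "D \<in> F" "height D < height A" "x \<in> A - B" "A - {x} \<subseteq> D"
        using shelling[OF AF, of B] B A psubset.prems by (auto simp: P'_def)
      hence "D \<in> P'" using A psubset.prems by (auto simp: P'_def)
      thus ?thesis using D by (auto simp: X_def)
    qed
    show ?thesis
      unfolding P
    proof (rule push_off_top[OF AF])
      show "X \<noteq> {}" using False sh by blast
      show "f \<in> region P'" if f: "f \<in> closed_simplex A" "x \<in> X" "f x = 0" for f x
      proof -
        obtain D where D: "D \<in> P'" "A - {x} \<subseteq> D" "x \<in> A" using f by (auto simp: X_def)
        have "finite A" "finite D" using facet[OF AF] facet[of D] D P psubset.prems by auto
        moreover have "f \<in> closed_simplex (A - {x})"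
          using f \<open>finite A\<close> D by (auto simp: closed_simplex_def sum.remove[of A x])
        ultimately have "f \<in> closed_simplex D" using closed_simplex_mono[OF D(2)] by blast
        thus ?thesis using D by (auto simp: region_def)
      qed
      show "\<exists>x\<in>X. f x = 0" if "f \<in> region P'" for f
        using that sh by (force simp: region_def closed_simplex_def)
      show "extendable d P' g'" if "continuous_on (sphere_d d) g'" "g' ` sphere_d d \<subseteq> region P'" for g'
      proof (rule psubset.IH)
        show "P' \<subset> P" using A by (auto simp: P'_def)
        show "B \<in> P'" if "C \<in> P'" "B \<in> F" "height B < height C" for C B
          using that psubset.prems(3)[of C B] A(2)[of C] by (auto simp: P'_def)
      qed (use False psubset.prems that in \<open>auto simp: P'_def\<close>)
      show "P' \<subseteq> F" "A \<notin> P'" using psubset.prems(2) by (auto simp: P'_def)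
      show "X \<subseteq> A" by (auto simp: X_def)
      show "g ` sphere_d d \<subseteq> region (insert A P')" using psubset.prems(6) P by simp
    qed (rule psubset.prems)+
  qed
qed

theorem k_connected_shelled:
  "k_connected (geom_top {A. A \<noteq> {} \<and> (\<exists>B\<in>F. A \<subseteq> B)}) (int n - 1)"
  unfolding k_connected_def
proof (intro allI impI)
  let ?K = "{A. A \<noteq> {} \<and> (\<exists>B\<in>F. A \<subseteq> B)}"
  fix d :: nat and g
  assume d: "int d \<le> int n - 1 + 1" and g: "continuous_map (top_of_set (sphere_d d)) (geom_top ?K) g"
  define Q where "Q N = {A \<in> F. height A \<le> N}" for N
  have "\<exists>N. g ` sphere_d d \<subseteq> region (Q N)"
  proof (rule geom_top_compact_image[OF compact_sphere_d g])
    fix s assume "s \<in> ?K"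
    then obtain B where B: "B \<in> F" "s \<subseteq> B" by blast
    hence "closed_simplex s \<subseteq> closed_simplex B" using facet by (intro closed_simplex_mono) auto
    thus "\<exists>N. \<forall>k\<ge>N. closed_simplex s \<subseteq> region (Q k)"
      using B by (intro exI[of _ "height B"]) (auto simp: region_def Q_def)
  qed
  then obtain N where N: "g ` sphere_d d \<subseteq> region (Q N)" by blast
  obtain A0 where A0: "A0 \<in> F" using nonempty by blast
  \<comment> \<open>The maximum with \<open>height A0\<close> keeps \<open>P\<close> nonempty. For d
    = 0 the sphere is empty and the bound \<open>N\<close> alone would not ensure this.\<close>
  define P where "P = Q (max N (height A0))"
  have P: "finite P" "P \<noteq> {}" "P \<subseteq> F"
    using finite_height A0 by (auto simp: P_def Q_def)
  have "Q N \<subseteq> P" by (auto simp: P_def Q_def)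
  hence gP: "g ` sphere_d d \<subseteq> region P" using N unfolding region_def by blast
  have gc: "continuous_on (sphere_d d) g"
    using continuous_map_compose[OF g continuous_map_geom_top_euclidean]
    by (simp add: o_def)
  have "extendable d P g"
    by (rule extendable_lower_set[OF P _ _ gc gP]) (use d in \<open>auto simp: P_def Q_def\<close>)
  then obtain h where h: "continuous_on (disk_d d) h" "h ` disk_d d \<subseteq> region P" "\<forall>x\<in>sphere_d d. h x = g x"
    by (auto simp: extendable_def)
  have "B \<noteq> {}" if "B \<in> F" for B using facet[OF that] by auto
  hence "P \<subseteq> ?K" using P(3) by blast
  hence "continuous_map (top_of_set (disk_d d)) (geom_top ?K) h"
    using h P facet unfolding region_def by (intro continuous_map_into_geom_top[of _ _ P]) auto
  with h show "\<exists>h. continuous_map (top_of_set (disk_d d)) (geom_top ?K) h \<and> (\<forall>x\<in>sphere_d d. h x = g x)"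
    by blast
qed

end

section \<open>Links and the conclusion\<close>

text \<open>For facets A' and B' containing \<open>C\<close>, the shelling yields D containing A'
  without a vertex x outside B'. Then x is not in \<open>C\<close>, so D contains \<open>C\<close>
  as well, and \<open>C\<close> can be subtracted throughout. The facets left have n - p
  vertices.\<close>

lemma shelled_complex_link:
  fixes height :: "'a set \<Rightarrow> nat"
  assumes "shelled_complex F height n" and C: "C \<subseteq> B" "B \<in> F" and p: "card C = p + 1" "p < n"
  shows "shelled_complex {A - C | A. A \<in> F \<and> C \<subseteq> A} (\<lambda>A. height (A \<union> C)) (n - p - 1)"
proof -
  interpret shelled_complex F height n by fact
  have un: "A - C \<union> C = A" if "C \<subseteq> A" for A using that by blast
  show ?thesis
  proof
    show "{A - C | A. A \<in> F \<and> C \<subseteq> A} \<noteq> {}" using C by blast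
  next
    fix A assume "A \<in> {A - C | A. A \<in> F \<and> C \<subseteq> A}"
    then obtain A' where A': "A = A' - C" "A' \<in> F" "C \<subseteq> A'" by blast
    hence "finite A'" "card A' = Suc n" "finite C" using facet finite_subset by blast+
    thus "finite A \<and> card A = Suc (n - p - 1)"
      using A' p by (simp add: card_Diff_subset)
  next
    fix N
    show "finite {A \<in> {A - C | A. A \<in> F \<and> C \<subseteq> A}. height (A \<union> C) \<le> N}"
    proof (rule finite_subset)
      show "{A \<in> {A - C | A. A \<in> F \<and> C \<subseteq> A}. height (A \<union> C) \<le> N} \<subseteq> (\<lambda>A. A - C) ` {A \<in> F. height A \<le> N}"
        using un by (auto simp: sup_absorb1 intro!: imageI)
    qed (intro finite_imageI finite_height)
  next
    fix A B
    assume "A \<in> {A - C | A. A \<in> F \<and> C \<subseteq> A}" "B \<in> {A - C | A. A \<in> F \<and> C \<subseteq> A}" "A \<noteq> B"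
      and le: "height (B \<union> C) \<le> height (A \<union> C)"
    then obtain A' B' where A': "A = A' - C" "A' \<in> F" "C \<subseteq> A'" and B': "B = B' - C" "B' \<in> F" "C \<subseteq> B'"
      by blast
    have "A' \<noteq> B'" "height B' \<le> height A'" using A' B' le \<open>A \<noteq> B\<close> un by auto
    then obtain D x where D: "D \<in> F" "height D < height A'" "x \<in> A' - B'" "A' - {x} \<subseteq> D"
      using shelling[OF A'(2) B'(2)] by blast
    hence "C \<subseteq> D" using A' B' by blast
    hence "D - C \<in> {A - C | A. A \<in> F \<and> C \<subseteq> A}" "height (D - C \<union> C) < height (A \<union> C)"
      using D un[of D] un[of A'] A' by auto
    moreover have "x \<in> A - B" "A - {x} \<subseteq> D - C" using D A' B' by auto
    ultimately show "\<exists>D\<in>{A - C | A. A \<in> F \<and> C \<subseteq> A}. height (D \<union> C) < height (A \<union> C) \<and> (\<exists>x\<in>A - B. A - {x} \<subseteq> D)"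
      by blast
  qed
qed

lemma link_pure_complex:
  "link {A. A \<noteq> {} \<and> (\<exists>B\<in>F. A \<subseteq> B)} C =
         {A. A \<noteq> {} \<and> (\<exists>B\<in>{A - C | A. A \<in> F \<and> C \<subseteq> A}. A \<subseteq> B)}"
proof (intro set_eqI iffI)
  fix D assume "D \<in> link {A. A \<noteq> {} \<and> (\<exists>B\<in>F. A \<subseteq> B)} C"
  then obtain B where "D \<noteq> {}" "D \<inter> C = {}" "B \<in> F" "D \<union> C \<subseteq> B"
    unfolding link_def by auto
  moreover from this have "D \<subseteq> B - C" "B - C \<in> {A - C | A. A \<in> F \<and> C \<subseteq> A}" by auto
  ultimately show "D \<in> {A. A \<noteq> {} \<and> (\<exists>B\<in>{A - C | A. A \<in> F \<and> C \<subseteq> A}. A \<subseteq> B)}"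
    unfolding mem_Collect_eq[of D] by (metis (no_types, lifting))
next
  fix D assume "D \<in> {A. A \<noteq> {} \<and> (\<exists>B\<in>{A - C | A. A \<in> F \<and> C \<subseteq> A}. A \<subseteq> B)}"
  then obtain B where "D \<noteq> {}" "D \<subseteq> B - C" "C \<subseteq> B" "B \<in> F" by auto
  moreover from this have "D \<subseteq> B" "D \<union> C \<subseteq> B" "D \<inter> C = {}" by auto
  ultimately show "D \<in> link {A. A \<noteq> {} \<and> (\<exists>B\<in>F. A \<subseteq> B)} C"
    unfolding link_def by auto
qed

theorem theorem4p5:
  fixes V :: "'g set" and s1 :: 'g and m :: "'g \<Rightarrow> 'g \<Rightarrow> enat" and n :: nat
  assumes "finite V" and "s1 \<in> V"
    and "\<forall>a\<in>V. m a a = 1"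
    and "\<forall>a\<in>V. \<forall>b\<in>V. m a b = m b a"
    and "\<forall>a\<in>V. \<forall>b\<in>V. a \<noteq> b \<longrightarrow> 2 \<le> m a b"
  shows "k_connected (geom_top (Cn V s1 m n)) (int n - 1) \<and>
         (\<forall>C\<in>Cn V s1 m n. \<forall>p::nat. card C = p + 1 \<longrightarrow>
            k_connected (geom_top (link (Cn V s1 m n) C)) (int n - int p - 2))"
proof -
  interpret coxeter_chain V s1 m n using assms by unfold_locales
  interpret shelled_complex facets flen n
  proof
    show "facets \<noteq> {}" by (auto simp: facets_def)
  qed (use facet_finite_card finite_flen_le facets_shelling in auto)
  have "k_connected (geom_top (link (Cn V s1 m n) C)) (int n - int p - 2)"
    if C: "C \<in> Cn V s1 m n" "card C = p + 1" for C p
  proof -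
    obtain B where B: "B \<in> facets" "C \<subseteq> B" "C \<noteq> {}" using C by (auto simp: Cn_eq)
    hence "card C \<le> Suc n" using facet_finite_card[of B] card_mono[of B C] by auto
    hence "p \<le> n" using C by simp
    show ?thesis
    proof (cases "p = n")
      \<comment> \<open>The link of an n-simplex is empty, and the claim is (-2)-connectedness,
        which is vacuous.\<close>
      case True
      then show ?thesis by (simp add: k_connected_def)
    next
      case False
      hence "p < n" using \<open>p \<le> n\<close> by simp
      interpret L: shelled_complex "{A - C | A. A \<in> facets \<and> C \<subseteq> A}" "\<lambda>A. flen (A \<union> C)" "n - p - 1"
        using B C \<open>p < n\<close> shelled_complex_axioms by (intro shelled_complex_link[of facets flen n C B p])
      have "int (n - p - 1) - 1 = int n - int p - 2" using \<open>p < n\<close> by simp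
      thus ?thesis using L.k_connected_shelled by (simp add: Cn_eq link_pure_complex)
    qed
  qed
  thus ?thesis using k_connected_shelled by (simp add: Cn_eq)
qed

end
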